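(* Suppose that the approximate solutions $\{\mathbf U_h=(\varrho_h(t),\mathbf m_h(t))\}_{h>0}$ of the scheme (S) (described in the context) for the stochastic barotropic compressible Euler system generate a dissipative measure-valued martingale solution $[(\Omega,\mathbb F,(\mathbb F_t)_{t\ge0},\mathbb P);\mathcal V^\omega_{t,x},W]$. Then the following hold. 1. There exists a subsequence $\{\mathbf U_{h_k}=(\varrho_{h_k}(t),\mathbf m_{h_k}(t))\}_{h_k>0}$ such that, $\mathbb P$-a.s., $$\varrho_{h_k}\to\langle\mathcal V^\omega_{t,x};\varrho\rangle\ \text{ in } C_w([0,T];L^\gamma(\mathbb T^3)),\qquad \mathbf m_{h_k}\to\langle\mathcal V^\omega_{t,x};\mathbf m\rangle\ \text{ in } C_w([0,T];L^{\frac{2\gamma}{\gamma+1}}(\mathbb T^3)).$$ 2. $\mathbb P$-a.s., there exists a subsequence $\{\mathbf U_{h_k}=(\varrho_{h_k}(t),\mathbf m_{h_k}(t))\}_{h_k>0}$ such that, as $N\to\infty$, $$\frac1N\sum_{k=1}^N\varrho_{h_k}\to\langle\mathcal V^\omega_{t,x};\varrho\rangle,\qquad \frac1N\sum_{k=1}^N\mathbf m_{h_k}\to\langle\mathcal V^\omega_{t,x};\mathbf m\rangle\qquad\text{a.e. in }(0,T)\times\mathbb T^3.$$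
   Context: **Equations.** $\mathbb T^3$ is the flat torus identified with $[0,\ell]^3$, $T>0$, $\gamma>1$, $p(\varrho)=\varrho^\gamma$, $P(\varrho)=\varrho^\gamma/(\gamma-1)$. The stochastic barotropic compressible Euler system for density $\varrho$ and momentum $\mathbf m$ on $(0,T)\times\mathbb T^3$ is $$d\varrho+\mathrm{div}\,\mathbf m\,dt=0,\qquad d\mathbf m+\Big[\mathrm{div}\Big(\tfrac{\mathbf m\otimes\mathbf m}{\varrho}\Big)+\nabla p(\varrho)\Big]dt=\Psi(\varrho,\mathbf m)\,dW,\qquad (\varrho,\mathbf m)(0)=(\varrho_0,\mathbf m_0).$$ **Noise.** $(\Omega,\mathbb F,(\mathbb F_t)_{t\ge0},\mathbb P)$ is a stochastic basis with complete right-continuous filtration; $W=\sum_{k\ge1}e_kW_k$ is an $(\mathbb F_t)$-cylindrical Wiener process in a separable Hilbert space $\mathfrak W$ with orthonormal basis $(e_k)$ and independent real Brownian motions $W_k$. $\mathfrak W_0\supset\mathfrak W$ is the space of $u=\sum_k\beta_ke_k$ with $\|u\|_{\mathfrak W_0}^2=\sum_k\beta_k^2/k^2<\infty$; $W\in C([0,T];\mathfrak W_0)$ a.s. $\Psi(\varrho,\mathbf m)e_k=\Psi_k(\cdot,\varrho(\cdot),\mathbf m(\cdot))$, where $\Psi_k:\mathbb T^3\times\mathbb R\times\mathbb R^3\to\mathbb R^3$ are $C^1$ and, uniformly in $x\in\mathbb T^3$, $\Psi_k(\cdot,0,0)=0$ and $|\partial_\varrho\Psi_k|+|\nabla_{\mathbf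 m}\Psi_k|\le\beta_k$ with constants $\beta_k$, $\sum_k\beta_k<\infty$. Stochastic integrals are $\int_0^t\Psi\,dW=\sum_k\int_0^t\Psi_k\,dW_k$. **Scheme (S).** $\mathcal T$ is the uniform periodic grid of $[0,\ell]^3$ by cubes $K$ of side $h$ ($\ell/h$ an integer). Functions with subscript $h$ are constant on each $K$, with value denoted by subscript $K$. Let $\mathbf e_1,\mathbf e_2,\mathbf e_3$ be the coordinate unit vectors, $K\pm h\mathbf e_p$ the neighbouring cells, and $$(\widetilde{\partial^p_h}w_h)_K=\frac{w_{K+h\mathbf e_p}-w_{K-h\mathbf e_p}}{2h},\quad (\widetilde{\mathrm{div}_h}\mathbf w_h)_K=\sum_{p=1}^3(\widetilde{\partial_h^p}w_h^p)_K,\quad (\Delta_hw_h)_K=\frac1{h^2}\sum_{L}(w_L-w_K),$$ the last sum over the six neighbours $L$ of $K$. With $p_h=p(\varrho_h)$, the scheme is the system of stochastic differential equations, for $t>0$, $K\in\mathcal T$, $$d\varrho_K+\big[(\widetilde{\mathrm{div}_h}\mathbf m_h)_K-\lambda h(\Delta_h\varrho_h)_K\big]dt=0,$$ $$d\mathbf m_K+\Big[\Big(\widetilde{\mathrm{div}_h}\Big(\tfrac{\mathbf m_h\otimes\mathbf m_h}{\varrho_h}+p_h\mathbb I\Big)\Big)_K-\lambda h(\Delta_h\mathbf m_h)_K\Big]dt=\Psi(\varrho_K,\mathbf m_K)\,dW,$$ with $(\varrho_K,\mathbf m_K)(0)=\frac1{h^3}\int_K(\varrho_0,\mathbf m_0)\,dx$.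 Here $\Psi_k(\varrho_K,\mathbf m_K)$ is understood as the average over $x\in K$ of $\Psi_k(x,\varrho_K,\mathbf m_K)$, and $\lambda=\max_{K}\max_s|\lambda^s(\mathbf U_K)|$, where $\lambda^s$ are the eigenvalues of the Jacobian (in the coordinate directions) of the flux $f(\varrho,\mathbf m)=[\mathbf m,\ \mathbf m\otimes\mathbf m/\varrho+p(\varrho)\mathbb I]$. The initial datum $(\varrho_0,\mathbf m_0)$ is $\mathbb F_0$-measurable with values in $L^\gamma(\mathbb T^3)\times L^{2\gamma/(\gamma+1)}(\mathbb T^3)$. **Dissipative measure-valued martingale solution.** Let $\mathcal M=\{[\varrho,\mathbf m]:\varrho\ge0,\mathbf m\in\mathbb R^3\}$, $\mathcal P(E)$ the Borel probability measures on $E$, $\mathcal M_b(E)$ the bounded Borel measures, $\langle\mathcal V;F\rangle=\int F\,d\mathcal V$, and let $\varrho,\mathbf m$ inside brackets denote the integration variables. $L^\infty_{w^*}$ denotes weakly-$*$ measurable essentially bounded maps. Let $\Lambda$ be a Borel probability measure on $L^\gamma(\mathbb T^3)\times L^{2\gamma/(\gamma+1)}(\mathbb T^3)$. $[(\Omega,\mathbb F,(\mathbb F_t)_{t\ge0},\mathbb P);\mathcal V^\omega_{t,x},W]$ is a dissipative measure-valued martingale solution with initial condition $\mathcal V^\omega_{0,x}$ if: 1. $\mathcal V^\omega$ is a random variable with values in $L^\infty_{w^*}([0,T]\times\mathbb T^3;\mathcal P(\mathcal M))$. 2. $(\Omega,\mathbb F,(\mathbb F_t),\mathbb P)$ is a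 stochastic basis with complete right-continuous filtration. 3. $W$ is an $(\mathbb F_t)$-cylindrical Wiener process. 4. For all $\varphi\in C^\infty(\mathbb T^3)$, $t\mapsto\int_{\mathbb T^3}\langle\mathcal V^\omega_{t,x};\varrho\rangle\varphi\,dx$ is in $C[0,T]$ a.s. and progressively measurable, and $\mathbb E[\sup_{t\in(0,T)}\|\langle\mathcal V^\omega_{t,\cdot};\varrho\rangle\|_{L^\gamma}^q]<\infty$ for all $1\le q<\infty$. 5. For all $\boldsymbol\varphi\in C^\infty(\mathbb T^3;\mathbb R^3)$, $t\mapsto\int_{\mathbb T^3}\langle\mathcal V^\omega_{t,x};\mathbf m\rangle\cdot\boldsymbol\varphi\,dx$ is in $C[0,T]$ a.s. and progressively measurable, and $\mathbb E[\sup_{t\in(0,T)}\|\langle\mathcal V^\omega_{t,\cdot};\mathbf m\rangle\|_{L^{2\gamma/(\gamma+1)}}^q]<\infty$ for all $1\le q<\infty$. 6. $\Lambda$ is the law of $\mathcal V^\omega_{0,x}$, i.e. $\mathcal V^\omega_{0,x}=\delta_{(\varrho_0(x),\mathbf m_0(x))}$ with $(\varrho_0,\mathbf m_0)$ of law $\Lambda$. 7. A.s., for all $\tau\in[0,T)$, $\varphi\in C^\infty(\mathbb T^3)$: $\int\langle\mathcal V^\omega_{\tau,x};\varrho\rangle\varphi\,dx-\int\langle\mathcal V^\omega_{0,x};\varrho\rangle\varphi\,dx=\int_0^\tau\int\langle\mathcal V^\omega_{t,x};\mathbf m\rangle\cdot\nabla\varphi\,dx\,dt$. 8. A.s., for all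 $\tau\in[0,T)$, $\boldsymbol\varphi\in C^\infty(\mathbb T^3;\mathbb R^3)$: $$\int\langle\mathcal V^\omega_{\tau,x};\mathbf m\rangle\cdot\boldsymbol\varphi\,dx-\int\langle\mathcal V^\omega_{0,x};\mathbf m\rangle\cdot\boldsymbol\varphi\,dx=\int_0^\tau\!\!\int\Big[\Big\langle\mathcal V^\omega_{t,x};\tfrac{\mathbf m\otimes\mathbf m}{\varrho}\Big\rangle:\nabla\boldsymbol\varphi+\langle\mathcal V^\omega_{t,x};p(\varrho)\rangle\mathrm{div}\boldsymbol\varphi\Big]dx\,dt+\int\boldsymbol\varphi\cdot\int_0^\tau\langle\mathcal V^\omega_{t,x};\Psi(\varrho,\mathbf m)\rangle dW\,dx+\int_0^\tau\!\!\int\nabla\boldsymbol\varphi:d\mu_m,$$ where a.s. $\mu_m\in L^\infty_{w^*}([0,T];\mathcal M_b(\mathbb T^3))$ is a tensor-valued measure. 9. There is a real-valued martingale $M_E$ such that a.s., for all $0\le s<t$ in $(0,T)$, $$\mathrm E(t+)\le\mathrm E(s-)+\frac12\int_s^t\int_{\mathbb T^3}\sum_{k\ge1}\langle\mathcal V^\omega_{\tau,x};\varrho^{-1}|\Psi_k(\varrho,\mathbf m)|^2\rangle dx\,d\tau+\frac12\int_s^t\int_{\mathbb T^3}d\mu_e+\int_s^tdM_E,$$ where $\mathrm E(t\mp)$ is the limit as $\tau\to0+$ of the averages over $(t-\tau,t)$, respectively $(t,t+\tau)$, of $s\mapsto\int_{\mathbb T^3}\langle\mathcal V^\omega_{s,x};\frac12\frac{|\mathbf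 m|^2}{\varrho}+P(\varrho)\rangle dx+\mathcal D(s)$, and $\mathrm E(0-)=\int_{\mathbb T^3}(\frac12\frac{|\mathbf m_0|^2}{\varrho_0}+P(\varrho_0))dx$; a.s. $\mu_e\in L^\infty_{w^*}([0,T];\mathcal M_b(\mathbb T^3))$, $\mathcal D\in L^\infty(0,T)$, $\mathcal D\ge0$. 10. There is a constant $C>0$ such that a.s., for every $\tau\in(0,T)$, $\int_0^\tau\int d|\mu_m|+\int_0^\tau\int d|\mu_e|\le C\int_0^\tau\mathcal D(t)\,dt$. **Generates.** $\{\mathbf U_h\}$ generates the solution $[(\widetilde\Omega,\widetilde{\mathbb F},(\widetilde{\mathbb F}_t),\widetilde{\mathbb P});\mathcal V^\omega_{t,x},\widetilde W]$ if, along a subsequence $h\to0$, there are random variables $\widetilde{\mathbf U}_h=(\widetilde\varrho_h,\widetilde{\mathbf m}_h)$ on $\widetilde\Omega$ such that $(\widetilde{\mathbf U}_h,\widetilde W)$ has the same law as $(\mathbf U_h,W)$ for each $h$ and, $\widetilde{\mathbb P}$-a.s., $\delta_{\widetilde{\mathbf U}_h}\to\mathcal V^\omega$ weakly-$*$ in $L^\infty_{w^*}((0,T)\times\mathbb T^3;\mathcal P(\mathbb R^4))$ and $(\widetilde\varrho_h,\widetilde{\mathbf m}_h)$ converges in $C_w([0,T];L^\gamma(\mathbb T^3))\times C_w([0,T];L^{2\gamma/(\gamma+1)}(\mathbb T^3))$ ($C_w$: weakly continuous functions). In the claim the tildes are dropped: $(\varrho_h,\mathbf m_h)$ denotes these representatives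 on the probability space of the generated solution. The approximate densities are positive, and the a priori energy bounds hold uniformly in $h$: $\mathbf m_h/\sqrt{\varrho_h}$ is bounded in $L^q(\Omega;L^\infty(0,T;L^2(\mathbb T^3)))$, $\varrho_h$ in $L^q(\Omega;L^\infty(0,T;L^\gamma(\mathbb T^3)))$, $\mathbf m_h$ in $L^q(\Omega;L^\infty(0,T;L^{2\gamma/(\gamma+1)}(\mathbb T^3)))$, $1\le q<\infty$. *)

theory Defs
  imports "HOL-Probability.Probability"
begin

text \<open>
  A state is a pair of a density and a momentum.  The torus is represented by the half-open cube
  \<open>[0,l)\<close> to the power three; functions that are differentiated or shifted are \<open>l\<close>-periodic
  functions on the whole space, and integrals are taken over the cube.
\<close>

type_synonym state = "real \<times> (real^3)"

definition torus :: "real \<Rightarrow> (real^3) set" where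
  "torus l = {x. \<forall>i. 0 \<le> x $ i \<and> x $ i < l}"

definition periodic :: "real \<Rightarrow> (real^3 \<Rightarrow> 'b) \<Rightarrow> bool" where
  "periodic l w \<longleftrightarrow> (\<forall>x i. w (x + l *\<^sub>R axis i 1) = w x)"


section \<open>Lebesgue spaces and weakly continuous functions\<close>

definition epowr :: "ennreal \<Rightarrow> real \<Rightarrow> ennreal" where
  "epowr a q = (if a = \<infinity> then \<infinity> else ennreal (enn2real a powr q))"

definition Lp_norm :: "real \<Rightarrow> real \<Rightarrow> (real^3 \<Rightarrow> 'b::euclidean_space) \<Rightarrow> ennreal" where
  "Lp_norm l p f = epowr (\<integral>\<^sup>+x. ennreal (norm (f x) powr p) \<partial>lebesgue_on (torus l)) (1 / p)"

definition Lp :: "real \<Rightarrow> real \<Rightarrow> (real^3 \<Rightarrow> 'b::euclidean_space) set" where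
  "Lp l p = {f \<in> borel_measurable (lebesgue_on (torus l)). Lp_norm l p f < \<infinity>}"

text \<open>
  The Borel structure of \<open>Lp\<close>, generated by the open balls (the space is separable).
  Functions are not identified modulo null sets.
\<close>

definition Lp_borel :: "real \<Rightarrow> real \<Rightarrow> (real^3 \<Rightarrow> 'b::euclidean_space) measure" where
  "Lp_borel l p = sigma (Lp l p)
     {{g \<in> Lp l p. Lp_norm l p (\<lambda>x. g x - f x) < ennreal r} | f r. f \<in> Lp l p}"

text \<open>The exponent of the momentum space.\<close>

definition mexp :: "real \<Rightarrow> real" where
  "mexp \<gamma> = 2 * \<gamma> / (\<gamma> + 1)"

text \<open>\<open>C\<^sub>w([0,T]; L\<^sup>p)\<close> for \<open>p > 1\<close>; the dual of \<open>L\<^sup>p\<close> is \<open>L\<^sup>q\<close> with \<open>q = p / (p - 1)\<close>.\<close>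

definition Cw :: "real \<Rightarrow> real \<Rightarrow> real \<Rightarrow> (real \<Rightarrow> real^3 \<Rightarrow> 'b::euclidean_space) set" where
  "Cw T l p = {u. (\<forall>t\<in>{0..T}. u t \<in> Lp l p) \<and>
     (\<forall>g \<in> Lp l (p / (p - 1)).
        continuous_on {0..T} (\<lambda>t. LINT x|lebesgue_on (torus l). u t x \<bullet> g x))}"

definition Cw_tendsto :: "real \<Rightarrow> real \<Rightarrow> real \<Rightarrow>
    (nat \<Rightarrow> real \<Rightarrow> real^3 \<Rightarrow> 'b::euclidean_space) \<Rightarrow> (real \<Rightarrow> real^3 \<Rightarrow> 'b) \<Rightarrow> bool" where
  "Cw_tendsto T l p u v \<longleftrightarrow> (\<forall>n. u n \<in> Cw T l p) \<and> v \<in> Cw T l p \<and>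
     (\<forall>g \<in> Lp l (p / (p - 1)).
        uniform_limit {0..T} (\<lambda>n t. LINT x|lebesgue_on (torus l). u n t x \<bullet> g x)
          (\<lambda>t. LINT x|lebesgue_on (torus l). v t x \<bullet> g x) sequentially)"


section \<open>Test functions and differential operators\<close>

text \<open>\<open>D is\<close> is the iterated partial derivative of \<open>\<phi>\<close> in the coordinate directions \<open>is\<close>.\<close>

definition smooth :: "(real^3 \<Rightarrow> 'b::euclidean_space) \<Rightarrow> bool" where
  "smooth \<phi> \<longleftrightarrow> (\<exists>D :: 3 list \<Rightarrow> real^3 \<Rightarrow> 'b. D [] = \<phi> \<and>
     (\<forall>is x. (D is has_derivative (\<lambda>v. \<Sum>i\<in>UNIV. v $ i *\<^sub>R D (i # is) x)) (at x)))"

definition test_fun :: "real \<Rightarrow> (real^3 \<Rightarrow> 'b::euclidean_space) \<Rightarrow> bool" where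
  "test_fun l \<phi> \<longleftrightarrow> smooth \<phi> \<and> periodic l \<phi>"

definition pd :: "3 \<Rightarrow> (real^3 \<Rightarrow> 'b::euclidean_space) \<Rightarrow> real^3 \<Rightarrow> 'b" where
  "pd j \<phi> x = frechet_derivative \<phi> (at x) (axis j 1)"

definition grad :: "(real^3 \<Rightarrow> real) \<Rightarrow> real^3 \<Rightarrow> real^3" where
  "grad \<phi> x = (\<chi> j. pd j \<phi> x)"

definition jac :: "(real^3 \<Rightarrow> real^3) \<Rightarrow> real^3 \<Rightarrow> real^3^3" where
  "jac \<phi> x = (\<chi> i j. pd j \<phi> x $ i)"

definition dvg :: "(real^3 \<Rightarrow> real^3) \<Rightarrow> real^3 \<Rightarrow> real" where
  "dvg \<phi> x = (\<Sum>i\<in>UNIV. pd i \<phi> x $ i)"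


section \<open>Constitutive functions and noise coefficients\<close>

definition conv_tensor :: "state \<Rightarrow> real^3^3" where
  "conv_tensor u = (\<chi> i j. snd u $ i * snd u $ j / fst u)"

text \<open>
  The quotient \<open>a / r\<close> for nonnegative arguments, lower semicontinuously extended to the vacuum:
  \<open>0 / 0 = 0\<close> and \<open>a / 0 = \<infinity>\<close> for \<open>a > 0\<close>.
\<close>

definition equot :: "real \<Rightarrow> real \<Rightarrow> ennreal" where
  "equot a r = (if r > 0 then ennreal (a / r) else if a = 0 then 0 else \<infinity>)"

definition energy :: "real \<Rightarrow> state \<Rightarrow> ennreal" where
  "energy \<gamma> u = equot ((norm (snd u))\<^sup>2 / 2) (fst u) + ennreal (fst u powr \<gamma> / (\<gamma> - 1))"

text \<open>
  Only the coefficients \<open>\<Psi>\<^sub>k\<close> of \<open>\<Psi>\<close> with respect to the orthonormal basis occur; here and for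
  the Wiener process the index \<open>k \<ge> 1\<close> is shifted to start at \<open>0\<close>.
\<close>

definition noise_coeff :: "real \<Rightarrow> (nat \<Rightarrow> (real^3) \<times> state \<Rightarrow> real^3) \<Rightarrow> bool" where
  "noise_coeff l \<Psi> \<longleftrightarrow>
     (\<forall>k. (\<forall>u. periodic l (\<lambda>x. \<Psi> k (x, u))) \<and>
          (\<exists>D :: (real^3) \<times> state \<Rightarrow> ((real^3) \<times> state) \<Rightarrow>\<^sub>L (real^3).
             continuous_on UNIV D \<and>
             (\<forall>z. (\<Psi> k has_derivative blinfun_apply (D z)) (at z))) \<and>
          (\<forall>x. \<Psi> k (x, 0, 0) = 0)) \<and>
     (\<exists>\<beta>. summable \<beta> \<and>
        (\<forall>k x \<rho> m.
           norm (frechet_derivative (\<Psi> k) (at (x, \<rho>, m)) (0, 1, 0)) +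
           onorm (\<lambda>w. frechet_derivative (\<Psi> k) (at (x, \<rho>, m)) (0, 0, w)) \<le> \<beta> k))"


section \<open>Stochastic preliminaries\<close>

text \<open>Filtrations are indexed by \<open>t \<ge> 0\<close>; their values at negative times are irrelevant.\<close>

definition stochastic_basis :: "'a measure \<Rightarrow> (real \<Rightarrow> 'a measure) \<Rightarrow> bool" where
  "stochastic_basis M F \<longleftrightarrow>
     prob_space M \<and> complete_measure M \<and>
     filtration (space M) (\<lambda>t. F (max 0 t)) \<and>
     (\<forall>t\<ge>0. subalgebra M (F t)) \<and>
     null_sets M \<subseteq> sets (F 0) \<and>
     (\<forall>t\<ge>0. sets (F t) = (\<Inter>s\<in>{t<..}. sets (F s)))"

definition prog_measurable :: "(real \<Rightarrow> 'a measure) \<Rightarrow> real \<Rightarrow> ('a \<Rightarrow> real \<Rightarrow> real) \<Rightarrow> bool" where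
  "prog_measurable F T X \<longleftrightarrow>
     (\<forall>t\<in>{0..T}. (\<lambda>(s, \<omega>). X \<omega> s) \<in> borel_measurable (restrict_space borel {0..t} \<Otimes>\<^sub>M F t))"

definition martingale :: "'a measure \<Rightarrow> (real \<Rightarrow> 'a measure) \<Rightarrow> real \<Rightarrow> ('a \<Rightarrow> real \<Rightarrow> real) \<Rightarrow> bool" where
  "martingale M F T X \<longleftrightarrow>
     (\<forall>t\<in>{0..T}. (\<lambda>\<omega>. X \<omega> t) \<in> borel_measurable (F t) \<and> integrable M (\<lambda>\<omega>. X \<omega> t)) \<and>
     (\<forall>s\<in>{0..T}. \<forall>t\<in>{s..T}. AE \<omega> in M. real_cond_exp M (F s) (\<lambda>\<omega>. X \<omega> t) \<omega> = X \<omega> s)"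

definition brownian_motion :: "'a measure \<Rightarrow> (real \<Rightarrow> 'a measure) \<Rightarrow> ('a \<Rightarrow> real \<Rightarrow> real) \<Rightarrow> bool" where
  "brownian_motion M F B \<longleftrightarrow>
     (\<forall>t\<ge>0. (\<lambda>\<omega>. B \<omega> t) \<in> borel_measurable (F t)) \<and>
     (AE \<omega> in M. B \<omega> 0 = 0 \<and> continuous_on {0..} (B \<omega>)) \<and>
     (\<forall>s t. 0 \<le> s \<and> s < t \<longrightarrow>
        distributed M lborel (\<lambda>\<omega>. B \<omega> t - B \<omega> s) (\<lambda>x. ennreal (normal_density 0 (sqrt (t - s)) x)) \<and>
        prob_space.indep_set M (sets (F s))
          {(\<lambda>\<omega>. B \<omega> t - B \<omega> s) -` A \<inter> space M | A. A \<in> sets borel})"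

text \<open>
  A cylindrical Wiener process \<open>W = \<Sum>\<^sub>k e\<^sub>k W\<^sub>k\<close> is given by its coordinates;
  \<open>W \<omega> t k\<close> is the value of the coordinate \<open>k\<close> at time \<open>t\<close>.
\<close>

definition cylindrical_wiener ::
    "'a measure \<Rightarrow> (real \<Rightarrow> 'a measure) \<Rightarrow> ('a \<Rightarrow> real \<Rightarrow> nat \<Rightarrow> real) \<Rightarrow> bool" where
  "cylindrical_wiener M F W \<longleftrightarrow>
     (\<forall>k. brownian_motion M F (\<lambda>\<omega> t. W \<omega> t k)) \<and>
     prob_space.indep_vars M (\<lambda>_. PiM {0..} (\<lambda>_. borel)) (\<lambda>k \<omega>. \<lambda>t\<in>{0..}. W \<omega> t k) UNIV"

definition tends_to_0_in_prob :: "'a measure \<Rightarrow> (nat \<Rightarrow> 'a \<Rightarrow> ennreal) \<Rightarrow> bool" where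
  "tends_to_0_in_prob M Y \<longleftrightarrow>
     (\<forall>n. Y n \<in> borel_measurable M) \<and>
     (\<forall>\<epsilon>>0. (\<lambda>n. measure M {\<omega> \<in> space M. ennreal \<epsilon> \<le> Y n \<omega>}) \<longlonglongrightarrow> 0)"

definition simple_process :: "'a measure \<Rightarrow> (real \<Rightarrow> 'a measure) \<Rightarrow> real \<Rightarrow>
    nat \<Rightarrow> (nat \<Rightarrow> real) \<Rightarrow> (nat \<Rightarrow> 'a \<Rightarrow> real) \<Rightarrow> bool" where
  "simple_process M F T n t \<xi> \<longleftrightarrow>
     t 0 = 0 \<and> t n = T \<and>
     (\<forall>i<n. t i < t (Suc i) \<and> \<xi> i \<in> borel_measurable (F (t i)) \<and>
            (\<exists>C. \<forall>\<omega>\<in>space M. \<bar>\<xi> i \<omega>\<bar> \<le> C))"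

definition simple_val :: "nat \<Rightarrow> (nat \<Rightarrow> real) \<Rightarrow> (nat \<Rightarrow> 'a \<Rightarrow> real) \<Rightarrow> 'a \<Rightarrow> real \<Rightarrow> real" where
  "simple_val n t \<xi> \<omega> s = (\<Sum>i<n. \<xi> i \<omega> * indicator {t i<..t (Suc i)} s)"

definition simple_int :: "nat \<Rightarrow> (nat \<Rightarrow> real) \<Rightarrow> (nat \<Rightarrow> 'a \<Rightarrow> real) \<Rightarrow> ('a \<Rightarrow> real \<Rightarrow> real) \<Rightarrow>
    'a \<Rightarrow> real \<Rightarrow> real" where
  "simple_int n t \<xi> B \<omega> s = (\<Sum>i<n. \<xi> i \<omega> * (B \<omega> (min s (t (Suc i))) - B \<omega> (min s (t i))))"

text \<open>
  \<open>I\<close> is (a version of) the Ito integral process of \<open>X\<close> with respect to \<open>B\<close> on \<open>[0,T]\<close>.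
  The integrand has, up to a null set of times, a progressively measurable version \<open>Y\<close>
  with square integrable paths.
\<close>

definition has_ito_integral :: "'a measure \<Rightarrow> (real \<Rightarrow> 'a measure) \<Rightarrow> real \<Rightarrow>
    ('a \<Rightarrow> real \<Rightarrow> real) \<Rightarrow> ('a \<Rightarrow> real \<Rightarrow> real) \<Rightarrow> ('a \<Rightarrow> real \<Rightarrow> real) \<Rightarrow> bool" where
  "has_ito_integral M F T B X I \<longleftrightarrow>
     (\<forall>t\<in>{0..T}. (\<lambda>\<omega>. I \<omega> t) \<in> borel_measurable (F t)) \<and>
     (AE \<omega> in M. continuous_on {0..T} (I \<omega>)) \<and>
     (\<exists>Y n t \<xi>.
        prog_measurable F T Y \<and>
        (AE \<omega> in M. AE s in lebesgue_on {0..T}. X \<omega> s = Y \<omega> s) \<and>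
        (AE \<omega> in M. (\<integral>\<^sup>+s. ennreal ((Y \<omega> s)\<^sup>2) \<partial>lebesgue_on {0..T}) < \<infinity>) \<and>
        (\<forall>j. simple_process M F T (n j) (t j) (\<xi> j)) \<and>
        tends_to_0_in_prob M (\<lambda>j \<omega>.
          \<integral>\<^sup>+s. ennreal ((simple_val (n j) (t j) (\<xi> j) \<omega> s - Y \<omega> s)\<^sup>2) \<partial>lebesgue_on {0..T}) \<and>
        tends_to_0_in_prob M (\<lambda>j \<omega>.
          SUP s\<in>{0..T}. ennreal \<bar>simple_int (n j) (t j) (\<xi> j) B \<omega> s - I \<omega> s\<bar>))"

text \<open>\<open>I = \<Sum>\<^sub>k \<integral> X\<^sub>k dW\<^sub>k\<close> on \<open>[0,T]\<close>.\<close>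

definition has_stoch_integral :: "'a measure \<Rightarrow> (real \<Rightarrow> 'a measure) \<Rightarrow> real \<Rightarrow>
    ('a \<Rightarrow> real \<Rightarrow> nat \<Rightarrow> real) \<Rightarrow> (nat \<Rightarrow> 'a \<Rightarrow> real \<Rightarrow> real) \<Rightarrow> ('a \<Rightarrow> real \<Rightarrow> real) \<Rightarrow> bool" where
  "has_stoch_integral M F T W X I \<longleftrightarrow>
     (\<forall>t\<in>{0..T}. (\<lambda>\<omega>. I \<omega> t) \<in> borel_measurable (F t)) \<and>
     (AE \<omega> in M. continuous_on {0..T} (I \<omega>)) \<and>
     (\<exists>J. (\<forall>k. has_ito_integral M F T (\<lambda>\<omega> t. W \<omega> t k) (X k) (J k)) \<and>
        tends_to_0_in_prob M (\<lambda>n \<omega>. SUP s\<in>{0..T}. ennreal \<bar>(\<Sum>k<n. J k \<omega> s) - I \<omega> s\<bar>))"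


section \<open>The numerical scheme\<close>

definition mesh :: "real \<Rightarrow> real \<Rightarrow> bool" where
  "mesh l h \<longleftrightarrow> h > 0 \<and> l / h \<in> \<int>"

definition cell :: "real \<Rightarrow> real^3 \<Rightarrow> (real^3) set" where
  "cell h x = {y. \<forall>i. \<lfloor>y $ i / h\<rfloor> = \<lfloor>x $ i / h\<rfloor>}"

text \<open>
  Grid functions are periodic functions, constant on each cell.  The value \<open>w\<^sub>K\<close> is \<open>w x\<close> for
  any \<open>x\<close> in the cell \<open>K\<close>, and neighbouring cells are reached by translation by \<open>h\<close>.
\<close>

definition grid_fun :: "real \<Rightarrow> real \<Rightarrow> (real^3 \<Rightarrow> 'b) \<Rightarrow> bool" where
  "grid_fun l h w \<longleftrightarrow> periodic l w \<and> (\<forall>x. \<forall>y\<in>cell h x. w y = w x)"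

definition dpart :: "real \<Rightarrow> 3 \<Rightarrow> (real^3 \<Rightarrow> 'b::real_vector) \<Rightarrow> real^3 \<Rightarrow> 'b" where
  "dpart h p w x = (w (x + h *\<^sub>R axis p 1) - w (x - h *\<^sub>R axis p 1)) /\<^sub>R (2 * h)"

definition ddiv :: "real \<Rightarrow> (real^3 \<Rightarrow> real^3) \<Rightarrow> real^3 \<Rightarrow> real" where
  "ddiv h w x = (\<Sum>p\<in>UNIV. dpart h p (\<lambda>y. w y $ p) x)"

definition ddiv_tensor :: "real \<Rightarrow> (real^3 \<Rightarrow> real^3^3) \<Rightarrow> real^3 \<Rightarrow> real^3" where
  "ddiv_tensor h w x = (\<chi> i. ddiv h (\<lambda>y. w y $ i) x)"

definition dlaplace :: "real \<Rightarrow> (real^3 \<Rightarrow> 'b::real_vector) \<Rightarrow> real^3 \<Rightarrow> 'b" where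
  "dlaplace h w x = (\<Sum>p\<in>UNIV. (w (x + h *\<^sub>R axis p 1) - w x) + (w (x - h *\<^sub>R axis p 1) - w x)) /\<^sub>R h\<^sup>2"

definition mom_flux :: "real \<Rightarrow> state \<Rightarrow> real^3^3" where
  "mom_flux \<gamma> u = conv_tensor u + (fst u powr \<gamma>) *\<^sub>R mat 1"

text \<open>The flux \<open>f(\<rho>, m) = [m, m \<otimes> m / \<rho> + p(\<rho>) I]\<close> in the coordinate direction \<open>p\<close>.\<close>

definition flux :: "real \<Rightarrow> 3 \<Rightarrow> state \<Rightarrow> state" where
  "flux \<gamma> p u = (snd u $ p, column p (mom_flux \<gamma> u))"

definition char_speeds :: "real \<Rightarrow> state \<Rightarrow> real set" where
  "char_speeds \<gamma> u =
     {s. \<exists>p v. v \<noteq> 0 \<and> frechet_derivative (flux \<gamma> p) (at u) v = s *\<^sub>R v}"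

text \<open>The maximum runs over the finitely many values of a grid function.\<close>

definition max_speed :: "real \<Rightarrow> (real^3 \<Rightarrow> state) \<Rightarrow> real" where
  "max_speed \<gamma> w = Max (\<Union>x. abs ` char_speeds \<gamma> (w x))"

definition scheme_solution :: "real \<Rightarrow> real \<Rightarrow> real \<Rightarrow> (nat \<Rightarrow> (real^3) \<times> state \<Rightarrow> real^3) \<Rightarrow>
    'a measure \<Rightarrow> (real \<Rightarrow> 'a measure) \<Rightarrow> ('a \<Rightarrow> real \<Rightarrow> nat \<Rightarrow> real) \<Rightarrow>
    ('a \<Rightarrow> (real^3 \<Rightarrow> real) \<times> (real^3 \<Rightarrow> real^3)) \<Rightarrow>
    real \<Rightarrow> ('a \<Rightarrow> real \<Rightarrow> real^3 \<Rightarrow> state) \<Rightarrow> bool" where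
  "scheme_solution T l \<gamma> \<Psi> M F W init h U \<longleftrightarrow>
     (\<forall>\<omega>\<in>space M. \<forall>t\<in>{0..T}. grid_fun l h (U \<omega> t)) \<and>
     (\<forall>x. \<forall>t\<in>{0..T}. (\<lambda>\<omega>. U \<omega> t x) \<in> borel_measurable (F t)) \<and>
     (\<forall>x. AE \<omega> in M. continuous_on {0..T} (\<lambda>t. U \<omega> t x)) \<and>
     (AE \<omega> in M. \<forall>x\<in>torus l. U \<omega> 0 x =
        (LINT y|lebesgue_on (cell h x). fst (init \<omega>) y, LINT y|lebesgue_on (cell h x). snd (init \<omega>) y) /\<^sub>R h ^ 3) \<and>
     (\<forall>x. AE \<omega> in M. \<forall>t\<in>{0..T}.
        fst (U \<omega> t x) - fst (U \<omega> 0 x) +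
          (LINT s|lebesgue_on {0..t}.
             ddiv h (\<lambda>y. snd (U \<omega> s y)) x
             - max_speed \<gamma> (U \<omega> s) * h * dlaplace h (\<lambda>y. fst (U \<omega> s y)) x) = 0) \<and>
     (\<forall>x i. \<exists>I.
        has_stoch_integral M F T W
          (\<lambda>k \<omega> s. ((LINT y|lebesgue_on (cell h x). \<Psi> k (y, U \<omega> s x)) /\<^sub>R h ^ 3) $ i) I \<and>
        (AE \<omega> in M. \<forall>t\<in>{0..T}.
           snd (U \<omega> t x) $ i - snd (U \<omega> 0 x) $ i +
             (LINT s|lebesgue_on {0..t}.
                (ddiv_tensor h (\<lambda>y. mom_flux \<gamma> (U \<omega> s y)) x
                 - (max_speed \<gamma> (U \<omega> s) * h) *\<^sub>R dlaplace h (\<lambda>y. snd (U \<omega> s y)) x) $ i)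
           = I \<omega> t))"

text \<open>
  Boundedness in \<open>L\<^sup>q(\<Omega>; L\<^sup>\<infinity>(0,T; L\<^sup>p))\<close>, for every \<open>1 \<le> q < \<infinity>\<close>, of a family indexed by the
  admissible mesh sizes.
\<close>

definition bounded_moments :: "real \<Rightarrow> real \<Rightarrow> 'a measure \<Rightarrow> real \<Rightarrow>
    (real \<Rightarrow> 'a \<Rightarrow> real \<Rightarrow> real^3 \<Rightarrow> 'b::euclidean_space) \<Rightarrow> bool" where
  "bounded_moments T l M p u \<longleftrightarrow>
     (\<forall>q\<ge>1. \<exists>C::real. \<forall>h. mesh l h \<longrightarrow>
        (\<lambda>\<omega>. esssup (lebesgue_on {0<..<T}) (\<lambda>t. Lp_norm l p (u h \<omega> t))) \<in> borel_measurable M \<and>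
        (\<integral>\<^sup>+\<omega>. epowr (esssup (lebesgue_on {0<..<T}) (\<lambda>t. Lp_norm l p (u h \<omega> t))) q \<partial>M) \<le> ennreal C)"


section \<open>Young measures\<close>

text \<open>
  Caratheodory functions representing \<open>L\<^sup>1(Q; C\<^sub>0(\<real>\<^sup>4))\<close>, the predual of the space of weakly-*
  measurable, essentially bounded maps from \<open>Q\<close> into the bounded Borel measures.
\<close>

definition L1C0 :: "(real \<times> (real^3)) set \<Rightarrow> (real \<times> (real^3) \<Rightarrow> state \<Rightarrow> real) set" where
  "L1C0 Q = {\<psi>.
     (\<forall>u. (\<lambda>z. \<psi> z u) \<in> borel_measurable (lebesgue_on Q)) \<and>
     (\<forall>z\<in>Q. continuous_on UNIV (\<psi> z) \<and> (\<psi> z \<longlongrightarrow> 0) at_infinity) \<and>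
     integrable (lebesgue_on Q) (\<lambda>z. SUP u. \<bar>\<psi> z u\<bar>)}"

definition young_tendsto :: "(real \<times> (real^3)) set \<Rightarrow>
    (nat \<Rightarrow> real \<Rightarrow> real^3 \<Rightarrow> state measure) \<Rightarrow> (real \<Rightarrow> real^3 \<Rightarrow> state measure) \<Rightarrow> bool" where
  "young_tendsto Q Vn V \<longleftrightarrow> (\<forall>\<psi>\<in>L1C0 Q.
     (\<lambda>n. LINT z|lebesgue_on Q. LINT u|Vn n (fst z) (snd z). \<psi> z u)
       \<longlonglongrightarrow> (LINT z|lebesgue_on Q. LINT u|V (fst z) (snd z). \<psi> z u))"

text \<open>
  Random variables with values in the weakly-* measurable maps from \<open>[0,T] \<times> T\<^sup>3\<close> into the
  probability measures on states of nonnegative density.  The latter are regarded as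
  probability measures on all states.
\<close>

definition young_random_variable :: "real \<Rightarrow> real \<Rightarrow> 'a measure \<Rightarrow>
    ('a \<Rightarrow> real \<Rightarrow> real^3 \<Rightarrow> state measure) \<Rightarrow> bool" where
  "young_random_variable T l M V \<longleftrightarrow>
     (\<forall>\<omega>\<in>space M.
        (\<forall>t\<in>{0..T}. \<forall>x\<in>torus l. V \<omega> t x \<in> space (prob_algebra borel) \<and>
           (AE u in V \<omega> t x. fst u \<ge> 0)) \<and>
        (\<forall>f::state \<Rightarrow> real. continuous_on UNIV f \<and> (f \<longlongrightarrow> 0) at_infinity \<longrightarrow>
           (\<lambda>z. LINT u|V \<omega> (fst z) (snd z). f u) \<in> borel_measurable (lebesgue_on ({0..T} \<times> torus l)))) \<and>
     (\<forall>\<psi>\<in>L1C0 ({0..T} \<times> torus l).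
        (\<lambda>\<omega>. LINT z|lebesgue_on ({0..T} \<times> torus l). LINT u|V \<omega> (fst z) (snd z). \<psi> z u)
          \<in> borel_measurable M)"


section \<open>Finite vector-valued Borel measures on the torus\<close>

definition torus_sets :: "real \<Rightarrow> (real^3) set set" where
  "torus_sets l = sets (restrict_space borel (torus l))"

definition vector_measure :: "real \<Rightarrow> ((real^3) set \<Rightarrow> 'b::euclidean_space) \<Rightarrow> bool" where
  "vector_measure l \<mu> \<longleftrightarrow> (\<forall>A::nat \<Rightarrow> (real^3) set.
     range A \<subseteq> torus_sets l \<and> disjoint_family A \<longrightarrow> (\<lambda>n. \<mu> (A n)) sums \<mu> (\<Union>n. A n))"

definition total_variation :: "real \<Rightarrow> ((real^3) set \<Rightarrow> 'b::euclidean_space) \<Rightarrow> ennreal" where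
  "total_variation l \<mu> =
     (SUP P\<in>{P. finite P \<and> disjoint P \<and> P \<subseteq> torus_sets l}. \<Sum>A\<in>P. ennreal (norm (\<mu> A)))"

definition positive_part :: "real \<Rightarrow> ((real^3) set \<Rightarrow> real) \<Rightarrow> (real^3) measure" where
  "positive_part l \<mu> = measure_of (torus l) (torus_sets l)
     (\<lambda>A. SUP B\<in>{B \<in> torus_sets l. B \<subseteq> A}. ennreal (\<mu> B))"

text \<open>Integration against a signed measure, by its Jordan decomposition.\<close>

definition signed_integral :: "real \<Rightarrow> ((real^3) set \<Rightarrow> real) \<Rightarrow> (real^3 \<Rightarrow> real) \<Rightarrow> real" where
  "signed_integral l \<mu> f =
     (LINT x|positive_part l \<mu>. f x) - (LINT x|positive_part l (\<lambda>A. - \<mu> A). f x)"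

definition tensor_integral :: "real \<Rightarrow> ((real^3) set \<Rightarrow> real^3^3) \<Rightarrow> (real^3 \<Rightarrow> real^3^3) \<Rightarrow> real" where
  "tensor_integral l \<mu> f =
     (\<Sum>i\<in>UNIV. \<Sum>j\<in>UNIV. signed_integral l (\<lambda>A. \<mu> A $ i $ j) (\<lambda>x. f x $ i $ j))"

text \<open>Weakly-* measurable, essentially bounded maps from \<open>[0,T]\<close> into the finite measures.\<close>

definition Linf_measures :: "real \<Rightarrow> real \<Rightarrow> (real \<Rightarrow> (real^3) set \<Rightarrow> 'b::euclidean_space) set" where
  "Linf_measures T l = {\<mu>.
     (\<forall>t\<in>{0..T}. vector_measure l (\<mu> t)) \<and>
     (\<forall>b\<in>Basis. \<forall>f. continuous_on UNIV f \<and> periodic l f \<longrightarrow>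
        (\<lambda>t. signed_integral l (\<lambda>A. \<mu> t A \<bullet> b) f) \<in> borel_measurable (lebesgue_on {0..T})) \<and>
     (\<exists>C::real. AE t in lebesgue_on {0..T}. total_variation l (\<mu> t) \<le> ennreal C)}"


section \<open>Dissipative measure-valued martingale solutions\<close>

text \<open>
  \<open>g\<close> is the state function whose barycentre is considered, e.g. \<open>fst\<close> for the density.  The
  integrability clause says that the brackets and their space integrals are well defined.
\<close>

definition barycentre_regular :: "real \<Rightarrow> real \<Rightarrow> real \<Rightarrow> 'a measure \<Rightarrow> (real \<Rightarrow> 'a measure) \<Rightarrow>
    ('a \<Rightarrow> real \<Rightarrow> real^3 \<Rightarrow> state measure) \<Rightarrow> (state \<Rightarrow> 'b::euclidean_space) \<Rightarrow> bool" where
  "barycentre_regular T l p M F V g \<longleftrightarrow>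
     (AE \<omega> in M. \<forall>t\<in>{0..T}.
        (AE x in lebesgue_on (torus l). integrable (V \<omega> t x) g) \<and>
        integrable (lebesgue_on (torus l)) (\<lambda>x. LINT u|V \<omega> t x. g u)) \<and>
     (\<forall>\<phi>. test_fun l \<phi> \<longrightarrow>
        (AE \<omega> in M. continuous_on {0..T}
           (\<lambda>t. LINT x|lebesgue_on (torus l). (LINT u|V \<omega> t x. g u) \<bullet> \<phi> x)) \<and>
        prog_measurable F T
          (\<lambda>\<omega> t. LINT x|lebesgue_on (torus l). (LINT u|V \<omega> t x. g u) \<bullet> \<phi> x)) \<and>
     (\<forall>q\<ge>1.
        (\<lambda>\<omega>. SUP t\<in>{0<..<T}. Lp_norm l p (\<lambda>x. LINT u|V \<omega> t x. g u)) \<in> borel_measurable M \<and>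
        (\<integral>\<^sup>+\<omega>. epowr (SUP t\<in>{0<..<T}. Lp_norm l p (\<lambda>x. LINT u|V \<omega> t x. g u)) q \<partial>M) < \<infinity>)"

definition initial_law :: "real \<Rightarrow> real \<Rightarrow> 'a measure \<Rightarrow>
    ((real^3 \<Rightarrow> real) \<times> (real^3 \<Rightarrow> real^3)) measure \<Rightarrow>
    ('a \<Rightarrow> real \<Rightarrow> real^3 \<Rightarrow> state measure) \<Rightarrow>
    ('a \<Rightarrow> (real^3 \<Rightarrow> real) \<times> (real^3 \<Rightarrow> real^3)) \<Rightarrow> bool" where
  "initial_law l \<gamma> M \<Lambda> V init \<longleftrightarrow>
     init \<in> M \<rightarrow>\<^sub>M (Lp_borel l \<gamma> \<Otimes>\<^sub>M Lp_borel l (mexp \<gamma>)) \<and>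
     distr M (Lp_borel l \<gamma> \<Otimes>\<^sub>M Lp_borel l (mexp \<gamma>)) init = \<Lambda> \<and>
     (AE \<omega> in M. AE x in lebesgue_on (torus l).
        V \<omega> 0 x = return borel (fst (init \<omega>) x, snd (init \<omega>) x))"

definition continuity_eq :: "real \<Rightarrow> real \<Rightarrow> (real \<Rightarrow> real^3 \<Rightarrow> state measure) \<Rightarrow> bool" where
  "continuity_eq T l V \<longleftrightarrow> (\<forall>\<tau>\<in>{0..<T}. \<forall>\<phi>. test_fun l \<phi> \<longrightarrow>
     (LINT x|lebesgue_on (torus l). (LINT u|V \<tau> x. fst u) * \<phi> x)
     - (LINT x|lebesgue_on (torus l). (LINT u|V 0 x. fst u) * \<phi> x)
     = (LINT z|lebesgue_on ({0..\<tau>} \<times> torus l).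
          (LINT u|V (fst z) (snd z). snd u) \<bullet> grad \<phi> (snd z)))"

text \<open>\<open>N \<phi> \<tau>\<close> is the stochastic integral up to time \<open>\<tau>\<close>, tested with \<open>\<phi>\<close>.\<close>

definition momentum_eq :: "real \<Rightarrow> real \<Rightarrow> real \<Rightarrow> (real \<Rightarrow> real^3 \<Rightarrow> state measure) \<Rightarrow>
    ((real^3 \<Rightarrow> real^3) \<Rightarrow> real \<Rightarrow> real) \<Rightarrow> (real \<Rightarrow> (real^3) set \<Rightarrow> real^3^3) \<Rightarrow> bool" where
  "momentum_eq T l \<gamma> V N \<mu>\<^sub>m \<longleftrightarrow> (\<forall>\<tau>\<in>{0..<T}. \<forall>\<phi>. test_fun l \<phi> \<longrightarrow>
     (LINT x|lebesgue_on (torus l). (LINT u|V \<tau> x. snd u) \<bullet> \<phi> x)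
     - (LINT x|lebesgue_on (torus l). (LINT u|V 0 x. snd u) \<bullet> \<phi> x)
     = (LINT z|lebesgue_on ({0..\<tau>} \<times> torus l).
          (LINT u|V (fst z) (snd z). conv_tensor u) \<bullet> jac \<phi> (snd z)
          + (LINT u|V (fst z) (snd z). fst u powr \<gamma>) * dvg \<phi> (snd z))
       + N \<phi> \<tau>
       + (LINT t|lebesgue_on {0..\<tau>}. tensor_integral l (\<mu>\<^sub>m t) (jac \<phi>)))"

definition total_energy :: "real \<Rightarrow> real \<Rightarrow> (real \<Rightarrow> real^3 \<Rightarrow> state measure) \<Rightarrow> (real \<Rightarrow> real) \<Rightarrow>
    real \<Rightarrow> ennreal" where
  "total_energy l \<gamma> V D s =
     (\<integral>\<^sup>+x. (\<integral>\<^sup>+u. energy \<gamma> u \<partial>V s x) \<partial>lebesgue_on (torus l)) + ennreal (D s)"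

text \<open>
  The one-sided limits \<open>Em t = E(t-)\<close> and \<open>Ep t = E(t+)\<close> are limits of averages.  The energy
  inequality is stated in the extended reals, since the initial energy may be infinite.
\<close>

definition energy_ineq :: "real \<Rightarrow> real \<Rightarrow> real \<Rightarrow> (nat \<Rightarrow> (real^3) \<times> state \<Rightarrow> real^3) \<Rightarrow>
    (real \<Rightarrow> real^3 \<Rightarrow> state measure) \<Rightarrow> (real^3 \<Rightarrow> real) \<times> (real^3 \<Rightarrow> real^3) \<Rightarrow>
    (real \<Rightarrow> (real^3) set \<Rightarrow> real) \<Rightarrow> (real \<Rightarrow> real) \<Rightarrow> (real \<Rightarrow> real) \<Rightarrow> bool" where
  "energy_ineq T l \<gamma> \<Psi> V init \<mu>\<^sub>e D ME \<longleftrightarrow> (\<exists>Em Ep :: real \<Rightarrow> ennreal.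
     Em 0 = (\<integral>\<^sup>+x. energy \<gamma> (fst init x, snd init x) \<partial>lebesgue_on (torus l)) \<and>
     (\<forall>t\<in>{0<..<T}.
        ((\<lambda>\<tau>. (\<integral>\<^sup>+s. total_energy l \<gamma> V D s \<partial>lebesgue_on {t - \<tau><..<t}) / ennreal \<tau>) \<longlongrightarrow> Em t) (at_right 0) \<and>
        ((\<lambda>\<tau>. (\<integral>\<^sup>+s. total_energy l \<gamma> V D s \<partial>lebesgue_on {t<..<t + \<tau>}) / ennreal \<tau>) \<longlongrightarrow> Ep t) (at_right 0)) \<and>
     (\<forall>s t. 0 \<le> s \<and> s < t \<and> t < T \<longrightarrow>
        enn2ereal (Ep t) \<le> enn2ereal (Em s)
          + ereal (1/2) * enn2ereal (\<integral>\<^sup>+z. (\<Sum>k. \<integral>\<^sup>+u. equot ((norm (\<Psi> k (snd z, u)))\<^sup>2) (fst u) \<partial>V (fst z) (snd z))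
                \<partial>lebesgue_on ({s<..<t} \<times> torus l))
          + ereal (1/2 * (LINT \<tau>|lebesgue_on {s..t}. \<mu>\<^sub>e \<tau> (torus l)))
          + ereal (ME t - ME s)))"

text \<open>
  Finiteness of the space-time integral of the energy expresses that the brackets of
  \<open>m \<otimes> m / \<rho>\<close> and \<open>p(\<rho>)\<close> in the momentum equation are integrable, and in particular that
  almost no Young measure charges the vacuum with nonzero momentum.
\<close>

definition dmv_martingale_solution :: "real \<Rightarrow> real \<Rightarrow> real \<Rightarrow>
    (nat \<Rightarrow> (real^3) \<times> state \<Rightarrow> real^3) \<Rightarrow>
    ((real^3 \<Rightarrow> real) \<times> (real^3 \<Rightarrow> real^3)) measure \<Rightarrow>
    'a measure \<Rightarrow> (real \<Rightarrow> 'a measure) \<Rightarrow>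
    ('a \<Rightarrow> real \<Rightarrow> real^3 \<Rightarrow> state measure) \<Rightarrow> ('a \<Rightarrow> real \<Rightarrow> nat \<Rightarrow> real) \<Rightarrow> bool" where
  "dmv_martingale_solution T l \<gamma> \<Psi> \<Lambda> M F V W \<longleftrightarrow>
     young_random_variable T l M V \<and>
     stochastic_basis M F \<and>
     cylindrical_wiener M F W \<and>
     barycentre_regular T l \<gamma> M F V fst \<and>
     barycentre_regular T l (mexp \<gamma>) M F V snd \<and>
     (\<exists>init. initial_law l \<gamma> M \<Lambda> V init \<and>
       (AE \<omega> in M. continuity_eq T l (V \<omega>)) \<and>
       (AE \<omega> in M. (\<integral>\<^sup>+z. (\<integral>\<^sup>+u. energy \<gamma> u \<partial>V \<omega> (fst z) (snd z)) \<partial>lebesgue_on ({0..T} \<times> torus l)) < \<infinity>) \<and>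
       (\<exists>N \<mu>\<^sub>m \<mu>\<^sub>e D ME.
         (\<forall>\<phi>. test_fun l \<phi> \<longrightarrow>
            has_stoch_integral M F T W
              (\<lambda>k \<omega> t. LINT x|lebesgue_on (torus l). (LINT u|V \<omega> t x. \<Psi> k (x, u)) \<bullet> \<phi> x)
              (\<lambda>\<omega>. N \<omega> \<phi>)) \<and>
         (AE \<omega> in M. \<mu>\<^sub>m \<omega> \<in> Linf_measures T l) \<and>
         (AE \<omega> in M. momentum_eq T l \<gamma> (V \<omega>) (N \<omega>) (\<mu>\<^sub>m \<omega>)) \<and>
         martingale M F T ME \<and>
         (AE \<omega> in M. \<mu>\<^sub>e \<omega> \<in> Linf_measures T l) \<and>
         (AE \<omega> in M. D \<omega> \<in> borel_measurable (lebesgue_on {0<..<T}) \<and>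
            (\<exists>C. AE t in lebesgue_on {0<..<T}. 0 \<le> D \<omega> t \<and> D \<omega> t \<le> C)) \<and>
         (AE \<omega> in M. energy_ineq T l \<gamma> \<Psi> (V \<omega>) (init \<omega>) (\<mu>\<^sub>e \<omega>) (D \<omega>) (ME \<omega>)) \<and>
         (\<exists>C>0. AE \<omega> in M. \<forall>\<tau>\<in>{0<..<T}.
            (\<integral>\<^sup>+t. total_variation l (\<mu>\<^sub>m \<omega> t) \<partial>lebesgue_on {0..\<tau>})
            + (\<integral>\<^sup>+t. total_variation l (\<mu>\<^sub>e \<omega> t) \<partial>lebesgue_on {0..\<tau>})
            \<le> ennreal C * (\<integral>\<^sup>+t. ennreal (D \<omega> t) \<partial>lebesgue_on {0..\<tau>}))))"

text \<open>
  The law of \<open>(U, W)\<close> on path space over \<open>[0,T]\<close>.  The Borel structure of the path space of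
  continuous grid functions (which are finite-dimensional) and that of
  \<open>C([0,T]; W\<^sub>0)\<close>, where \<open>W\<^sub>0\<close> is the weighted sequence space of the Wiener process, are
  generated by the evaluations of the cell values and of the coordinates.
\<close>

definition joint_law :: "real \<Rightarrow> 'a measure \<Rightarrow> ('a \<Rightarrow> real \<Rightarrow> real^3 \<Rightarrow> state) \<Rightarrow>
    ('a \<Rightarrow> real \<Rightarrow> nat \<Rightarrow> real) \<Rightarrow> ((real \<times> (real^3) \<Rightarrow> state) \<times> (real \<times> nat \<Rightarrow> real)) measure" where
  "joint_law T M U W =
     distr M (PiM ({0..T} \<times> UNIV) (\<lambda>_. borel) \<Otimes>\<^sub>M PiM ({0..T} \<times> UNIV) (\<lambda>_. borel))
       (\<lambda>\<omega>. (\<lambda>z\<in>{0..T} \<times> UNIV. U \<omega> (fst z) (snd z), \<lambda>z\<in>{0..T} \<times> UNIV. W \<omega> (fst z) (snd z)))"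

text \<open>
  \<open>U' n\<close> is the representative of \<open>U (hs n)\<close> on the probability space \<open>M'\<close> of the generated
  solution.
\<close>

definition generates :: "real \<Rightarrow> real \<Rightarrow> real \<Rightarrow>
    'a measure \<Rightarrow> ('a \<Rightarrow> real \<Rightarrow> nat \<Rightarrow> real) \<Rightarrow> (real \<Rightarrow> 'a \<Rightarrow> real \<Rightarrow> real^3 \<Rightarrow> state) \<Rightarrow>
    'b measure \<Rightarrow> ('b \<Rightarrow> real \<Rightarrow> real^3 \<Rightarrow> state measure) \<Rightarrow> ('b \<Rightarrow> real \<Rightarrow> nat \<Rightarrow> real) \<Rightarrow>
    (nat \<Rightarrow> real) \<Rightarrow> (nat \<Rightarrow> 'b \<Rightarrow> real \<Rightarrow> real^3 \<Rightarrow> state) \<Rightarrow> bool" where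
  "generates T l \<gamma> M W U M' V W' hs U' \<longleftrightarrow>
     (\<forall>n. mesh l (hs n)) \<and> (\<forall>n. hs (Suc n) < hs n) \<and> hs \<longlonglongrightarrow> 0 \<and>
     (\<forall>n.
        (\<forall>\<omega>\<in>space M'. \<forall>t\<in>{0..T}. grid_fun l (hs n) (U' n \<omega> t)) \<and>
        (\<forall>\<omega>\<in>space M'. \<forall>x. continuous_on {0..T} (\<lambda>t. U' n \<omega> t x)) \<and>
        (\<forall>x. \<forall>t\<in>{0..T}. (\<lambda>\<omega>. U' n \<omega> t x) \<in> borel_measurable M') \<and>
        joint_law T M' (U' n) W' = joint_law T M (U (hs n)) W) \<and>
     (AE \<omega> in M'.
        young_tendsto ({0<..<T} \<times> torus l) (\<lambda>n t x. return borel (U' n \<omega> t x)) (V \<omega>)) \<and>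
     (AE \<omega> in M'. \<exists>r m.
        Cw_tendsto T l \<gamma> (\<lambda>n t x. fst (U' n \<omega> t x)) r \<and>
        Cw_tendsto T l (mexp \<gamma>) (\<lambda>n t x. snd (U' n \<omega> t x)) m)"

end

theory Submission
  imports Defs "HOL-Computational_Algebra.Nth_Powers"
begin

text \<open>
  Outside a null set of \<open>\<omega>\<close> the argument is deterministic.  Fix \<open>\<omega>\<close> and write \<open>u\<^sub>n\<close> for the
  \<open>n\<close>-th approximation and \<open>V\<close> for the Young measure that the Dirac masses at \<open>u\<^sub>n\<close> converge to.

  The Young measure sees \<open>u\<^sub>n\<close> only through functions that vanish at infinity, so the passage to
  its barycentre needs a bound on large values.  Convergence in \<open>C\<^sub>w([0,T]; L\<^sup>p)\<close> provides one: by
  the uniform boundedness principle (\<open>Lp_uniform_boundedness\<close>, by a gliding hump) the norms in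
  \<open>L\<^sup>p\<close> are bounded uniformly in \<open>n\<close> and \<open>t\<close> (\<open>Cw_tendsto_bounded\<close>), hence \<open>|u\<^sub>n|\<^sup>p\<close> is bounded in
  \<open>L\<^sup>1\<close> of the space-time cylinder for the smaller exponent \<open>p = 2 \<gamma> / (\<gamma> + 1)\<close>, which lies
  strictly between \<open>1\<close> and \<open>2\<close>.  These data form the locale \<open>young_limit\<close>.

  First claim.  Under such a moment bound, functions of linear growth of \<open>u\<^sub>n\<close> converge weakly to
  their barycentres (\<open>weak_convergence\<close>).  The limit in \<open>C\<^sub>w\<close>, which exists by assumption, must
  therefore agree with the barycentre of \<open>V\<close> in the sense of space-time integrals.  Paired with a
  trigonometric function of \<open>x\<close>, both are continuous in time, so the pairings agree at every time
  (\<open>pairing_with_mode_eq\<close>); trigonometric functions separate integrable functions on the torus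
  (\<open>AE_zero_if_fourier_modes_vanish\<close>), so limit and barycentre coincide for every \<open>t\<close>
  (\<open>Cw_limit_is_barycentre\<close>), and no subsequence has to be taken.  Countably many test functions
  suffice, which keeps the exceptional set of \<open>\<omega>\<close> null.

  Second claim.  This is the theorem of Komlos, for a sequence that is bounded in \<open>L\<^sup>p\<close> with
  \<open>p > 1\<close> and has a Young measure (\<open>cesaro_subsequence\<close>).  The proof follows Etemadi's proof of
  the strong law of large numbers.  Truncate the \<open>k\<close>-th term at level about \<open>k\<close>; almost
  everywhere this changes only finitely many terms.  The Young measure gives the weak limits of the
  truncated functions, so a subsequence can be chosen whose deviations from these limits are almost
  orthogonal.  Their partial sums \<open>S\<^sub>N\<close> then satisfy \<open>\<integral> (S\<^sub>N / N)\<^sup>2 \<le> c N\<^sup>1\<^sup>-\<^sup>p\<close>, which is summable along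
  \<open>N = j\<^sup>a\<close> for large \<open>a\<close>.  Nonnegativity (of the positive and negative parts of the components)
  fills the gaps between consecutive powers.
\<close>


section \<open>The uniform boundedness principle in Lebesgue spaces\<close>

text \<open>
  The signs in the gliding hump argument: choosing them one after the other, each new term of
  \<open>\<Sum>\<^sub>i \<epsilon>\<^sub>i c\<^sub>i b\<^sub>j\<^sub>i\<close> can be given the sign of the sum of the earlier ones, so that they do not cancel it.
\<close>

lemma exists_noncancelling_signs:
  fixes b :: "nat \<Rightarrow> nat \<Rightarrow> real"
  assumes "\<And>j. b j j \<ge> 0"
  shows "\<exists>\<epsilon> :: nat \<Rightarrow> real. (\<forall>j. \<bar>\<epsilon> j\<bar> = 1) \<and> (\<forall>j. b j j \<le> \<bar>\<Sum>i<Suc j. \<epsilon> i * b j i\<bar>)"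
proof -
  have "\<exists>\<epsilon> :: nat \<Rightarrow> real. \<forall>j. \<epsilon> j = (if (\<Sum>i<j. \<epsilon> i * b j i) \<ge> 0 then 1 else - 1)"
  proof (rule dependent_wellorder_choice)
    fix r and f g :: "nat \<Rightarrow> real" and x :: nat
    assume "\<And>y. y < x \<Longrightarrow> f y = g y"
    then have "(\<Sum>i<x. f i * b x i) = (\<Sum>i<x. g i * b x i)"
      by (intro sum.cong) auto
    then show "(r = (if (\<Sum>i<x. f i * b x i) \<ge> 0 then 1 else - 1)) =
        (r = (if (\<Sum>i<x. g i * b x i) \<ge> 0 then 1 else - 1))"
      by simp
  qed auto
  then obtain \<epsilon> :: "nat \<Rightarrow> real"
    where \<epsilon>: "\<And>j. \<epsilon> j = (if (\<Sum>i<j. \<epsilon> i * b j i) \<ge> 0 then 1 else - 1)"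
    by blast
  have "\<bar>\<epsilon> j\<bar> = 1" for j
    by (subst \<epsilon>) auto
  moreover have "b j j \<le> \<bar>\<Sum>i<Suc j. \<epsilon> i * b j i\<bar>" for j
    using \<epsilon>[of j] assms[of j] by (auto split: if_splits)
  ultimately show ?thesis by blast
qed

lemma geometric_tail_third: "(\<Sum>i. (1 / 3 :: real) ^ (i + Suc j)) = (1 / 3) ^ j / 2"
proof -
  have "(\<Sum>i. (1 / 3 :: real) ^ (i + Suc j)) = (\<Sum>i. (1 / 3) ^ Suc j * (1 / 3 :: real) ^ i)"
    by (intro suminf_cong) (simp add: power_add mult_ac)
  also have "\<dots> = (1 / 3) ^ Suc j * (3 / 2)"
    by (subst suminf_mult) (auto simp: suminf_geometric)
  finally show ?thesis by simp
qed

text \<open>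
  Here \<open>b\<^sub>j\<^sub>i\<close> stands for the pairing of the \<open>j\<close>-th vector, of norm \<open>A\<^sub>j\<close>, with the \<open>i\<close>-th
  functional of norm one.  The terms up to \<open>j\<close> contribute at least \<open>3\<^sup>-\<^sup>j A\<^sub>j\<close> by the choice of signs,
  and those after \<open>j\<close> cancel at most half of it, because \<open>\<Sum>\<^sub>i\<^sub>>\<^sub>j 3\<^sup>-\<^sup>i = 3\<^sup>-\<^sup>j / 2\<close>.
\<close>

lemma gliding_hump_coefficients:
  fixes b :: "nat \<Rightarrow> nat \<Rightarrow> real" and A :: "nat \<Rightarrow> real"
  assumes b: "\<And>j i. \<bar>b j i\<bar> \<le> A j" "\<And>j. b j j = A j"
  shows "\<exists>\<epsilon> :: nat \<Rightarrow> real. (\<forall>j. \<bar>\<epsilon> j\<bar> = 1) \<and>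
    (\<forall>j. summable (\<lambda>i. \<epsilon> i * (1 / 3) ^ i * b j i) \<and>
         A j * (1 / 3) ^ j / 2 \<le> \<bar>\<Sum>i. \<epsilon> i * (1 / 3) ^ i * b j i\<bar>)"
proof -
  have A0: "A j \<ge> 0" for j
    using b(1)[of j j] by linarith
  then have "\<And>j. (1 / 3) ^ j * b j j \<ge> 0"
    by (simp add: b(2))
  from exists_noncancelling_signs[of "\<lambda>j i. (1 / 3) ^ i * b j i", OF this]
  obtain \<epsilon> :: "nat \<Rightarrow> real" where \<epsilon>: "\<And>j. \<bar>\<epsilon> j\<bar> = 1"
      "\<And>j. (1 / 3) ^ j * A j \<le> \<bar>\<Sum>i<Suc j. \<epsilon> i * (1 / 3) ^ i * b j i\<bar>"
    by (auto simp: b(2) mult.assoc)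
  have le: "\<bar>\<epsilon> i * (1 / 3) ^ i * b j i\<bar> \<le> A j * (1 / 3) ^ i" for i j
    using b(1)[of j i] \<epsilon>(1)[of i] by (simp add: abs_mult mult.commute mult_right_mono)
  have sm: "summable (\<lambda>i. A j * (1 / 3) ^ i)" for j
    by (intro summable_mult summable_geometric) auto
  have sm2: "summable (\<lambda>i. \<epsilon> i * (1 / 3) ^ i * b j i)" for j
    by (rule summable_comparison_test'[OF sm[of j], of 0]) (use le in auto)
  have "A j * (1 / 3) ^ j / 2 \<le> \<bar>\<Sum>i. \<epsilon> i * (1 / 3) ^ i * b j i\<bar>" for j
  proof -
    let ?x = "\<lambda>i. \<epsilon> i * (1 / 3) ^ i * b j i"
    have "\<bar>\<Sum>i. ?x (i + Suc j)\<bar> \<le> (\<Sum>i. A j * (1 / 3) ^ (i + Suc j))"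
    proof -
      have "summable (\<lambda>i. A j * (1 / 3) ^ (i + Suc j))"
        by (subst summable_iff_shift) (rule sm)
      moreover have "\<bar>?x (i + Suc j)\<bar> \<le> A j * (1 / 3) ^ (i + Suc j)" for i
        using le[of "i + Suc j" j] by simp
      ultimately show ?thesis
        using norm_suminf_le[of "\<lambda>i. ?x (i + Suc j)" "\<lambda>i. A j * (1 / 3) ^ (i + Suc j)"]
        by simp
    qed
    also have "\<dots> = A j * ((1 / 3) ^ j / 2)"
      by (subst suminf_mult) (auto simp only: geometric_tail_third summable_iff_shift intro!: summable_geometric, auto)
    finally have tail: "\<bar>\<Sum>i. ?x (i + Suc j)\<bar> \<le> A j * (1 / 3) ^ j / 2"
      by simp
    have "(\<Sum>i. ?x i) = (\<Sum>i. ?x (i + Suc j)) + (\<Sum>i<Suc j. ?x i)"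
      by (rule suminf_split_initial_segment[OF sm2])
    with tail \<epsilon>(2)[of j] show ?thesis
      by (auto simp: abs_if mult.commute split: if_splits)
  qed
  with \<epsilon>(1) sm2 show ?thesis by blast
qed

text \<open>
  Hoelder's inequality for a dual function of norm one, integrated from Young's inequality for the
  normalised product.
\<close>

lemma Lp_pairing_le:
  fixes v g :: "'a \<Rightarrow> 'b::euclidean_space"
  assumes p: "1 < p" and q: "q = p / (p - 1)"
    and [measurable]: "v \<in> borel_measurable M" "g \<in> borel_measurable M"
    and v: "integrable M (\<lambda>x. norm (v x) powr p)"
    and A: "A > 0" "(LINT x|M. norm (v x) powr p) = A powr p"
    and g: "integrable M (\<lambda>x. norm (g x) powr q)" "(LINT x|M. norm (g x) powr q) = 1"
  shows "integrable M (\<lambda>x. norm (v x) * norm (g x))" "(LINT x|M. norm (v x) * norm (g x)) \<le> A"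
proof -
  have q1: "q > 1" and pq: "1 / p + 1 / q = 1"
    using p by (simp_all add: q field_simps)
  let ?B = "\<lambda>x. A * ((norm (v x) powr p / A powr p) / p + norm (g x) powr q / q)"
  have le: "norm (v x) * norm (g x) \<le> ?B x" for x
  proof -
    have "(norm (v x) / A) * norm (g x) \<le> (norm (v x) / A) powr p / p + norm (g x) powr q / q"
      using A by (intro Youngs_inequality p q1 pq) auto
    then have "A * ((norm (v x) / A) * norm (g x)) \<le> A * ((norm (v x) / A) powr p / p + norm (g x) powr q / q)"
      using A by (intro mult_left_mono) auto
    then show ?thesis
      using A by (simp add: powr_divide)
  qed
  have B: "integrable M ?B"
    using v g by auto
  show I: "integrable M (\<lambda>x. norm (v x) * norm (g x))"
    by (rule Bochner_Integration.integrable_bound[OF B]) (use le in \<open>auto intro!: AE_I2 order_trans[OF le]\<close>)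
  have "(LINT x|M. norm (v x) * norm (g x)) \<le> (LINT x|M. ?B x)"
    by (rule integral_mono[OF I B le])
  also have "\<dots> = A * ((A powr p / A powr p) / p + 1 / q)"
    using v g A by simp
  also have "\<dots> = A"
    using A pq by simp
  finally show "(LINT x|M. norm (v x) * norm (g x)) \<le> A" .
qed

text \<open>
  The extremal function of the duality is \<open>|v|\<^sup>p\<^sup>-\<^sup>1 sgn v\<close>, normalised; it lies in \<open>L\<^sup>q\<close> because
  \<open>(p - 1) q = p\<close>.
\<close>

lemma Lp_norm_attained:
  fixes v :: "'a \<Rightarrow> 'b::euclidean_space"
  assumes p: "1 < p" and q: "q = p / (p - 1)"
    and [measurable]: "v \<in> borel_measurable M"
    and v: "integrable M (\<lambda>x. norm (v x) powr p)"
    and A: "A > 0" "(LINT x|M. norm (v x) powr p) = A powr p"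
  shows "\<exists>g. g \<in> borel_measurable M \<and> integrable M (\<lambda>x. norm (g x) powr q) \<and>
     (LINT x|M. norm (g x) powr q) = 1 \<and> (LINT x|M. v x \<bullet> g x) = A"
proof -
  let ?g = "\<lambda>x. ((norm (v x) / A) powr (p - 1)) *\<^sub>R sgn (v x)"
  have pq: "(p - 1) * q = p"
    using p by (simp add: q)
  have n: "norm (?g x) powr q = norm (v x) powr p / A powr p" for x
    using A p by (auto simp: norm_sgn powr_powr pq powr_divide)
  have i: "v x \<bullet> ?g x = norm (v x) powr p / A powr (p - 1)" for x
  proof (cases "v x = 0")
    case False
    have "norm (v x) powr p = norm (v x) powr (p - 1) * norm (v x)"
      using powr_mult_base[of "norm (v x)" "p - 1"] by (simp add: mult.commute)
    then show ?thesis
      using False A by (simp add: sgn_div_norm powr_divide power2_eq_square flip: power2_norm_eq_inner)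
  qed (use p in auto)
  have "(LINT x|M. v x \<bullet> ?g x) = A"
    unfolding i using A by (simp flip: powr_diff)
  moreover have "integrable M (\<lambda>x. norm (?g x) powr q)" "(LINT x|M. norm (?g x) powr q) = 1"
    unfolding n using A v by simp_all
  ultimately show ?thesis
    by (intro exI[of _ ?g]) auto
qed

text \<open>
  Normalised functions in \<open>L\<^sup>q\<close> may be superposed with geometrically decaying weights: since
  \<open>3\<^sup>-\<^sup>i = 2\<^sup>-\<^sup>i (2/3)\<^sup>i\<close>, the superposition is at most \<open>2 sup\<^sub>i (2/3)\<^sup>i |g\<^sub>i|\<close>, and the \<open>q\<close>-th power of the
  supremum is bounded by a summable series of integrable functions.
\<close>

lemma Lq_superposition:
  fixes g :: "nat \<Rightarrow> 'a \<Rightarrow> 'b::euclidean_space"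
  assumes q: "1 \<le> q" and [measurable]: "\<And>i. g i \<in> borel_measurable M"
    and g: "\<And>i. integrable M (\<lambda>x. norm (g i x) powr q)" "\<And>i. (LINT x|M. norm (g i x) powr q) = 1"
    and c: "\<And>i. \<bar>c i\<bar> = (1 / 3 :: real) ^ i"
  shows "AE x in M. summable (\<lambda>i. norm (c i *\<^sub>R g i x))"
    "integrable M (\<lambda>x. norm (\<Sum>i. c i *\<^sub>R g i x) powr q)"
proof -
  let ?Y = "\<lambda>i x. (2 / 3) ^ i * norm (g i x) powr q"
  have sm: "summable (\<lambda>i. LINT x|M. norm (?Y i x))"
    using g by (simp add: abs_mult)
  have iY: "integrable M (?Y i)" for i
    using g by simp
  have sY: "AE x in M. summable (\<lambda>i. norm (?Y i x))"
  proof -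
    have "(\<Sum>i. ennreal (LINT x|M. norm (?Y i x))) \<noteq> \<infinity>"
      using sm by (simp add: ennreal_suminf_neq_top)
    moreover have "(\<Sum>i. ennreal (LINT x|M. norm (?Y i x))) = (\<Sum>i. \<integral>\<^sup>+x. ennreal (norm (?Y i x)) \<partial>M)"
      using iY by (intro suminf_cong nn_integral_eq_integral[symmetric] integrable_norm) auto
    ultimately have "(\<integral>\<^sup>+x. (\<Sum>i. ennreal (norm (?Y i x))) \<partial>M) \<noteq> \<infinity>"
      by (subst nn_integral_suminf) auto
    then have "AE x in M. (\<Sum>i. ennreal (norm (?Y i x))) \<noteq> \<infinity>"
      by (intro nn_integral_noteq_infinite) auto
    then show ?thesis
      by eventually_elim (intro summable_suminf_not_top, auto)
  qed
  have bd: "summable (\<lambda>i. norm (c i *\<^sub>R g i x)) \<and>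
      norm (\<Sum>i. c i *\<^sub>R g i x) powr q \<le> 2 powr q * (\<Sum>i. ?Y i x)"
    if "summable (\<lambda>i. norm (?Y i x))" for x
  proof -
    define S where "S = (\<Sum>i. ?Y i x)"
    have sY: "summable (\<lambda>i. ?Y i x)"
      using that by (simp add: abs_mult)
    have S0: "S \<ge> 0"
      unfolding S_def by (rule suminf_nonneg[OF sY]) simp
    have le: "norm (c i *\<^sub>R g i x) \<le> S powr (1 / q) * (1 / 2) ^ i" for i
    proof -
      have "((2 / 3) ^ i * norm (g i x)) powr q = ((2 / 3) ^ i) powr q * norm (g i x) powr q"
        by (simp add: powr_mult)
      also have "\<dots> \<le> ?Y i x"
      proof (rule mult_right_mono)
        have "((2 / 3 :: real) ^ i) powr q \<le> ((2 / 3) ^ i) powr 1"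
          by (rule powr_mono') (use q in \<open>auto intro: power_le_one\<close>)
        then show "((2 / 3 :: real) ^ i) powr q \<le> (2 / 3) ^ i"
          by simp
      qed simp
      also have "\<dots> \<le> S"
        unfolding S_def using sum_le_suminf[OF sY, of "{i}"] by simp
      finally have "(((2 / 3) ^ i * norm (g i x)) powr q) powr (1 / q) \<le> S powr (1 / q)"
        using q by (intro powr_mono2) auto
      then have "(2 / 3) ^ i * norm (g i x) \<le> S powr (1 / q)"
        using q by (simp add: powr_powr)
      then have "(1 / 2) ^ i * ((2 / 3) ^ i * norm (g i x)) \<le> (1 / 2) ^ i * S powr (1 / q)"
        by (intro mult_left_mono) auto
      moreover have "(1 / 2 :: real) ^ i * (2 / 3) ^ i = (1 / 3) ^ i"
        unfolding power_mult_distrib[symmetric] by simp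
      ultimately have "(1 / 3) ^ i * norm (g i x) \<le> (1 / 2) ^ i * S powr (1 / q)"
        by (metis mult.assoc)
      then show ?thesis
        by (simp add: c mult.commute)
    qed
    have sg: "summable (\<lambda>i. S powr (1 / q) * (1 / 2 :: real) ^ i)"
      by (intro summable_mult summable_geometric) auto
    have s: "summable (\<lambda>i. norm (c i *\<^sub>R g i x))"
      by (rule summable_comparison_test'[OF sg, of 0]) (use le in simp)
    have "norm (\<Sum>i. c i *\<^sub>R g i x) \<le> (\<Sum>i. S powr (1 / q) * (1 / 2) ^ i)"
      by (rule norm_suminf_le[OF le sg])
    also have "\<dots> = 2 * S powr (1 / q)"
      by (subst suminf_mult) (auto simp: suminf_geometric)
    finally have "norm (\<Sum>i. c i *\<^sub>R g i x) powr q \<le> (2 * S powr (1 / q)) powr q"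
      using q by (intro powr_mono2) auto
    also have "\<dots> = 2 powr q * S"
      using q S0 by (simp add: powr_mult powr_powr)
    finally show ?thesis
      using s by (simp add: S_def)
  qed
  show "AE x in M. summable (\<lambda>i. norm (c i *\<^sub>R g i x))"
    using sY by eventually_elim (use bd in blast)
  have "integrable M (\<lambda>x. 2 powr q * (\<Sum>i. ?Y i x))"
    by (intro integrable_mult_right integrable_suminf[OF iY sY sm])
  then show "integrable M (\<lambda>x. norm (\<Sum>i. c i *\<^sub>R g i x) powr q)"
  proof (rule Bochner_Integration.integrable_bound)
    show "AE x in M. norm (norm (\<Sum>i. c i *\<^sub>R g i x) powr q) \<le> norm (2 powr q * (\<Sum>i. ?Y i x))"
      using sY
    proof eventually_elim
      case (elim x)
      from bd[OF this] show ?case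
        by auto
    qed
  qed simp
qed

text \<open>
  The uniform boundedness principle in \<open>L\<^sup>p\<close>, by the gliding hump method: if the norms of some
  \<open>v\<^sub>j\<close> grew faster than \<open>3\<^sup>j\<close>, superposing the functions that attain them with weights \<open>\<plusminus> 3\<^sup>-\<^sup>j\<close> would
  give one element of the dual space against which the \<open>v\<^sub>j\<close> are unbounded.
\<close>

lemma Lp_uniform_boundedness:
  fixes v :: "'i \<Rightarrow> 'a \<Rightarrow> 'b::euclidean_space"
  assumes p: "1 < p"
    and vm: "\<And>i. i \<in> I \<Longrightarrow> v i \<in> borel_measurable M"
    and vi: "\<And>i. i \<in> I \<Longrightarrow> integrable M (\<lambda>x. norm (v i x) powr p)"
    and bdd: "\<And>g. g \<in> borel_measurable M \<Longrightarrow> integrable M (\<lambda>x. norm (g x) powr (p / (p - 1))) \<Longrightarrow>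
       \<exists>B. \<forall>i\<in>I. \<bar>LINT x|M. v i x \<bullet> g x\<bar> \<le> B"
  shows "\<exists>B. \<forall>i\<in>I. (LINT x|M. norm (v i x) powr p) \<le> B"
proof (rule ccontr)
  assume neg: "\<not> ?thesis"
  define q where "q = p / (p - 1)"
  have q1: "q \<ge> 1"
    using p by (simp add: q_def)
  \<comment> \<open>Norms beyond \<open>2 (j + 1) 3\<^sup>j\<close> survive the weight \<open>3\<^sup>-\<^sup>j\<close> and the factor \<open>1/2\<close> lost to the tail.\<close>
  have "\<exists>i\<in>I. (LINT x|M. norm (v i x) powr p) > (2 * real (Suc j) * 3 ^ j) powr p" for j
    using neg by (auto simp: not_le)
  then obtain i where i: "\<And>j. i j \<in> I"
      "\<And>j. (LINT x|M. norm (v (i j) x) powr p) > (2 * real (Suc j) * 3 ^ j) powr p"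
    by metis
  define A where "A j = (LINT x|M. norm (v (i j) x) powr p) powr (1 / p)" for j
  have pos: "(LINT x|M. norm (v (i j) x) powr p) > 0" for j
    using i(2)[of j] by (meson powr_ge_zero order_le_less_trans)
  have A0: "A j > 0" for j
    using pos[of j] by (simp add: A_def)
  have Ap: "(LINT x|M. norm (v (i j) x) powr p) = A j powr p" for j
    using pos[of j] p by (simp add: A_def powr_powr)
  have Ag: "A j > 2 * real (Suc j) * 3 ^ j" for j
    using i(2)[of j] A0[of j] p powr_mono2[of p "A j" "2 * real (Suc j) * 3 ^ j"]
    unfolding Ap by linarith
  have "\<exists>g. \<forall>j. g j \<in> borel_measurable M \<and> integrable M (\<lambda>x. norm (g j x) powr q) \<and>
     (LINT x|M. norm (g j x) powr q) = 1 \<and> (LINT x|M. v (i j) x \<bullet> g j x) = A j"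
    by (intro choice allI Lp_norm_attained[OF p q_def vm[OF i(1)] vi[OF i(1)] A0 Ap])
  then obtain g where gm [measurable]: "\<And>j. g j \<in> borel_measurable M"
    and g: "\<And>j. integrable M (\<lambda>x. norm (g j x) powr q)" "\<And>j. (LINT x|M. norm (g j x) powr q) = 1"
      "\<And>j. (LINT x|M. v (i j) x \<bullet> g j x) = A j"
    by blast
  note vm' [measurable] = vm[OF i(1)]
  define b where "b j k = (LINT x|M. v (i j) x \<bullet> g k x)" for j k
  have hoelder: "integrable M (\<lambda>x. norm (v (i j) x) * norm (g k x))"
      "(LINT x|M. norm (v (i j) x) * norm (g k x)) \<le> A j" for j k
    using Lp_pairing_le[OF p q_def vm' gm vi[OF i(1)] A0 Ap g(1) g(2)] by auto
  have ivg: "integrable M (\<lambda>x. v (i j) x \<bullet> g k x)" for j k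
    by (rule Bochner_Integration.integrable_bound[OF hoelder(1)[of j k]])
       (auto simp: Cauchy_Schwarz_ineq2)
  have absvg: "(LINT x|M. \<bar>v (i j) x \<bullet> g k x\<bar>) \<le> A j" for j k
    by (rule order_trans[OF integral_mono[OF integrable_abs[OF ivg] hoelder(1)] hoelder(2)])
       (rule Cauchy_Schwarz_ineq2)
  have "\<bar>b j k\<bar> \<le> A j" for j k
    unfolding b_def by (rule order_trans[OF integral_abs_bound absvg])
  moreover have "b j j = A j" for j
    by (simp add: b_def g)
  ultimately obtain \<epsilon> :: "nat \<Rightarrow> real" where \<epsilon>: "\<And>j. \<bar>\<epsilon> j\<bar> = 1"
      "\<And>j. A j * (1 / 3) ^ j / 2 \<le> \<bar>\<Sum>k. \<epsilon> k * (1 / 3) ^ k * b j k\<bar>"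
    using gliding_hump_coefficients[of b A] by blast
  define c where "c k = \<epsilon> k * (1 / 3) ^ k" for k
  have c: "\<bar>c k\<bar> = (1 / 3) ^ k" for k
    by (simp add: c_def abs_mult \<epsilon>)
  define G where "G x = (\<Sum>k. c k *\<^sub>R g k x)" for x
  note sup = Lq_superposition[where c = c and g = g and M = M, OF q1 gm g(1) g(2) c]
  have [measurable]: "G \<in> borel_measurable M"
    unfolding G_def by measurable
  have "integrable M (\<lambda>x. norm (G x) powr q)"
    using sup(2) by (simp add: G_def)
  then obtain B where B: "\<And>j. \<bar>LINT x|M. v (i j) x \<bullet> G x\<bar> \<le> B"
    using bdd[of G] i(1) by (auto simp: q_def)
  have "real (Suc j) \<le> B" for j
  proof -
    have vG: "AE x in M. v (i j) x \<bullet> G x = (\<Sum>k. c k * (v (i j) x \<bullet> g k x))"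
      using sup(1)
    proof eventually_elim
      case (elim x)
      then have "summable (\<lambda>k. c k *\<^sub>R g k x)"
        by (rule summable_norm_cancel)
      from bounded_linear.suminf[OF bounded_linear_inner_right this, of "v (i j) x"]
      show ?case
        by (simp add: G_def)
    qed
    have "(LINT x|M. v (i j) x \<bullet> G x) = (LINT x|M. (\<Sum>k. c k * (v (i j) x \<bullet> g k x)))"
      by (rule integral_cong_AE[OF _ _ vG]) auto
    also have "\<dots> = (\<Sum>k. LINT x|M. c k * (v (i j) x \<bullet> g k x))"
    proof (rule integral_suminf)
      show "integrable M (\<lambda>x. c k * (v (i j) x \<bullet> g k x))" for k
        using ivg by simp
      show "AE x in M. summable (\<lambda>k. norm (c k * (v (i j) x \<bullet> g k x)))"
        using sup(1)
      proof eventually_elim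
        case (elim x)
        then have "summable (\<lambda>k. norm (v (i j) x) * norm (c k *\<^sub>R g k x))"
          by (rule summable_mult)
        then show ?case
        proof (rule summable_comparison_test'[where N = 0])
          fix k
          have "\<bar>v (i j) x \<bullet> (c k *\<^sub>R g k x)\<bar> \<le> norm (v (i j) x) * norm (c k *\<^sub>R g k x)"
            by (rule Cauchy_Schwarz_ineq2)
          then show "norm (norm (c k * (v (i j) x \<bullet> g k x))) \<le> norm (v (i j) x) * norm (c k *\<^sub>R g k x)"
            by simp
        qed
      qed
      have "summable (\<lambda>k. A j * (1 / 3) ^ k)"
        by (intro summable_mult summable_geometric) auto
      then show "summable (\<lambda>k. LINT x|M. norm (c k * (v (i j) x \<bullet> g k x)))"
      proof (rule summable_comparison_test'[where N = 0])
        fix k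
        have "(LINT x|M. norm (c k * (v (i j) x \<bullet> g k x))) = (1 / 3) ^ k * (LINT x|M. \<bar>v (i j) x \<bullet> g k x\<bar>)"
          by (simp add: abs_mult c)
        also have "\<dots> \<le> (1 / 3) ^ k * A j"
          by (intro mult_left_mono absvg) auto
        finally show "norm (LINT x|M. norm (c k * (v (i j) x \<bullet> g k x))) \<le> A j * (1 / 3) ^ k"
          by (simp add: mult.commute)
      qed
    qed
    also have "\<dots> = (\<Sum>k. \<epsilon> k * (1 / 3) ^ k * b j k)"
      by (simp add: b_def c_def)
    finally have "A j * (1 / 3) ^ j / 2 \<le> B"
      using \<epsilon>(2)[of j] B[of j] by linarith
    moreover have "(2 * real (Suc j) * 3 ^ j) * (1 / 3) ^ j / 2 \<le> A j * (1 / 3) ^ j / 2"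
      using Ag[of j] by (intro divide_right_mono mult_right_mono) auto
    moreover have "(2 * real (Suc j) * 3 ^ j) * (1 / 3) ^ j / 2 = real (Suc j)"
      by (simp add: power_divide)
    ultimately show ?thesis by linarith
  qed
  moreover obtain j where "B < real j"
    using reals_Archimedean2 by blast
  ultimately show False
    by (smt (verit) of_nat_Suc)
qed


section \<open>Averages of sequences\<close>

lemma cesaro_tendsto_0:
  fixes X :: "nat \<Rightarrow> real"
  assumes "X \<longlonglongrightarrow> 0"
  shows "(\<lambda>N. (\<Sum>k=1..N. X k) / real N) \<longlonglongrightarrow> 0"
proof (rule LIMSEQ_I)
  fix e :: real assume e: "e > 0"
  from LIMSEQ_D[OF assms, of "e / 2"] e obtain m where m: "\<And>k. k \<ge> m \<Longrightarrow> \<bar>X k\<bar> < e / 2"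
    by auto
  define S where "S = (\<Sum>k\<le>m. \<bar>X k\<bar>)"
  obtain n where n: "real n > 2 * S / e"
    using reals_Archimedean2 by blast
  have "norm ((\<Sum>k=1..N. X k) / real N - 0) < e" if N: "N \<ge> Suc n" for N
  proof -
    have "\<bar>\<Sum>k=1..N. X k\<bar> \<le> (\<Sum>k=1..N. \<bar>X k\<bar>)"
      by (rule sum_abs)
    also have "\<dots> \<le> (\<Sum>k=1..N. (if k \<le> m then \<bar>X k\<bar> else 0) + e / 2)"
      using m e by (intro sum_mono) (auto simp: less_imp_le)
    also have "\<dots> = (\<Sum>k=1..N. if k \<le> m then \<bar>X k\<bar> else 0) + N * (e / 2)"
      by (simp add: sum.distrib)
    also have "(\<Sum>k=1..N. if k \<le> m then \<bar>X k\<bar> else 0) = (\<Sum>k\<in>{1..N} \<inter> {..m}. \<bar>X k\<bar>)"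
      by (subst sum.inter_restrict) auto
    also have "\<dots> \<le> S"
      unfolding S_def by (intro sum_mono2) auto
    finally have 1: "\<bar>\<Sum>k=1..N. X k\<bar> \<le> S + N * (e / 2)" by simp
    have "2 * S / e < real N"
      using n N by linarith
    then have "S < N * (e / 2)"
      using e by (simp add: field_simps)
    with 1 have "\<bar>\<Sum>k=1..N. X k\<bar> < N * e"
      by linarith
    then show ?thesis
      using N by (simp add: field_simps)
  qed
  then show "\<exists>no. \<forall>N\<ge>no. norm ((\<Sum>k=1..N. X k) / real N - 0) < e" by blast
qed

lemma cesaro_tendsto_if_difference:
  fixes X Y :: "nat \<Rightarrow> real"
  assumes "(\<lambda>k. X k - Y k) \<longlonglongrightarrow> 0" "(\<lambda>N. (\<Sum>k=1..N. Y k) / real N) \<longlonglongrightarrow> L"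
  shows "(\<lambda>N. (\<Sum>k=1..N. X k) / real N) \<longlonglongrightarrow> L"
proof -
  have "(\<lambda>N. (\<Sum>k=1..N. X k - Y k) / real N + (\<Sum>k=1..N. Y k) / real N) \<longlonglongrightarrow> 0 + L"
    by (intro tendsto_add cesaro_tendsto_0 assms)
  then show ?thesis
    by (simp add: sum_subtractf diff_divide_distrib)
qed

lemma cesaro_tendsto:
  fixes X :: "nat \<Rightarrow> real"
  assumes "X \<longlonglongrightarrow> L"
  shows "(\<lambda>N. (\<Sum>k=1..N. X k) / real N) \<longlonglongrightarrow> L"
proof (rule cesaro_tendsto_if_difference)
  show "(\<lambda>k. X k - L) \<longlonglongrightarrow> 0"
    using assms by (simp add: LIM_zero)
  have "eventually (\<lambda>N. (\<Sum>k=1..N. L) / real N = L) sequentially"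
    using eventually_gt_at_top[of 0] by eventually_elim auto
  then show "(\<lambda>N. (\<Sum>k=1..N. L) / real N) \<longlonglongrightarrow> L"
    by (rule tendsto_eventually)
qed

text \<open>
  Partial sums of nonnegative terms are monotone, so between two consecutive \<open>a\<close>-th powers the
  averages are controlled by those at the powers, up to the ratio of the powers, which tends to one.
\<close>

lemma average_tendsto_if_along_powers:
  fixes S :: "nat \<Rightarrow> real"
  assumes S: "mono S" "S 0 \<ge> 0" and a: "a > 0"
    and lim: "(\<lambda>j. S (j ^ a) / real (j ^ a)) \<longlonglongrightarrow> L"
  shows "(\<lambda>N. S N / real N) \<longlonglongrightarrow> L"
proof -
  have S0: "S n \<ge> 0" for n
    using monoD[OF S(1), of 0 n] S(2) by simp
  \<comment> \<open>With \<open>j\<close> the integer root, \<open>j\<^sup>a \<le> N \<le> (j + 1)\<^sup>a\<close>.\<close>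
  let ?j = "nth_root_nat a"
  let ?low = "\<lambda>j. S (j ^ a) / real (j ^ a) * (real j / real (Suc j)) ^ a"
  let ?up = "\<lambda>j. S (Suc j ^ a) / real (Suc j ^ a) * (real (Suc j) / real j) ^ a"
  have r: "(\<lambda>j. (real j / real (Suc j)) ^ a) \<longlonglongrightarrow> 1 ^ a"
      "(\<lambda>j. (real (Suc j) / real j) ^ a) \<longlonglongrightarrow> 1 ^ a"
    by (intro tendsto_power LIMSEQ_n_over_Suc_n LIMSEQ_Suc_n_over_n)+
  have "?low \<longlonglongrightarrow> L * 1 ^ a" "?up \<longlonglongrightarrow> L * 1 ^ a"
    using tendsto_mult[OF lim r(1)] tendsto_mult[OF LIMSEQ_Suc[OF lim] r(2)] .
  then have lims: "?low \<longlonglongrightarrow> L" "?up \<longlonglongrightarrow> L"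
    by simp_all
  have j: "filterlim ?j at_top sequentially"
    unfolding filterlim_at_top
  proof
    fix x
    show "\<forall>\<^sub>F N in sequentially. x \<le> ?j N"
      using eventually_ge_at_top[of "x ^ a"] by eventually_elim (use a in \<open>auto intro: nth_root_nat_ge\<close>)
  qed
  have sandwich: "?low (?j N) \<le> S N / real N \<and> S N / real N \<le> ?up (?j N)" if N: "N \<ge> 1" for N
  proof -
    define j where "j = ?j N"
    have j1: "j \<ge> 1"
      using nth_root_nat_ge[of a 1 N] a N by (simp add: j_def)
    have le: "j ^ a \<le> N"
      using a by (simp add: j_def nth_root_nat_power_le)
    have "\<not> Suc j ^ a \<le> N"
      using nth_root_nat_ge[of a "Suc j" N] a by (auto simp: j_def)
    then have ge: "N \<le> Suc j ^ a" by simp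
    have "?low j = S (j ^ a) / real (Suc j ^ a)"
      using j1 by (simp add: power_divide)
    also have "\<dots> \<le> S N / real N"
      using monoD[OF S(1) le] S0 N ge by (intro frac_le) (auto simp flip: of_nat_power)
    finally have 1: "?low j \<le> S N / real N" .
    have "S N / real N \<le> S (Suc j ^ a) / real (j ^ a)"
      using monoD[OF S(1) ge] S0 j1 le by (intro frac_le) (auto simp flip: of_nat_power)
    also have "\<dots> = ?up j"
      using j1 by (simp add: power_divide del: of_nat_Suc power_Suc)
    finally show ?thesis
      using 1 by (simp add: j_def)
  qed
  show ?thesis
  proof (rule tendsto_sandwich)
    show "\<forall>\<^sub>F N in sequentially. ?low (?j N) \<le> S N / real N"
      using eventually_ge_at_top[of 1] by eventually_elim (use sandwich in blast)
    show "\<forall>\<^sub>F N in sequentially. S N / real N \<le> ?up (?j N)"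
      using eventually_ge_at_top[of 1] by eventually_elim (use sandwich in blast)
  qed (intro filterlim_compose[OF lims(1) j] filterlim_compose[OF lims(2) j])+
qed

text \<open>
  The sum of all \<open>Y\<^sub>j\<close> has a finite integral, so it is finite almost everywhere and its terms
  tend to zero.
\<close>

lemma AE_tendsto_0_if_summable_integral:
  fixes Y :: "nat \<Rightarrow> 'z \<Rightarrow> real"
  assumes Y: "\<And>j. integrable M (Y j)" "\<And>j z. Y j z \<ge> 0"
    and c: "\<And>j. (LINT z|M. Y j z) \<le> c j" "summable c"
  shows "AE z in M. (\<lambda>j. Y j z) \<longlonglongrightarrow> 0"
proof -
  have [measurable]: "Y j \<in> borel_measurable M" for j
    using Y(1) by auto
  have "summable (\<lambda>j. LINT z|M. Y j z)"
    by (rule summable_comparison_test'[OF c(2), of 0]) (use c(1) Y(2) in simp)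
  then have "(\<Sum>j. ennreal (LINT z|M. Y j z)) \<noteq> \<infinity>"
    using Y(2) by (simp add: ennreal_suminf_neq_top)
  then have "(\<integral>\<^sup>+z. (\<Sum>j. ennreal (Y j z)) \<partial>M) \<noteq> \<infinity>"
    using Y by (subst nn_integral_suminf) (auto simp: nn_integral_eq_integral)
  then have "AE z in M. (\<Sum>j. ennreal (Y j z)) \<noteq> \<infinity>"
    by (intro nn_integral_noteq_infinite) auto
  then show ?thesis
    by eventually_elim (intro summable_LIMSEQ_zero summable_suminf_not_top, use Y(2) in auto)
qed


section \<open>Barycentres of Young measures with bounded moments\<close>

lemma vanishing_continuous_bounded:
  fixes f :: "'e::euclidean_space \<Rightarrow> real"
  assumes f: "continuous_on UNIV f" and lim: "(f \<longlongrightarrow> 0) at_infinity"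
  shows "\<exists>B. \<forall>x. \<bar>f x\<bar> \<le> B"
proof -
  have "\<forall>\<^sub>F x in at_infinity. dist (f x) 0 < 1"
    using lim by (rule tendstoD) simp
  then obtain R where R: "\<And>x. R \<le> norm x \<Longrightarrow> \<bar>f x\<bar> < 1"
    by (auto simp: eventually_at_infinity)
  have "bounded (f ` cball 0 R)"
    by (intro compact_imp_bounded compact_continuous_image continuous_on_subset[OF f]) auto
  then obtain B where B: "\<And>x. x \<in> cball 0 R \<Longrightarrow> \<bar>f x\<bar> \<le> B"
    unfolding bounded_iff by (metis imageI real_norm_def)
  have "\<bar>f x\<bar> \<le> max 1 B" for x
    using R[of x] B[of x] by (cases "R \<le> norm x") auto
  then show ?thesis by blast
qed

text \<open>
  The cutoff is continuous with compact support, equals one on the ball of radius \<open>k + 1\<close>, and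
  increases to one with \<open>k\<close>.  The radii are shifted by one so that level \<open>0\<close> is not degenerate.
\<close>

definition cutoff :: "nat \<Rightarrow> 'e::real_normed_vector \<Rightarrow> real" where
  "cutoff k x = max 0 (min 1 (real k + 2 - norm x))"

lemma cutoff_bounds: "0 \<le> cutoff k x" "cutoff k x \<le> 1"
  by (auto simp: cutoff_def)

lemma cutoff_eq_1: "norm x \<le> real k + 1 \<Longrightarrow> cutoff k x = 1"
  by (auto simp: cutoff_def)

lemma cutoff_eq_0: "norm x \<ge> real k + 2 \<Longrightarrow> cutoff k x = 0"
  by (auto simp: cutoff_def)

lemma incseq_cutoff: "incseq (\<lambda>k. cutoff k x)"
  by (auto simp: incseq_def cutoff_def)

lemma eventually_cutoff_eq_1: "eventually (\<lambda>k. cutoff k x = 1) sequentially"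
proof -
  obtain n where "norm x \<le> real n"
    using real_arch_simple by blast
  then show ?thesis
    by (intro eventually_sequentiallyI[of n] cutoff_eq_1) linarith
qed

lemma continuous_on_cutoff: "continuous_on A (cutoff k)"
  unfolding cutoff_def by (intro continuous_intros)

lemma cutoff_vanishes_at_infinity:
  fixes f :: "'e::real_normed_vector \<Rightarrow> real"
  shows "((\<lambda>x. cutoff k x * f x) \<longlongrightarrow> 0) at_infinity"
proof (rule tendsto_eventually)
  show "\<forall>\<^sub>F x in at_infinity. cutoff k x * f x = 0"
    unfolding eventually_at_infinity by (intro exI[of _ "real k + 2"]) (auto simp: cutoff_eq_0)
qed

lemma le_one_plus_powr:
  fixes a p :: real
  assumes "p > 1" "a \<ge> 0"
  shows "a \<le> 1 + a powr p"
  using powr_mono[of 1 p a] assms by (cases "a \<le> 1") (auto intro: add_increasing2)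

text \<open>
  These two estimates are what a moment of order \<open>p\<close> between \<open>1\<close> and \<open>2\<close> gives: values above a
  level contribute little to the integral, and values below it contribute to the second moment
  only a power of the level that is less than one.
\<close>

lemma powr_split_le_above:
  fixes a R p :: real
  assumes "p > 1" "a > R" "R > 0"
  shows "a \<le> R powr (1 - p) * a powr p"
proof -
  have "a = a powr (1 - p) * a powr p"
    using assms by (simp flip: powr_add)
  also have "\<dots> \<le> R powr (1 - p) * a powr p"
    using assms by (intro mult_right_mono powr_mono2') auto
  finally show ?thesis .
qed

lemma powr_split_le_below:
  fixes a R p :: real
  assumes "p \<le> 2" "0 \<le> a" "a \<le> R"
  shows "a\<^sup>2 \<le> R powr (2 - p) * a powr p"
proof (cases "a = 0")
  case False
  then have "a\<^sup>2 = a powr (2 - p) * a powr p"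
    using assms by (simp flip: powr_add)
  also have "\<dots> \<le> R powr (2 - p) * a powr p"
    using assms by (intro mult_right_mono powr_mono2) auto
  finally show ?thesis .
qed auto

text \<open>
  A sequence with bounded moments of order \<open>p\<close> whose Dirac masses converge weakly-* to the family \<open>V\<close>
  of probability measures.  Only functions vanishing at infinity are tested, and both the
  measurability of \<open>V\<close> and the convergence are required for these alone; everything about functions
  of linear growth is derived from the moments.
\<close>

locale young_limit = finite_measure M for M :: "'z measure" +
  fixes u :: "nat \<Rightarrow> 'z \<Rightarrow> 'e::euclidean_space" and V :: "'z \<Rightarrow> 'e measure" and p C :: real
  assumes p: "1 < p" "p \<le> 2" and C: "0 \<le> C"
    and u_measurable [measurable]: "\<And>n. u n \<in> borel_measurable M"
    and moment: "\<And>n. (\<integral>\<^sup>+z. ennreal (norm (u n z) powr p) \<partial>M) \<le> ennreal C"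
    and V_prob: "\<And>z. z \<in> space M \<Longrightarrow> V z \<in> space (prob_algebra borel)"
    and V_measurable: "\<And>f :: 'e \<Rightarrow> real. continuous_on UNIV f \<Longrightarrow> (f \<longlongrightarrow> 0) at_infinity \<Longrightarrow>
       (\<lambda>z. LINT x|V z. f x) \<in> borel_measurable M"
    and young: "\<And>(f :: 'e \<Rightarrow> real) (g :: 'z \<Rightarrow> real) B. continuous_on UNIV f \<Longrightarrow> (f \<longlongrightarrow> 0) at_infinity \<Longrightarrow>
       g \<in> borel_measurable M \<Longrightarrow> (\<And>z. z \<in> space M \<Longrightarrow> \<bar>g z\<bar> \<le> B) \<Longrightarrow>
       (\<lambda>n. LINT z|M. g z * f (u n z)) \<longlonglongrightarrow> (LINT z|M. g z * (LINT x|V z. f x))"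
begin

lemma
  assumes "z \<in> space M"
  shows prob_space_V: "prob_space (V z)" and sets_V: "sets (V z) = sets borel"
  using V_prob[OF assms] by (auto simp: space_prob_algebra)

lemma integrable_bounded:
  fixes f :: "'z \<Rightarrow> real"
  assumes "f \<in> borel_measurable M" "\<And>z. z \<in> space M \<Longrightarrow> \<bar>f z\<bar> \<le> B"
  shows "integrable M f"
  by (rule integrable_const_bound[of _ B]) (use assms in auto)

lemma integrable_V_bounded:
  fixes f :: "'e \<Rightarrow> real"
  assumes "z \<in> space M" "f \<in> borel_measurable borel" "\<And>x. \<bar>f x\<bar> \<le> B"
  shows "integrable (V z) f"
proof -
  interpret V: prob_space "V z" by (rule prob_space_V[OF assms(1)])
  have "f \<in> borel_measurable (V z)"
    using assms(2) measurable_cong_sets[OF sets_V[OF assms(1)] refl] by blast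
  then show ?thesis
    by (intro V.integrable_const_bound[of _ B]) (use assms in auto)
qed

text \<open>The truncations make continuous functions admissible for the convergence of the locale.\<close>

definition trunc :: "nat \<Rightarrow> ('e \<Rightarrow> real) \<Rightarrow> 'e \<Rightarrow> real" where
  "trunc k f x = cutoff k x * f x"

definition bary :: "('e \<Rightarrow> real) \<Rightarrow> 'z \<Rightarrow> real" where
  "bary f z = (LINT x|V z. f x)"

lemma trunc_continuous: "continuous_on UNIV f \<Longrightarrow> continuous_on UNIV (trunc k f)"
  unfolding trunc_def by (intro continuous_intros continuous_on_cutoff)

lemma trunc_vanishes: "(trunc k f \<longlongrightarrow> 0) at_infinity"
  unfolding trunc_def by (rule cutoff_vanishes_at_infinity)

lemma trunc_bounded:
  assumes "continuous_on UNIV f"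
  shows "\<exists>B. \<forall>x. \<bar>trunc k f x\<bar> \<le> B"
  using vanishing_continuous_bounded[OF trunc_continuous[OF assms] trunc_vanishes] .

lemma bary_trunc_measurable [measurable]:
  "continuous_on UNIV f \<Longrightarrow> bary (trunc k f) \<in> borel_measurable M"
  unfolding bary_def by (intro V_measurable trunc_continuous trunc_vanishes)

lemma continuous_measurable: "continuous_on UNIV (f :: 'e \<Rightarrow> real) \<Longrightarrow> f \<in> borel_measurable borel"
  by (rule borel_measurable_continuous_onI)

lemma measurable_V: "z \<in> space M \<Longrightarrow> continuous_on UNIV (f :: 'e \<Rightarrow> real) \<Longrightarrow> f \<in> borel_measurable (V z)"
  using continuous_measurable measurable_cong_sets[OF sets_V refl] by blast

lemma integrable_trunc_V:
  "z \<in> space M \<Longrightarrow> continuous_on UNIV f \<Longrightarrow> integrable (V z) (trunc k f)"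
  using trunc_bounded[of f k] by (blast intro: integrable_V_bounded continuous_measurable trunc_continuous)

text \<open>
  Truncation gives access to unbounded functions by monotone convergence.  In particular
  their integrals depend measurably on \<open>z\<close>.
\<close>

lemma nn_bary_SUP:
  fixes f :: "'e \<Rightarrow> real"
  assumes z: "z \<in> space M" and f: "continuous_on UNIV f" "\<And>x. f x \<ge> 0"
  shows "(\<integral>\<^sup>+x. ennreal (f x) \<partial>V z) = (SUP k. ennreal (bary (trunc k f) z))"
proof -
  have "(\<integral>\<^sup>+x. ennreal (f x) \<partial>V z) = (\<integral>\<^sup>+x. (SUP k. ennreal (trunc k f x)) \<partial>V z)"
  proof (rule nn_integral_cong)
    fix x
    have "incseq (\<lambda>k. ennreal (trunc k f x))"
      using incseq_cutoff[of x] f(2)[of x]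
      by (auto simp: incseq_def trunc_def intro!: ennreal_leI mult_right_mono)
    moreover have "(\<lambda>k. ennreal (trunc k f x)) \<longlonglongrightarrow> ennreal (f x)"
      by (rule tendsto_eventually) (use eventually_cutoff_eq_1[of x] in \<open>auto simp: trunc_def elim!: eventually_mono\<close>)
    ultimately show "ennreal (f x) = (SUP k. ennreal (trunc k f x))"
      using LIMSEQ_SUP LIMSEQ_unique by blast
  qed
  also have "\<dots> = (SUP k. \<integral>\<^sup>+x. ennreal (trunc k f x) \<partial>V z)"
  proof (rule nn_integral_monotone_convergence_SUP)
    show "incseq (\<lambda>k x. ennreal (trunc k f x))"
      using incseq_cutoff f(2)
      by (auto simp: incseq_def le_fun_def trunc_def intro!: ennreal_leI mult_right_mono)
    show "(\<lambda>x. ennreal (trunc k f x)) \<in> borel_measurable (V z)" for k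
      using measurable_V[OF z trunc_continuous[OF f(1), of k]] by simp
  qed
  also have "\<dots> = (SUP k. ennreal (bary (trunc k f) z))"
    unfolding bary_def using z f
    by (intro SUP_cong refl nn_integral_eq_integral integrable_trunc_V)
       (auto simp: trunc_def cutoff_bounds)
  finally show ?thesis .
qed

lemma nn_bary_measurable:
  fixes f :: "'e \<Rightarrow> real"
  assumes f: "continuous_on UNIV f" "\<And>x. f x \<ge> 0"
  shows "(\<lambda>z. \<integral>\<^sup>+x. ennreal (f x) \<partial>V z) \<in> borel_measurable M"
proof -
  note [measurable] = bary_trunc_measurable[OF f(1)]
  have "(\<lambda>z. SUP k. ennreal (bary (trunc k f) z)) \<in> borel_measurable M"
    by measurable
  then show ?thesis
    by (rule measurable_cong[THEN iffD2, rotated]) (rule nn_bary_SUP[OF _ f])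
qed

lemma
  fixes f :: "'e \<Rightarrow> real"
  assumes f: "continuous_on UNIV f"
  shows integrable_V_measurable: "Measurable.pred M (\<lambda>z. integrable (V z) f)"
    and bary_measurable: "bary f \<in> borel_measurable M"
proof -
  have cont: "continuous_on UNIV (\<lambda>x. max 0 (f x))" "continuous_on UNIV (\<lambda>x. max 0 (- f x))"
    using f by (auto intro!: continuous_intros)
  define P where "P z = (\<integral>\<^sup>+x. ennreal (max 0 (f x)) \<partial>V z)" for z
  define N where "N z = (\<integral>\<^sup>+x. ennreal (max 0 (- f x)) \<partial>V z)" for z
  have [measurable]: "P \<in> borel_measurable M" "N \<in> borel_measurable M"
    unfolding P_def N_def by (rule nn_bary_measurable[OF cont(1)] nn_bary_measurable[OF cont(2)]; simp)+
  have int: "integrable (V z) f \<longleftrightarrow> P z < \<infinity> \<and> N z < \<infinity>" if z: "z \<in> space M" for z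
    using measurable_V[OF z f] unfolding real_integrable_def P_def N_def by (simp add: less_top)
  have "Measurable.pred M (\<lambda>z. P z < \<infinity> \<and> N z < \<infinity>)"
    by measurable
  then show "Measurable.pred M (\<lambda>z. integrable (V z) f)"
    by (rule measurable_cong[THEN iffD2, rotated]) (rule int)
  have "(\<lambda>z. if P z < \<infinity> \<and> N z < \<infinity> then enn2real (P z) - enn2real (N z) else 0) \<in> borel_measurable M"
    by measurable
  moreover have "bary f z = (if P z < \<infinity> \<and> N z < \<infinity> then enn2real (P z) - enn2real (N z) else 0)"
    if z: "z \<in> space M" for z
    using int[OF z] unfolding bary_def P_def N_def
    by (simp add: real_lebesgue_integral_def not_integrable_integral_eq)
  ultimately show "bary f \<in> borel_measurable M"
    by (subst measurable_cong)
qed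

text \<open>
  Where the function is not integrable, the integral is zero by convention; the set of
  these \<open>z\<close> is measurable, which makes the barycentre measurable without exceptional sets.
\<close>

lemma barycentre_measurable:
  fixes L :: "'e \<Rightarrow> 'b::euclidean_space"
  assumes L: "continuous_on UNIV L"
  shows "(\<lambda>z. LINT x|V z. L x) \<in> borel_measurable M"
proof -
  have cont: "continuous_on UNIV (\<lambda>x. L x \<bullet> b)" for b
    using L by (intro continuous_intros)
  note [measurable] = integrable_V_measurable[OF cont] bary_measurable[OF cont]
  have "(\<lambda>z. if \<forall>b\<in>Basis. integrable (V z) (\<lambda>x. L x \<bullet> b)
      then \<Sum>b\<in>Basis. bary (\<lambda>x. L x \<bullet> b) z *\<^sub>R b else 0) \<in> borel_measurable M"
    by measurable
  moreover have "(LINT x|V z. L x) = (if \<forall>b\<in>Basis. integrable (V z) (\<lambda>x. L x \<bullet> b)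
      then \<Sum>b\<in>Basis. bary (\<lambda>x. L x \<bullet> b) z *\<^sub>R b else 0)" for z
  proof (cases "\<forall>b\<in>Basis. integrable (V z) (\<lambda>x. L x \<bullet> b)")
    case True
    then have "integrable (V z) (\<lambda>x. \<Sum>b\<in>Basis. (L x \<bullet> b) *\<^sub>R b)"
      by (intro Bochner_Integration.integrable_sum integrable_scaleR_left) auto
    then have int: "integrable (V z) L"
      by (simp add: euclidean_representation)
    have "(LINT x|V z. L x) = (\<Sum>b\<in>Basis. ((LINT x|V z. L x) \<bullet> b) *\<^sub>R b)"
      by (rule euclidean_representation[symmetric])
    also have "\<dots> = (\<Sum>b\<in>Basis. bary (\<lambda>x. L x \<bullet> b) z *\<^sub>R b)"
      using int by (simp add: bary_def)
    finally show ?thesis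
      using True by simp
  next
    case False
    then have "\<not> integrable (V z) L"
      by auto
    then show ?thesis
      unfolding if_not_P[OF False] by (rule not_integrable_integral_eq)
  qed
  ultimately show ?thesis
    by simp
qed

lemma bary_trunc_le:
  assumes z: "z \<in> space M" and f: "continuous_on UNIV f" and B: "\<And>x. \<bar>trunc k f x\<bar> \<le> B"
  shows "\<bar>bary (trunc k f) z\<bar> \<le> B"
proof -
  interpret V: prob_space "V z" by (rule prob_space_V[OF z])
  have "\<bar>bary (trunc k f) z\<bar> \<le> (LINT x|V z. \<bar>trunc k f x\<bar>)"
    unfolding bary_def by (rule integral_abs_bound)
  also have "\<dots> \<le> (LINT x|V z. B)"
    by (intro integral_mono integrable_abs integrable_trunc_V z f B) auto
  finally show ?thesis
    by (simp add: V.prob_space)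
qed

lemma continuous_norm_powr: "continuous_on UNIV (\<lambda>x :: 'e. norm x powr p)"
  by (rule continuous_on_powr') (use p in \<open>auto intro!: continuous_intros\<close>)

lemma u_moment: "integrable M (\<lambda>z. norm (u n z) powr p)" "(LINT z|M. norm (u n z) powr p) \<le> C"
proof -
  show int: "integrable M (\<lambda>z. norm (u n z) powr p)"
    using moment[of n] by (intro integrableI_bounded) (auto simp: le_less_trans)
  show "(LINT z|M. norm (u n z) powr p) \<le> C"
    using moment[of n] C by (simp add: nn_integral_eq_integral[OF int])
qed

text \<open>
  The moment bound passes to the limit, first for truncated moments by convergence, then for the
  full moment monotonically.
\<close>

lemma moment_V: "(\<integral>\<^sup>+z. \<integral>\<^sup>+x. ennreal (norm x powr p) \<partial>V z \<partial>M) \<le> ennreal C"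
proof -
  let ?f = "\<lambda>x :: 'e. norm x powr p"
  note cont = continuous_norm_powr
  note [measurable] = bary_trunc_measurable[OF cont] continuous_measurable[OF cont]
      continuous_measurable[OF trunc_continuous[OF cont]]
  have nonneg: "bary (trunc k ?f) z \<ge> 0" for k z
    unfolding bary_def by (intro integral_nonneg_AE AE_I2) (simp add: trunc_def cutoff_bounds)
  have int: "integrable M (bary (trunc k ?f))" for k
  proof -
    obtain B where B: "\<And>x. \<bar>trunc k ?f x\<bar> \<le> B"
      using trunc_bounded[OF cont] by blast
    have "\<bar>bary (trunc k ?f) z\<bar> \<le> B" if z: "z \<in> space M" for z
      by (rule bary_trunc_le[OF z cont B])
    then show ?thesis
      by (intro integrable_bounded) auto
  qed
  have le: "(LINT z|M. bary (trunc k ?f) z) \<le> C" for k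
  proof -
    have "(\<lambda>n. LINT z|M. 1 * trunc k ?f (u n z)) \<longlonglongrightarrow> (LINT z|M. 1 * (LINT x|V z. trunc k ?f x))"
      by (rule young[where B = 1]) (auto intro: trunc_continuous cont trunc_vanishes)
    then have lim: "(\<lambda>n. LINT z|M. trunc k ?f (u n z)) \<longlonglongrightarrow> (LINT z|M. bary (trunc k ?f) z)"
      by (simp add: bary_def)
    have "(LINT z|M. trunc k ?f (u n z)) \<le> C" for n
    proof -
      have tr: "trunc k ?f x \<le> ?f x" for x
        using mult_right_mono[OF cutoff_bounds(2)[of k x], of "?f x"] by (simp add: trunc_def)
      have "(LINT z|M. trunc k ?f (u n z)) \<le> (LINT z|M. ?f (u n z))"
        by (rule integral_mono_AE'[OF u_moment(1)]) (auto simp: tr)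
      then show ?thesis
        using u_moment(2)[of n] by linarith
    qed
    then show ?thesis
      by (intro LIMSEQ_le_const2[OF lim]) auto
  qed
  have "(\<integral>\<^sup>+z. \<integral>\<^sup>+x. ennreal (norm x powr p) \<partial>V z \<partial>M) = (\<integral>\<^sup>+z. (SUP k. ennreal (bary (trunc k ?f) z)) \<partial>M)"
    by (intro nn_integral_cong nn_bary_SUP cont) auto
  also have "\<dots> = (SUP k. \<integral>\<^sup>+z. ennreal (bary (trunc k ?f) z) \<partial>M)"
  proof (rule nn_integral_monotone_convergence_SUP_AE)
    show "AE z in M. ennreal (bary (trunc k ?f) z) \<le> ennreal (bary (trunc (Suc k) ?f) z)" for k
    proof (rule AE_I2)
      fix z assume z: "z \<in> space M"
      have "trunc k ?f x \<le> trunc (Suc k) ?f x" for x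
        using incseqD[OF incseq_cutoff, of k "Suc k" x] by (simp add: trunc_def mult_right_mono)
      then show "ennreal (bary (trunc k ?f) z) \<le> ennreal (bary (trunc (Suc k) ?f) z)"
        unfolding bary_def by (intro ennreal_leI integral_mono integrable_trunc_V z cont)
    qed
  qed auto
  also have "\<dots> \<le> ennreal C"
    using int nonneg C by (intro SUP_least) (simp add: nn_integral_eq_integral ennreal_leI le)
  finally show ?thesis .
qed

end

lemma tendsto_if_uniformly_approximated:
  fixes X :: "nat \<Rightarrow> real"
  assumes Xk: "\<And>k. Xk k \<longlonglongrightarrow> Yk k"
    and X: "\<And>k n. \<bar>X n - Xk k n\<bar> \<le> e k" and Y: "\<And>k. \<bar>Y - Yk k\<bar> \<le> e k"
    and e: "e \<longlonglongrightarrow> 0"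
  shows "X \<longlonglongrightarrow> Y"
proof (rule LIMSEQ_I)
  fix r :: real assume r: "r > 0"
  obtain k where k: "\<bar>e k\<bar> < r / 3"
    using LIMSEQ_D[OF e, of "r / 3"] r by auto
  obtain m where m: "\<And>n. n \<ge> m \<Longrightarrow> \<bar>Xk k n - Yk k\<bar> < r / 3"
    using LIMSEQ_D[OF Xk[of k], of "r / 3"] r by auto
  have "\<bar>X n - Y\<bar> < r" if "n \<ge> m" for n
    using m[OF that] k X[of n k] Y[of k] by linarith
  then show "\<exists>no. \<forall>n\<ge>no. norm (X n - Y) < r"
    by auto
qed

context young_limit
begin

lemma AE_moment_V: "AE z in M. integrable (V z) (\<lambda>x. norm x powr p)"
proof -
  have "AE z in M. (\<integral>\<^sup>+x. ennreal (norm x powr p) \<partial>V z) \<noteq> \<infinity>"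
    using moment_V by (intro nn_integral_noteq_infinite nn_bary_measurable continuous_norm_powr) (auto simp: top_unique)
  moreover have "AE z in M. z \<in> space M"
    by auto
  ultimately show ?thesis
  proof eventually_elim
    case (elim z)
    then show ?case
      using measurable_V[OF elim(2) continuous_norm_powr]
      by (intro integrableI_bounded) (auto simp: less_top)
  qed
qed

abbreviation V_moment :: "'z \<Rightarrow> real" where
  "V_moment \<equiv> bary (\<lambda>x. norm x powr p)"

lemma V_moment_nonneg: "V_moment z \<ge> 0"
  by (simp add: bary_def)

lemma V_moment_integrable: "integrable M V_moment" "(LINT z|M. V_moment z) \<le> C"
proof -
  note [measurable] = bary_measurable[OF continuous_norm_powr]
  have "(\<integral>\<^sup>+z. ennreal (V_moment z) \<partial>M) = (\<integral>\<^sup>+z. \<integral>\<^sup>+x. ennreal (norm x powr p) \<partial>V z \<partial>M)"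
    by (rule nn_integral_cong_AE)
       (use AE_moment_V in \<open>eventually_elim, simp add: bary_def nn_integral_eq_integral\<close>)
  with moment_V have le: "(\<integral>\<^sup>+z. ennreal (V_moment z) \<partial>M) \<le> ennreal C"
    by simp
  show int: "integrable M V_moment"
    using le by (intro integrableI_bounded) (auto simp: V_moment_nonneg le_less_trans)
  show "(LINT z|M. V_moment z) \<le> C"
    using le C V_moment_nonneg by (simp add: nn_integral_eq_integral[OF int])
qed

lemma AE_integrable_V_id: "AE z in M. integrable (V z) (\<lambda>x. x)"
  using AE_moment_V AE_space
proof eventually_elim
  case (elim z)
  interpret V: prob_space "V z" by (rule prob_space_V[OF elim(2)])
  have "(\<lambda>x. x) \<in> borel_measurable (V z)"
    by (rule measurable_ident_sets[OF sets_V[OF elim(2)]])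
  moreover have "integrable (V z) (\<lambda>x. 1 + norm x powr p)"
    using elim(1) by simp
  moreover have "AE x in V z. norm x \<le> norm (1 + norm x powr p)"
    by (intro AE_I2 order_trans[OF le_one_plus_powr[OF p(1) norm_ge_zero]]) simp
  ultimately show ?case
    using Bochner_Integration.integrable_bound[of "V z" "\<lambda>x. 1 + norm x powr p" "\<lambda>x. x"] by blast
qed

context
  fixes f :: "'e \<Rightarrow> real"
  assumes f: "continuous_on UNIV f" "\<And>x. \<bar>f x\<bar> \<le> norm x"
begin

lemma f_measurable [measurable]: "f \<in> borel_measurable borel" "trunc k f \<in> borel_measurable borel"
  using f(1) by (auto intro!: continuous_measurable trunc_continuous)

lemma bary_f_measurable [measurable]: "bary f \<in> borel_measurable M" "bary (trunc k f) \<in> borel_measurable M"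
  using f(1) by (auto intro!: bary_measurable trunc_continuous)

lemma f_le: "\<bar>f x\<bar> \<le> 1 + norm x powr p"
  using f(2)[of x] le_one_plus_powr[OF p(1) norm_ge_zero, of x] by linarith

lemma trunc_error: "\<bar>f x - trunc k f x\<bar> \<le> (real k + 1) powr (1 - p) * norm x powr p"
proof (cases "norm x \<le> real k + 1")
  case False
  have "\<bar>f x - trunc k f x\<bar> = (1 - cutoff k x) * \<bar>f x\<bar>"
  proof -
    have "f x - trunc k f x = (1 - cutoff k x) * f x"
      by (simp add: trunc_def algebra_simps)
    then show ?thesis
      using cutoff_bounds[of k x] by (simp add: abs_mult)
  qed
  also have "\<dots> \<le> 1 * norm x"
    using cutoff_bounds[of k x] f(2) by (intro mult_mono) auto
  also have "\<dots> \<le> (real k + 1) powr (1 - p) * norm x powr p"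
    using powr_split_le_above[of p "real k + 1" "norm x"] p False by simp
  finally show ?thesis .
qed (simp add: trunc_def cutoff_eq_1)

lemma trunc_square: "(trunc k f x)\<^sup>2 \<le> (real k + 2) powr (2 - p) * norm x powr p"
proof (cases "norm x \<le> real k + 2")
  case True
  have "\<bar>trunc k f x\<bar> \<le> 1 * norm x"
    unfolding trunc_def abs_mult using cutoff_bounds[of k x] f(2) by (intro mult_mono) auto
  then have "(trunc k f x)\<^sup>2 \<le> (norm x)\<^sup>2"
    by (simp add: abs_le_square_iff[symmetric])
  also have "\<dots> \<le> (real k + 2) powr (2 - p) * norm x powr p"
    using powr_split_le_below[of p "norm x" "real k + 2"] p True by simp
  finally show ?thesis .
qed (simp add: trunc_def cutoff_eq_0)

lemma f_u_integrable: "integrable M (\<lambda>z. f (u n z))"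
proof (rule Bochner_Integration.integrable_bound)
  show "integrable M (\<lambda>z. 1 + norm (u n z) powr p)"
    using u_moment(1) by simp
qed (auto intro!: order_trans[OF f_le])

lemma V_f_integrable:
  "z \<in> space M \<Longrightarrow> integrable (V z) (\<lambda>x. norm x powr p) \<Longrightarrow> integrable (V z) f"
proof -
  assume z: "z \<in> space M" and i: "integrable (V z) (\<lambda>x. norm x powr p)"
  interpret V: prob_space "V z" by (rule prob_space_V[OF z])
  have "integrable (V z) (\<lambda>x. 1 + norm x powr p)"
    using i by simp
  then show "integrable (V z) f"
    by (rule Bochner_Integration.integrable_bound)
       (auto intro!: order_trans[OF f_le] measurable_V[OF z f(1)])
qed

lemma AE_bary_bound: "AE z in M. \<bar>bary f z\<bar> \<le> 1 + V_moment z"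
  using AE_moment_V AE_space
proof eventually_elim
  case (elim z)
  interpret V: prob_space "V z" by (rule prob_space_V[OF elim(2)])
  have "\<bar>bary f z\<bar> \<le> (LINT x|V z. \<bar>f x\<bar>)"
    unfolding bary_def by (rule integral_abs_bound)
  also have "\<dots> \<le> (LINT x|V z. 1 + norm x powr p)"
    using elim by (intro integral_mono integrable_abs V_f_integrable f_le) auto
  finally show ?case
    using elim by (simp add: bary_def V.prob_space)
qed

lemma bary_f_integrable: "integrable M (bary f)"
proof (rule Bochner_Integration.integrable_bound)
  show "integrable M (\<lambda>z. 1 + V_moment z)"
    using V_moment_integrable(1) by simp
  show "AE z in M. norm (bary f z) \<le> norm (1 + V_moment z)"
    using AE_bary_bound by eventually_elim auto
qed simp

text \<open>
  The same rate as for the functions themselves: the error of truncation is estimated pointwise by the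
  \<open>p\<close>-th moment, before any integration.
\<close>

lemma bary_trunc_error:
  assumes "z \<in> space M" "integrable (V z) (\<lambda>x. norm x powr p)"
  shows "\<bar>bary f z - bary (trunc k f) z\<bar> \<le> (real k + 1) powr (1 - p) * V_moment z"
proof -
  note int = V_f_integrable[OF assms] integrable_trunc_V[OF assms(1) f(1), of k]
  have "\<bar>bary f z - bary (trunc k f) z\<bar> = \<bar>LINT x|V z. f x - trunc k f x\<bar>"
    using int by (simp add: bary_def)
  also have "\<dots> \<le> (LINT x|V z. \<bar>f x - trunc k f x\<bar>)"
    by (rule integral_abs_bound)
  also have "\<dots> \<le> (LINT x|V z. (real k + 1) powr (1 - p) * norm x powr p)"
    using int assms(2) by (intro integral_mono trunc_error integrable_abs) auto
  finally show ?thesis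
    by (simp add: bary_def)
qed

lemma truncation_rate_tendsto_0: "(\<lambda>k. (real k + 1) powr (1 - p)) \<longlonglongrightarrow> 0"
proof (rule tendsto_neg_powr)
  show "filterlim (\<lambda>k. real k + 1) at_top sequentially"
    by (rule filterlim_at_top_mono[OF filterlim_real_sequentially]) auto
qed (use p in auto)

lemma AE_bary_trunc_tendsto: "AE z in M. (\<lambda>k. bary (trunc k f) z) \<longlonglongrightarrow> bary f z"
  using AE_moment_V AE_space
proof eventually_elim
  case (elim z)
  have "(\<lambda>k. (real k + 1) powr (1 - p) * V_moment z) \<longlonglongrightarrow> 0"
    by (rule tendsto_mult_left_zero[OF truncation_rate_tendsto_0])
  then have "(\<lambda>k. bary (trunc k f) z - bary f z) \<longlonglongrightarrow> 0"
    by (rule Lim_null_comparison[rotated])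
       (use bary_trunc_error[OF elim(2) elim(1)] in \<open>auto simp: abs_minus_commute\<close>)
  then show ?case
    by (simp add: LIM_zero_iff)
qed

text \<open>
  The Young measure identifies the weak limit even of functions of linear growth: the moments
  make the contribution of large values uniformly small.
\<close>

lemma weak_convergence:
  assumes [measurable]: "g \<in> borel_measurable M" and g: "\<And>z. z \<in> space M \<Longrightarrow> \<bar>g z\<bar> \<le> B"
  shows "integrable M (\<lambda>z. g z * f (u n z))" "integrable M (\<lambda>z. g z * bary f z)"
    "(\<lambda>n. LINT z|M. g z * f (u n z)) \<longlonglongrightarrow> (LINT z|M. g z * bary f z)"
proof -
  have mult: "integrable M (\<lambda>z. g z * h z)" if "integrable M h" for h :: "'z \<Rightarrow> real"
  proof (rule Bochner_Integration.integrable_bound)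
    show "integrable M (\<lambda>z. B * h z)"
      using that by simp
    have "AE z in M. z \<in> space M"
      by simp
    then show "AE z in M. norm (g z * h z) \<le> norm (B * h z)"
    proof eventually_elim
      case (elim z)
      show ?case
        using order_trans[OF g[OF elim] abs_ge_self] by (simp add: abs_mult mult_right_mono)
    qed
  qed (use that in measurable)
  show "integrable M (\<lambda>z. g z * f (u n z))" "integrable M (\<lambda>z. g z * bary f z)"
    by (rule mult[OF f_u_integrable] mult[OF bary_f_integrable])+
  have bd: "\<bar>LINT z|M. g z * h z\<bar> \<le> \<bar>B\<bar> * (e * C)"
    if h: "integrable M h" and le: "AE z in M. \<bar>h z\<bar> \<le> e * m z" and e: "e \<ge> 0"
      and m: "integrable M m" "(LINT z|M. m z) \<le> C" for h m e
  proof -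
    have "\<bar>LINT z|M. g z * h z\<bar> \<le> (LINT z|M. \<bar>g z * h z\<bar>)"
      by (rule integral_abs_bound)
    also have "\<dots> \<le> (LINT z|M. \<bar>B\<bar> * (e * m z))"
    proof (rule integral_mono_AE)
      show "AE z in M. \<bar>g z * h z\<bar> \<le> \<bar>B\<bar> * (e * m z)"
        using le AE_space
      proof eventually_elim
        case (elim z)
        then show ?case
          unfolding abs_mult using g[of z] by (intro mult_mono) auto
      qed
    qed (use mult[OF h] m in auto)
    also have "\<dots> = \<bar>B\<bar> * (e * (LINT z|M. m z))"
      by simp
    also have "\<dots> \<le> \<bar>B\<bar> * (e * C)"
      using m e by (intro mult_left_mono) auto
    finally show ?thesis .
  qed
  have tu: "integrable M (\<lambda>z. trunc k f (u n z))" for k n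
    using trunc_bounded[OF f(1), of k] by (auto intro!: integrable_bounded)
  have tb: "integrable M (bary (trunc k f))" for k
  proof (rule Bochner_Integration.integrable_bound)
    show "integrable M (\<lambda>z. \<bar>bary f z\<bar> + (real k + 1) powr (1 - p) * V_moment z)"
      using bary_f_integrable V_moment_integrable by auto
    show "AE z in M. norm (bary (trunc k f) z) \<le> norm (\<bar>bary f z\<bar> + (real k + 1) powr (1 - p) * V_moment z)"
      using AE_moment_V AE_space
    proof eventually_elim
      case (elim z)
      show ?case
        using bary_trunc_error[OF elim(2,1), of k] by auto
    qed
  qed simp
  show "(\<lambda>n. LINT z|M. g z * f (u n z)) \<longlonglongrightarrow> (LINT z|M. g z * bary f z)"
  proof (rule tendsto_if_uniformly_approximated)
    fix k
    show "(\<lambda>n. LINT z|M. g z * trunc k f (u n z)) \<longlonglongrightarrow> (LINT z|M. g z * bary (trunc k f) z)"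
      unfolding bary_def by (rule young[OF trunc_continuous[OF f(1)] trunc_vanishes assms(1) g])
    show "\<bar>(LINT z|M. g z * f (u n z)) - (LINT z|M. g z * trunc k f (u n z))\<bar>
        \<le> \<bar>B\<bar> * ((real k + 1) powr (1 - p) * C)" for n
    proof -
      have "\<bar>LINT z|M. g z * (f (u n z) - trunc k f (u n z))\<bar> \<le> \<bar>B\<bar> * ((real k + 1) powr (1 - p) * C)"
        by (rule bd[OF _ _ _ u_moment]) (auto intro: f_u_integrable tu trunc_error)
      then show ?thesis
        using mult[OF f_u_integrable, of n] mult[OF tu, of k n] by (simp add: right_diff_distrib)
    qed
    show "\<bar>(LINT z|M. g z * bary f z) - (LINT z|M. g z * bary (trunc k f) z)\<bar>
        \<le> \<bar>B\<bar> * ((real k + 1) powr (1 - p) * C)"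
    proof -
      have "AE z in M. \<bar>bary f z - bary (trunc k f) z\<bar> \<le> (real k + 1) powr (1 - p) * V_moment z"
        using AE_moment_V AE_space by eventually_elim (rule bary_trunc_error)
      then have "\<bar>LINT z|M. g z * (bary f z - bary (trunc k f) z)\<bar> \<le> \<bar>B\<bar> * ((real k + 1) powr (1 - p) * C)"
        by (intro bd[OF _ _ _ V_moment_integrable]) (auto intro: bary_f_integrable tb)
      then show ?thesis
        using mult[OF bary_f_integrable] mult[OF tb, of k] by (simp add: right_diff_distrib)
    qed
  next
    have "(\<lambda>k. \<bar>B\<bar> * ((real k + 1) powr (1 - p) * C)) \<longlonglongrightarrow> \<bar>B\<bar> * (0 * C)"
      by (intro tendsto_intros truncation_rate_tendsto_0)
    then show "(\<lambda>k. \<bar>B\<bar> * ((real k + 1) powr (1 - p) * C)) \<longlonglongrightarrow> 0"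
      by simp
  qed
qed

end

end


section \<open>Almost everywhere convergence of Cesaro means\<close>

context young_limit
begin

definition deviation :: "('e \<Rightarrow> real) \<Rightarrow> nat \<Rightarrow> nat \<Rightarrow> 'z \<Rightarrow> real" where
  "deviation f k n z = trunc k f (u n z) - bary (trunc k f) z"

lemma deviation_bounded:
  assumes f: "continuous_on UNIV f"
  shows "\<exists>B. \<forall>n. \<forall>z\<in>space M. \<bar>deviation f k n z\<bar> \<le> B"
proof -
  obtain B where B: "\<And>x. \<bar>trunc k f x\<bar> \<le> B"
    using trunc_bounded[OF f] by blast
  have "\<bar>deviation f k n z\<bar> \<le> 2 * B" if "z \<in> space M" for n z
    using B[of "u n z"] bary_trunc_le[OF that f B] unfolding deviation_def by linarith
  then show ?thesis by blast
qed

lemma deviation_measurable: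
  assumes f: "continuous_on UNIV f"
  shows "deviation f k n \<in> borel_measurable M"
proof -
  note [measurable] = continuous_measurable[OF trunc_continuous[OF f]] bary_trunc_measurable[OF f]
  show ?thesis
    unfolding deviation_def by measurable
qed

lemma deviation_products_integrable:
  assumes f: "continuous_on UNIV f"
  shows "integrable M (\<lambda>z. deviation f j m z * deviation f k n z)"
proof -
  note [measurable] = deviation_measurable[OF f]
  obtain A B where A: "\<And>z. z \<in> space M \<Longrightarrow> \<bar>deviation f j m z\<bar> \<le> A"
    and B: "\<And>z. z \<in> space M \<Longrightarrow> \<bar>deviation f k n z\<bar> \<le> B"
    using deviation_bounded[OF f, of j] deviation_bounded[OF f, of k] by blast
  have "\<bar>deviation f j m z * deviation f k n z\<bar> \<le> A * B" if "z \<in> space M" for z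
    unfolding abs_mult using A[OF that] B[OF that] by (intro mult_mono) auto
  then show ?thesis
    by (intro integrable_bounded) auto
qed

lemma deviation_weakly_null:
  assumes f: "continuous_on UNIV f"
    and g: "g \<in> borel_measurable M" "\<And>z. z \<in> space M \<Longrightarrow> \<bar>g z\<bar> \<le> B"
  shows "(\<lambda>n. LINT z|M. g z * deviation f k n z) \<longlonglongrightarrow> 0"
proof -
  note [measurable] = continuous_measurable[OF trunc_continuous[OF f]] bary_trunc_measurable[OF f] g(1)
  obtain A where A: "\<And>x. \<bar>trunc k f x\<bar> \<le> A"
    using trunc_bounded[OF f] by blast
  have "integrable M (\<lambda>z. g z * trunc k f (u n z))" for n
  proof (rule integrable_bounded)
    show "\<bar>g z * trunc k f (u n z)\<bar> \<le> B * A" if "z \<in> space M" for z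
      unfolding abs_mult using g(2)[OF that] A by (intro mult_mono) auto
  qed measurable
  moreover have "integrable M (\<lambda>z. g z * bary (trunc k f) z)"
  proof (rule integrable_bounded)
    show "\<bar>g z * bary (trunc k f) z\<bar> \<le> B * A" if "z \<in> space M" for z
      unfolding abs_mult using g(2)[OF that] bary_trunc_le[OF that f A] by (intro mult_mono) auto
  qed measurable
  ultimately have eq: "(LINT z|M. g z * deviation f k n z) =
      (LINT z|M. g z * trunc k f (u n z)) - (LINT z|M. g z * bary (trunc k f) z)" for n
    by (simp add: deviation_def right_diff_distrib)
  show ?thesis
    unfolding eq bary_def using young[OF trunc_continuous[OF f] trunc_vanishes g, of k]
    by (rule LIM_zero)
qed

text \<open>
  For an integrand fixed in the past, the next deviation is eventually almost orthogonal to it.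
  The condition is imposed on all pairs of a level and an index up to the present ones, of which
  there are finitely many, so that it does not refer to the earlier choices.
\<close>

lemma almost_orthogonal_subsequence:
  assumes F: "finite F" "\<And>f. f \<in> F \<Longrightarrow> continuous_on UNIV f"
  shows "\<exists>r :: nat \<Rightarrow> nat. strict_mono r \<and> (\<forall>f\<in>F. \<forall>k. \<forall>j<k.
     \<bar>LINT z|M. deviation f j (r j) z * deviation f k (r k) z\<bar> \<le> 1 / (real k + 1))"
proof -
  let ?Q = "\<lambda>k x y. x < y \<and> (\<forall>f\<in>F. \<forall>j\<in>{..k}. \<forall>i\<in>{..x}.
     \<bar>LINT z|M. deviation f j i z * deviation f (Suc k) y z\<bar> \<le> 1 / (real (Suc k) + 1))"
  have "\<exists>y. ?Q k x y" for k x :: nat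
  proof -
    have ev: "\<forall>\<^sub>F y in sequentially. \<bar>LINT z|M. deviation f j i z * deviation f (Suc k) y z\<bar> \<le> 1 / (real (Suc k) + 1)"
      if f: "f \<in> F" for f j i
    proof -
      obtain B where "\<And>z. z \<in> space M \<Longrightarrow> \<bar>deviation f j i z\<bar> \<le> B"
        using deviation_bounded[OF F(2)[OF f], of j] by blast
      from deviation_weakly_null[OF F(2)[OF f] deviation_measurable[OF F(2)[OF f]] this]
      have "\<forall>\<^sub>F y in sequentially. \<bar>LINT z|M. deviation f j i z * deviation f (Suc k) y z\<bar> < 1 / (real (Suc k) + 1)"
        by (auto simp: tendsto_iff dist_real_def)
      then show ?thesis
        by (rule eventually_mono) simp
    qed
    have "\<forall>\<^sub>F y in sequentially. ?Q k x y"
      by (intro eventually_conj eventually_gt_at_top eventually_ball_finite ballI ev F) auto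
    then show ?thesis
      by (rule eventually_happens'[OF sequentially_bot])
  qed
  then have "\<exists>r. (\<forall>k. True) \<and> (\<forall>k. ?Q k (r k) (r (Suc k)))"
    using dependent_nat_choice[of "\<lambda>_ _. True" ?Q] by auto
  then obtain r where r: "\<And>k. ?Q k (r k) (r (Suc k))"
    by blast
  have "strict_mono r"
    using r by (auto simp: strict_mono_Suc_iff)
  moreover have "\<bar>LINT z|M. deviation f j (r j) z * deviation f k (r k) z\<bar> \<le> 1 / (real k + 1)"
    if fF: "f \<in> F" and jk: "j < k" for f j k
  proof -
    obtain k' where k': "k = Suc k'" "j \<le> k'"
      using jk by (cases k) auto
    then have "r j \<le> r k'"
      using \<open>strict_mono r\<close> by (simp add: strict_mono_less_eq)
    then show ?thesis
      using r[of k'] fF k' by auto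
  qed
  ultimately show ?thesis by blast
qed

text \<open>
  By Markov's inequality the \<open>k\<close>-th term exceeds \<open>k + 1\<close> on a set of measure at most
  \<open>C (k + 1)\<^sup>-\<^sup>p\<close>.  This is summable since \<open>p > 1\<close>, so the lemma of Borel and Cantelli applies,
  for every choice of the subsequence.
\<close>

lemma AE_eventually_below_level:
  "AE z in M. \<forall>\<^sub>F k in sequentially. norm (u (r k) z) \<le> real k + 1"
proof -
  define A where "A k = {z \<in> space M. (real k + 1) powr p \<le> norm (u (r k) z) powr p}" for k
  have [measurable]: "A k \<in> sets M" for k
    unfolding A_def by measurable
  have le: "measure M (A k) \<le> C * (real (Suc k) powr - p)" for k
  proof -
    have "measure M (A k) \<le> (LINT z|M. norm (u (r k) z) powr p) / (real k + 1) powr p"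
      unfolding A_def
      by (rule integral_Markov_inequality_measure[OF u_moment(1), where A = "{}"]) auto
    also have "\<dots> \<le> C / (real k + 1) powr p"
      by (intro divide_right_mono u_moment) auto
    finally show ?thesis
      by (simp add: powr_minus_divide add.commute)
  qed
  have "summable (\<lambda>k. real k powr - p)"
    using p by (simp add: summable_real_powr_iff)
  then have "summable (\<lambda>k. C * (real (Suc k) powr - p))"
    by (intro summable_mult) (subst summable_Suc_iff)
  then have "summable (\<lambda>k. measure M (A k))"
    by (rule summable_comparison_test'[where N = 0]) (use le in simp)
  then have "AE z in M. \<forall>\<^sub>F k in sequentially. z \<in> space M - A k"
    by (intro borel_cantelli_AE1) (auto simp: less_top[symmetric])
  then show ?thesis
  proof eventually_elim
    case (elim z)
    then show ?case
    proof (rule eventually_mono)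
      fix k assume "z \<in> space M - A k"
      then have "norm (u (r k) z) powr p < (real k + 1) powr p"
        by (auto simp: A_def)
      then show "norm (u (r k) z) \<le> real k + 1"
        using powr_mono2[of p "real k + 1" "norm (u (r k) z)"] p by fastforce
    qed
  qed
qed

context
  fixes f :: "'e \<Rightarrow> real"
  assumes f: "continuous_on UNIV f" "\<And>x. \<bar>f x\<bar> \<le> norm x"
begin

text \<open>
  Both the truncated function and its barycentre have second moment at most
  \<open>(k + 2)\<^sup>2\<^sup>-\<^sup>p C\<close>; for the barycentre this is the nonnegativity of the variance under \<open>V\<close>.
\<close>

lemma deviation_square_integral:
  "(LINT z|M. (deviation f k n z)\<^sup>2) \<le> 4 * C * (real k + 2) powr (2 - p)"
proof -
  note [measurable] = deviation_measurable[OF f(1)] bary_f_measurable[OF f]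
  let ?c = "(real k + 2) powr (2 - p)"
  have "(LINT z|M. (deviation f k n z)\<^sup>2) \<le>
      (LINT z|M. 2 * (?c * norm (u n z) powr p) + 2 * (?c * V_moment z))"
  proof (rule integral_mono_AE)
    show "integrable M (\<lambda>z. (deviation f k n z)\<^sup>2)"
      using deviation_products_integrable[OF f(1), of k n k n] by (simp add: power2_eq_square)
    show "integrable M (\<lambda>z. 2 * (?c * norm (u n z) powr p) + 2 * (?c * V_moment z))"
      using u_moment(1) V_moment_integrable(1) by simp
    show "AE z in M. (deviation f k n z)\<^sup>2 \<le> 2 * (?c * norm (u n z) powr p) + 2 * (?c * V_moment z)"
      using AE_moment_V AE_space
    proof eventually_elim
      case (elim z)
      interpret V: prob_space "V z" by (rule prob_space_V[OF elim(2)])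
      obtain B where B: "\<And>x. \<bar>trunc k f x\<bar> \<le> B"
        using trunc_bounded[OF f(1)] by blast
      have i2: "integrable (V z) (\<lambda>x. (trunc k f x)\<^sup>2)"
      proof (rule integrable_V_bounded[OF elim(2), where B = "B\<^sup>2"])
        show "\<bar>(trunc k f x)\<^sup>2\<bar> \<le> B\<^sup>2" for x
          using power_mono[OF B[of x], of 2] by simp
      qed (use continuous_measurable[OF trunc_continuous[OF f(1)]] in measurable)
      have "0 \<le> V.variance (trunc k f)"
        by (rule V.variance_positive)
      also have "\<dots> = (LINT x|V z. (trunc k f x)\<^sup>2) - (bary (trunc k f) z)\<^sup>2"
        unfolding bary_def by (rule V.variance_eq[OF integrable_trunc_V[OF elim(2) f(1)] i2])
      finally have "(bary (trunc k f) z)\<^sup>2 \<le> (LINT x|V z. (trunc k f x)\<^sup>2)"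
        by simp
      also have "\<dots> \<le> (LINT x|V z. ?c * norm x powr p)"
        using elim i2 by (intro integral_mono trunc_square f) auto
      also have "\<dots> = ?c * V_moment z"
        by (simp add: bary_def)
      finally have b: "(bary (trunc k f) z)\<^sup>2 \<le> ?c * V_moment z" .
      have "(deviation f k n z)\<^sup>2 \<le> 2 * (trunc k f (u n z))\<^sup>2 + 2 * (bary (trunc k f) z)\<^sup>2"
        using zero_le_power2[of "trunc k f (u n z) + bary (trunc k f) z"]
        unfolding deviation_def by (simp add: power2_sum power2_diff)
      then show ?case
        using b trunc_square[OF f, of k "u n z"] by linarith
    qed
  qed
  also have "\<dots> = 2 * (?c * (LINT z|M. norm (u n z) powr p)) + 2 * (?c * (LINT z|M. V_moment z))"
    using u_moment(1) V_moment_integrable(1) by simp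
  also have "\<dots> \<le> 2 * (?c * C) + 2 * (?c * C)"
    using u_moment(2) V_moment_integrable(2) by (intro add_mono mult_left_mono) auto
  finally show ?thesis
    by (simp add: mult_ac)
qed

context
  fixes r :: "nat \<Rightarrow> nat"
  assumes r: "\<And>j k. j < k \<Longrightarrow> \<bar>LINT z|M. deviation f j (r j) z * deviation f k (r k) z\<bar> \<le> 1 / (real k + 1)"
begin

definition deviation_sum :: "nat \<Rightarrow> 'z \<Rightarrow> real" where
  "deviation_sum N z = (\<Sum>k=1..N. deviation f k (r k) z)"

lemma deviation_sum_square_integrable: "integrable M (\<lambda>z. (deviation_sum N z)\<^sup>2)"
  unfolding deviation_sum_def power2_eq_square sum_product
  by (intro Bochner_Integration.integrable_sum deviation_products_integrable f)

text \<open>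
  In the step from \<open>N\<close> to \<open>N + 1\<close>, the mixed terms add up to at most \<open>2 N / (N + 2)\<close>, by almost
  orthogonality, so the diagonal terms dominate.
\<close>

lemma deviation_sum_square_integral:
  "(LINT z|M. (deviation_sum N z)\<^sup>2) \<le> real N * ((2 + 4 * C) * (real N + 2) powr (2 - p))"
proof (induction N)
  case 0
  show ?case by (simp add: deviation_sum_def)
next
  case (Suc N)
  let ?d = "deviation f (Suc N) (r (Suc N))"
  let ?c = "(real (Suc N) + 2) powr (2 - p)"
  have c: "?c \<ge> 1"
    using p by (intro ge_one_powr_ge_zero) auto
  have "deviation_sum N z * ?d z = (\<Sum>j=1..N. deviation f j (r j) z * ?d z)" for z
    by (simp add: deviation_sum_def sum_distrib_right)
  then have prod: "(deviation_sum N z + ?d z)\<^sup>2 = (deviation_sum N z)\<^sup>2 +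
      2 * (\<Sum>j=1..N. deviation f j (r j) z * ?d z) + ?d z * ?d z" for z
    by (simp only: power2_sum power2_eq_square[of "?d z"] mult.assoc)
  have "(LINT z|M. (deviation_sum (Suc N) z)\<^sup>2) = (LINT z|M. (deviation_sum N z + ?d z)\<^sup>2)"
    by (simp add: deviation_sum_def)
  also have "\<dots> = (LINT z|M. (deviation_sum N z)\<^sup>2) +
      2 * (\<Sum>j=1..N. LINT z|M. deviation f j (r j) z * ?d z) + (LINT z|M. ?d z * ?d z)"
    unfolding prod using deviation_sum_square_integrable deviation_products_integrable[OF f(1)] by simp
  also have "(\<Sum>j=1..N. LINT z|M. deviation f j (r j) z * ?d z) \<le> (\<Sum>j=1..N. 1 / (real (Suc N) + 1))"
    by (intro sum_mono order_trans[OF abs_ge_self r]) auto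
  also have "(\<Sum>j=1..N. 1 / (real (Suc N) + 1)) \<le> 1"
    by simp
  also have "(LINT z|M. ?d z * ?d z) \<le> 4 * C * ?c"
    using deviation_square_integral[of "Suc N" "r (Suc N)"] by (simp add: power2_eq_square)
  also have "(LINT z|M. (deviation_sum N z)\<^sup>2) \<le> real N * ((2 + 4 * C) * (real N + 2) powr (2 - p))"
    by (rule Suc.IH)
  also have "\<dots> \<le> real N * ((2 + 4 * C) * ?c)"
    using C p by (intro mult_left_mono powr_mono2) auto
  also have "real N * ((2 + 4 * C) * ?c) + 2 * 1 + 4 * C * ?c \<le> real (Suc N) * ((2 + 4 * C) * ?c)"
    using c by (simp add: algebra_simps)
  finally show ?case by simp
qed

lemma deviation_average_square_integral:
  assumes N: "N \<ge> 1"
  shows "(LINT z|M. (deviation_sum N z / real N)\<^sup>2) \<le> 3 * (2 + 4 * C) * real N powr (1 - p)"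
proof -
  have "(real N + 2) powr (2 - p) \<le> (3 * real N) powr (2 - p)"
    using p N by (intro powr_mono2) auto
  also have "\<dots> = 3 powr (2 - p) * real N powr (2 - p)"
    by (simp add: powr_mult)
  also have "\<dots> \<le> 3 powr 1 * real N powr (2 - p)"
    using p by (intro mult_right_mono powr_mono) auto
  finally have 1: "(real N + 2) powr (2 - p) \<le> 3 * real N powr (2 - p)" by simp
  have 2: "real N powr (2 - p) = real N * real N powr (1 - p)"
    using powr_mult_base[of "real N" "1 - p"] N by simp
  have "(LINT z|M. (deviation_sum N z / real N)\<^sup>2) = (LINT z|M. (deviation_sum N z)\<^sup>2) / (real N)\<^sup>2"
    by (simp add: power_divide)
  also have "\<dots> \<le> (real N * ((2 + 4 * C) * (3 * (real N * real N powr (1 - p))))) / (real N)\<^sup>2"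
    using 1 C unfolding 2
    by (intro divide_right_mono order_trans[OF deviation_sum_square_integral] mult_left_mono) auto
  also have "\<dots> = 3 * (2 + 4 * C) * real N powr (1 - p)"
    using N by (simp add: power2_eq_square)
  finally show ?thesis .
qed

lemma AE_deviation_average_along_powers:
  assumes a: "real a * (p - 1) \<ge> 2"
  shows "AE z in M. (\<lambda>j. deviation_sum (j ^ a) z / real (j ^ a)) \<longlonglongrightarrow> 0"
proof -
  have a0: "a > 0"
    using a by (cases a) auto
  have "AE z in M. (\<lambda>j. (deviation_sum (j ^ a) z / real (j ^ a))\<^sup>2) \<longlonglongrightarrow> 0"
  proof (rule AE_tendsto_0_if_summable_integral)
    show "integrable M (\<lambda>z. (deviation_sum (j ^ a) z / real (j ^ a))\<^sup>2)" for j
      using deviation_sum_square_integrable by (simp add: power_divide)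
    show "(LINT z|M. (deviation_sum (j ^ a) z / real (j ^ a))\<^sup>2) \<le> 3 * (2 + 4 * C) * real j powr - 2" for j
    proof (cases "j = 0")
      case True
      then show ?thesis
        using a0 by (simp add: deviation_sum_def)
    next
      case False
      have "real (j ^ a) powr (1 - p) = real j powr (real a * (1 - p))"
        using False by (simp add: powr_powr flip: powr_realpow)
      also have "\<dots> \<le> real j powr - 2"
        using False a by (intro powr_mono) (auto simp: algebra_simps)
      finally have "3 * (2 + 4 * C) * real (j ^ a) powr (1 - p) \<le> 3 * (2 + 4 * C) * real j powr - 2"
        using C by (intro mult_left_mono) auto
      moreover have "j ^ a \<ge> 1"
        using False by simp
      ultimately show ?thesis
        using deviation_average_square_integral[of "j ^ a"] by linarith
    qed
    show "summable (\<lambda>j. 3 * (2 + 4 * C) * real j powr - 2)"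
      by (intro summable_mult) (simp add: summable_real_powr_iff)
  qed auto
  then show ?thesis
    by eventually_elim (rule power_tendsto_0_iff[THEN iffD1, OF pos2])
qed

text \<open>
  The weak limit of the \<open>k\<close>-th truncated term depends on \<open>k\<close>, but tends to the barycentre of \<open>f\<close>, and so
  do its averages.  Thus the averages of the truncated terms converge along the \<open>a\<close>-th powers, where
  \<open>a (p - 1) \<ge> 2\<close>, and by monotonicity along all integers.
\<close>

lemma AE_cesaro_nonneg:
  assumes f0: "\<And>x. f x \<ge> 0"
  shows "AE z in M. (\<lambda>N. (\<Sum>k=1..N. f (u (r k) z)) / real N) \<longlonglongrightarrow> bary f z"
proof -
  define a where "a = nat \<lceil>2 / (p - 1)\<rceil>"
  have a: "real a * (p - 1) \<ge> 2"
  proof -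
    have "2 / (p - 1) \<le> real a"
      unfolding a_def using p by (simp add: of_nat_ceiling)
    then show ?thesis
      using p by (simp add: divide_le_eq)
  qed
  then have a0: "a > 0"
    by (cases a) auto
  show ?thesis
    using AE_deviation_average_along_powers[OF a] AE_eventually_below_level[of r] AE_bary_trunc_tendsto[OF f]
  proof eventually_elim
    case (elim z)
    define S where "S N = (\<Sum>k=1..N. trunc k f (u (r k) z))" for N
    have S: "S N = deviation_sum N z + (\<Sum>k=1..N. bary (trunc k f) z)" for N
      by (simp add: S_def deviation_sum_def deviation_def sum_subtractf)
    have "filterlim (\<lambda>j. j ^ a) at_top sequentially"
      using a0 by (intro filterlim_subseq) (auto simp: strict_mono_def power_strict_mono)
    from filterlim_compose[OF cesaro_tendsto[OF elim(3)] this]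
    have "(\<lambda>j. (\<Sum>k=1..j ^ a. bary (trunc k f) z) / real (j ^ a)) \<longlonglongrightarrow> bary f z" .
    from tendsto_add[OF elim(1) this]
    have "(\<lambda>j. S (j ^ a) / real (j ^ a)) \<longlonglongrightarrow> bary f z"
      by (simp add: S add_divide_distrib)
    moreover have "mono S"
    proof (rule incseq_SucI[unfolded incseq_def[symmetric]], goal_cases)
      case (1 n)
      have "trunc (Suc n) f (u (r (Suc n)) z) \<ge> 0"
        using f0 by (simp add: trunc_def cutoff_bounds)
      then show ?case
        by (simp add: S_def)
    qed
    ultimately have "(\<lambda>N. S N / real N) \<longlonglongrightarrow> bary f z"
      using a0 by (intro average_tendsto_if_along_powers[of S a]) (auto simp: S_def)
    moreover have "(\<lambda>k. f (u (r k) z) - trunc k f (u (r k) z)) \<longlonglongrightarrow> 0"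
      by (rule tendsto_eventually, rule eventually_mono[OF elim(2)]) (simp add: trunc_def cutoff_eq_1)
    ultimately show ?case
      unfolding S_def by (rule cesaro_tendsto_if_difference[rotated])
  qed
qed

end

end

text \<open>
  Positive and negative parts of the components are nonnegative functions of linear growth.  There are
  finitely many of them, so one subsequence is almost orthogonal for all.
\<close>

theorem cesaro_subsequence:
  "\<exists>r :: nat \<Rightarrow> nat. strict_mono r \<and>
     (AE z in M. (\<lambda>N. (\<Sum>k=1..N. u (r k) z) /\<^sub>R real N) \<longlonglongrightarrow> (LINT x|V z. x))"
proof -
  define part where "part b x = max 0 (x \<bullet> b)" for b x :: 'e
  let ?B = "Basis \<union> uminus ` Basis :: 'e set"
  have part: "continuous_on UNIV (part b)" "\<And>x. \<bar>part b x\<bar> \<le> norm x" "\<And>x. part b x \<ge> 0"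
    if "b \<in> ?B" for b
  proof -
    show "continuous_on UNIV (part b)"
      unfolding part_def by (intro continuous_intros)
    have "norm b = 1"
      using that by auto
    then show "\<bar>part b x\<bar> \<le> norm x" for x
      using norm_cauchy_schwarz[of x b] by (simp add: part_def)
  qed (simp add: part_def)
  have fin: "finite (part ` ?B)" and cont: "\<And>f. f \<in> part ` ?B \<Longrightarrow> continuous_on UNIV f"
    using part(1) by auto
  obtain r :: "nat \<Rightarrow> nat" where r: "strict_mono r"
    "\<And>f k j. f \<in> part ` ?B \<Longrightarrow> j < k \<Longrightarrow>
       \<bar>LINT z|M. deviation f j (r j) z * deviation f k (r k) z\<bar> \<le> 1 / (real k + 1)"
    using almost_orthogonal_subsequence[OF fin cont] by blast
  have "AE z in M. \<forall>b\<in>?B. (\<lambda>N. (\<Sum>k=1..N. part b (u (r k) z)) / real N) \<longlonglongrightarrow> bary (part b) z"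
    by (intro AE_finite_allI AE_cesaro_nonneg part r(2)) auto
  moreover have "AE z in M. (\<lambda>N. (\<Sum>k=1..N. u (r k) z) /\<^sub>R real N) \<longlonglongrightarrow> (LINT x|V z. x)"
    if all: "AE z in M. \<forall>b\<in>?B. (\<lambda>N. (\<Sum>k=1..N. part b (u (r k) z)) / real N) \<longlonglongrightarrow> bary (part b) z"
    using all AE_moment_V AE_integrable_V_id AE_space
  proof eventually_elim
    case (elim z)
    have diff: "part b x - part (- b) x = x \<bullet> b" for b x
      by (auto simp: part_def)
    show ?case
    proof (subst tendsto_componentwise_iff, rule ballI)
      fix b :: 'e assume b: "b \<in> Basis"
      then have b': "b \<in> ?B" "- b \<in> ?B"
        by auto
      have "(\<lambda>N. (\<Sum>k=1..N. part b (u (r k) z)) / real N - (\<Sum>k=1..N. part (- b) (u (r k) z)) / real N)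
          \<longlonglongrightarrow> bary (part b) z - bary (part (- b)) z"
        using elim(1) b' by (intro tendsto_diff) auto
      also have "bary (part b) z - bary (part (- b)) z = (LINT x|V z. part b x - part (- b) x)"
        unfolding bary_def
        using V_f_integrable[OF part(1,2)[OF b'(1)] elim(4,2)] V_f_integrable[OF part(1,2)[OF b'(2)] elim(4,2)]
        by simp
      also have "\<dots> = (LINT x|V z. x) \<bullet> b"
        using elim(3) by (simp add: diff)
      finally show "(\<lambda>N. ((\<Sum>k=1..N. u (r k) z) /\<^sub>R real N) \<bullet> b) \<longlonglongrightarrow> (LINT x|V z. x) \<bullet> b"
        by (simp add: diff inner_sum_left divide_inverse mult.commute
            flip: sum_subtractf right_diff_distrib diff_divide_distrib)
    qed
  qed
  ultimately show ?thesis
    using r(1) by blast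
qed

end


section \<open>Trigonometric polynomials on the torus\<close>

definition fourier_mode :: "real \<Rightarrow> int^3 \<Rightarrow> real \<Rightarrow> real^3 \<Rightarrow> real" where
  "fourier_mode l k \<theta> x = cos (2 * pi / l * (\<Sum>i\<in>UNIV. of_int (k $ i) * x $ i) + \<theta>)"

text \<open>
  Each differentiation in direction \<open>i\<close> multiplies a mode by its frequency in that direction and
  shifts the phase by a quarter period, which gives all iterated derivatives explicitly.
\<close>

lemma smooth_fourier_mode:
  fixes b :: "'b::euclidean_space"
  shows "smooth (\<lambda>x. fourier_mode l k \<theta> x *\<^sub>R b)"
proof -
  let ?f = "\<lambda>i. 2 * pi / l * of_int (k $ i)"
  let ?D = "\<lambda>is x. (prod_list (map ?f is) * fourier_mode l k (\<theta> + real (length is) * (pi / 2)) x) *\<^sub>R b"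
  have "(?D is has_derivative (\<lambda>v. \<Sum>i\<in>UNIV. v $ i *\<^sub>R ?D (i # is) x)) (at x)" for "is" x
  proof -
    let ?P = "prod_list (map ?f is)"
    let ?t = "\<theta> + real (length is) * (pi / 2)"
    let ?a = "\<lambda>x :: real^3. 2 * pi / l * (\<Sum>i\<in>UNIV. of_int (k $ i) * x $ i) + ?t"
    have lin: "bounded_linear (\<lambda>x :: real^3. x $ i)" for i
      by (rule bounded_linear_vec_nth)
    have "bounded_linear (\<lambda>v :: real^3. \<Sum>i\<in>UNIV. ?f i * v $ i)"
      by (intro bounded_linear_sum bounded_linear_const_mult lin)
    then have "((\<lambda>x. (\<Sum>i\<in>UNIV. ?f i * x $ i) + ?t) has_derivative (\<lambda>v. (\<Sum>i\<in>UNIV. ?f i * v $ i) + 0)) (at x)"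
      by (intro has_derivative_add bounded_linear_imp_has_derivative has_derivative_const)
    moreover have "(\<Sum>i\<in>UNIV. ?f i * y $ i) = 2 * pi / l * (\<Sum>i\<in>UNIV. of_int (k $ i) * y $ i)" for y :: "real^3"
      unfolding sum_distrib_left by (intro sum.cong refl) (simp only: mult.assoc)
    ultimately have a: "(?a has_derivative (\<lambda>v. \<Sum>i\<in>UNIV. ?f i * v $ i)) (at x)"
      by (simp only: add_0_right)
    have "((\<lambda>x. (?P * cos (?a x)) *\<^sub>R b) has_derivative
        (\<lambda>v. (?P * ((\<Sum>i\<in>UNIV. ?f i * v $ i) * - sin (?a x))) *\<^sub>R b)) (at x)"
      by (rule has_derivative_scaleR_left[OF has_derivative_mult_right[OF has_derivative_cos[OF a]]])
    also have "(\<lambda>v. (?P * ((\<Sum>i\<in>UNIV. ?f i * v $ i) * - sin (?a x))) *\<^sub>R b) =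
        (\<lambda>v. \<Sum>i\<in>UNIV. v $ i *\<^sub>R ?D (i # is) x)"
    proof
      fix v :: "real^3"
      have "fourier_mode l k (\<theta> + real (length (i # is)) * (pi / 2)) x = - sin (?a x)" for i
      proof -
        have "2 * pi / l * (\<Sum>i\<in>UNIV. of_int (k $ i) * x $ i) + (\<theta> + real (length (i # is)) * (pi / 2)) = ?a x + pi / 2"
          by (simp add: algebra_simps add_divide_distrib)
        then show ?thesis
          unfolding fourier_mode_def by (simp only: cos_add) simp
      qed
      then have "(\<Sum>i\<in>UNIV. v $ i *\<^sub>R ?D (i # is) x) = (\<Sum>i\<in>UNIV. (v $ i * (?f i * ?P * (- sin (?a x)))) *\<^sub>R b)"
        by (simp only: list.map prod_list.Cons scaleR_scaleR)
      also have "\<dots> = (\<Sum>i\<in>UNIV. v $ i * (?f i * ?P * (- sin (?a x)))) *\<^sub>R b"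
        by (rule scaleR_left.sum[symmetric])
      also have "(\<Sum>i\<in>UNIV. v $ i * (?f i * ?P * (- sin (?a x)))) = ?P * ((\<Sum>i\<in>UNIV. ?f i * v $ i) * - sin (?a x))"
        unfolding sum_distrib_left sum_distrib_right by (intro sum.cong refl) (simp only: mult_ac)
      finally show "(?P * ((\<Sum>i\<in>UNIV. ?f i * v $ i) * - sin (?a x))) *\<^sub>R b = (\<Sum>i\<in>UNIV. v $ i *\<^sub>R ?D (i # is) x)"
        by (rule sym)
    qed
    finally show ?thesis
      unfolding fourier_mode_def .
  qed
  then show ?thesis
    unfolding smooth_def by (intro exI[of _ ?D]) auto
qed

lemma periodic_fourier_mode:
  assumes "l > 0"
  shows "periodic l (\<lambda>x. fourier_mode l k \<theta> x *\<^sub>R b)"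
proof -
  have "fourier_mode l k \<theta> (x + l *\<^sub>R axis i 1) = fourier_mode l k \<theta> x" for x i
  proof -
    have "(\<Sum>j\<in>UNIV. of_int (k $ j) * (x + l *\<^sub>R axis i 1) $ j) =
        (\<Sum>j\<in>UNIV. of_int (k $ j) * x $ j) + (\<Sum>j\<in>UNIV. if j = i then of_int (k $ i) * l else 0)"
      unfolding sum.distrib[symmetric] by (intro sum.cong) (auto simp: axis_def algebra_simps)
    also have "\<dots> = (\<Sum>j\<in>UNIV. of_int (k $ j) * x $ j) + of_int (k $ i) * l"
      by simp
    finally have "2 * pi / l * (\<Sum>j\<in>UNIV. of_int (k $ j) * (x + l *\<^sub>R axis i 1) $ j) + \<theta> =
        (2 * pi / l * (\<Sum>j\<in>UNIV. of_int (k $ j) * x $ j) + \<theta>) + 2 * pi * of_int (k $ i)"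
      using assms by (simp add: field_simps)
    then show ?thesis
      unfolding fourier_mode_def by (simp only: cos_add) simp
  qed
  then show ?thesis
    by (simp add: periodic_def)
qed

lemma test_fun_fourier_mode: "l > 0 \<Longrightarrow> test_fun l (\<lambda>x. fourier_mode l k \<theta> x *\<^sub>R b)"
  by (simp add: test_fun_def smooth_fourier_mode periodic_fourier_mode)

lemma continuous_fourier_mode: "continuous_on A (fourier_mode l k \<theta>)"
  unfolding fourier_mode_def by (intro continuous_intros)

inductive trig_poly :: "real \<Rightarrow> (real^3 \<Rightarrow> real) \<Rightarrow> bool" for l where
  mode: "trig_poly l (\<lambda>x. c * fourier_mode l k \<theta> x)"
| add: "trig_poly l f \<Longrightarrow> trig_poly l g \<Longrightarrow> trig_poly l (\<lambda>x. f x + g x)"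

lemma trig_poly_const: "trig_poly l (\<lambda>x. c)"
  using trig_poly.mode[of l c 0 0] by (simp add: fourier_mode_def)

lemma trig_poly_sum: "(\<And>i. i \<in> I \<Longrightarrow> trig_poly l (f i)) \<Longrightarrow> trig_poly l (\<lambda>x. \<Sum>i\<in>I. f i x)"
  by (induction I rule: infinite_finite_induct) (auto intro: trig_poly.add trig_poly_const)

lemma fourier_mode_product:
  "fourier_mode l k \<theta> x * fourier_mode l k' \<theta>' x =
     (fourier_mode l (k - k') (\<theta> - \<theta>') x + fourier_mode l (k + k') (\<theta> + \<theta>') x) / 2"
proof -
  let ?A = "2 * pi / l * (\<Sum>i\<in>UNIV. of_int (k $ i) * x $ i) + \<theta>"
  let ?B = "2 * pi / l * (\<Sum>i\<in>UNIV. of_int (k' $ i) * x $ i) + \<theta>'"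
  have "2 * pi / l * (\<Sum>i\<in>UNIV. of_int ((k - k') $ i) * x $ i) + (\<theta> - \<theta>') = ?A - ?B"
    "2 * pi / l * (\<Sum>i\<in>UNIV. of_int ((k + k') $ i) * x $ i) + (\<theta> + \<theta>') = ?A + ?B"
    by (simp_all add: sum_subtractf sum.distrib left_diff_distrib distrib_right right_diff_distrib distrib_left)
  then show ?thesis
    unfolding fourier_mode_def by (simp only: cos_times_cos)
qed

lemma trig_poly_mult:
  assumes f: "trig_poly l f" and g: "trig_poly l g"
  shows "trig_poly l (\<lambda>x. f x * g x)"
  using f
proof induction
  case (mode c k \<theta>)
  show ?case
    using g
  proof induction
    case (mode c' k' \<theta>')
    have "(\<lambda>x. c * fourier_mode l k \<theta> x * (c' * fourier_mode l k' \<theta>' x)) =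
        (\<lambda>x. c * c' / 2 * fourier_mode l (k - k') (\<theta> - \<theta>') x + c * c' / 2 * fourier_mode l (k + k') (\<theta> + \<theta>') x)"
    proof
      fix x
      have "c * fourier_mode l k \<theta> x * (c' * fourier_mode l k' \<theta>' x) =
          c * c' * (fourier_mode l k \<theta> x * fourier_mode l k' \<theta>' x)"
        by simp
      then show "c * fourier_mode l k \<theta> x * (c' * fourier_mode l k' \<theta>' x) =
          c * c' / 2 * fourier_mode l (k - k') (\<theta> - \<theta>') x + c * c' / 2 * fourier_mode l (k + k') (\<theta> + \<theta>') x"
        unfolding fourier_mode_product by (simp add: algebra_simps add_divide_distrib)
    qed
    then show ?case
      by (simp only: trig_poly.intros)
  next
    case (add f g)
    then show ?case
      using trig_poly.add by (fastforce simp: distrib_left)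
  qed
next
  case (add f h)
  then show ?case
    using trig_poly.add by (fastforce simp: distrib_right)
qed

lemma trig_poly_polynomial:
  assumes P: "real_polynomial_function P" and s: "\<And>i. trig_poly l (\<lambda>x. s x $ i)"
  shows "trig_poly l (\<lambda>x. P (s x :: real^3))"
  using P
proof induction
  case (linear f)
  have "f (s x) = (\<Sum>i\<in>UNIV. f (axis i 1) * s x $ i)" for x
  proof -
    have "f (s x) = f (\<Sum>i\<in>UNIV. s x $ i *\<^sub>R axis i 1)"
      by (simp add: basis_expansion[of "s x", unfolded scalar_mult_eq_scaleR])
    also have "\<dots> = (\<Sum>i\<in>UNIV. f (axis i 1) * s x $ i)"
      using linear by (simp add: linear_sum linear_scale bounded_linear.linear mult.commute)
    finally show ?thesis .
  qed
  then show ?case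
    by (auto intro!: trig_poly_sum trig_poly_mult trig_poly_const s)
qed (auto intro: trig_poly_const trig_poly.add trig_poly_mult)

text \<open>
  The building blocks of the functions that detect boxes in the torus: shifted cosines of one
  coordinate, compared with a level.
\<close>

lemma trig_poly_cos_shift: "trig_poly l (\<lambda>x. cos (2 * pi / l * (x $ i - c)) - d)"
proof -
  have "(\<Sum>j\<in>UNIV. real_of_int (axis i 1 $ j) * x $ j) = x $ i" for x :: "real^3"
  proof -
    have "(\<Sum>j\<in>UNIV. real_of_int (axis i 1 $ j) * x $ j) = (\<Sum>j\<in>UNIV. if j = i then x $ i else 0)"
      by (intro sum.cong) (auto simp: axis_def)
    then show ?thesis by simp
  qed
  then have "(\<lambda>x. cos (2 * pi / l * (x $ i - c)) - d) =
      (\<lambda>x. 1 * fourier_mode l (axis i 1) (- (2 * pi / l * c)) x + - d)"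
    by (simp add: fourier_mode_def right_diff_distrib)
  then show ?thesis
    by (simp only: trig_poly.add trig_poly.mode trig_poly_const)
qed

lemma continuous_trig_poly: "trig_poly l f \<Longrightarrow> continuous_on A f"
  by (induction rule: trig_poly.induct) (auto intro!: continuous_intros continuous_fourier_mode)

text \<open>
  On a period, an interval is the set where a shifted cosine exceeds a level; this makes boxes
  accessible to trigonometric polynomials.
\<close>

lemma interval_iff_cos_greater:
  fixes a b y l :: real
  assumes "0 \<le> a" "a < b" "b \<le> l" "0 \<le> y" "y < l"
  shows "a < y \<and> y < b \<longleftrightarrow> cos (2 * pi / l * (y - (a + b) / 2)) > cos (2 * pi / l * ((b - a) / 2))"
proof -
  have l: "l > 0"
    using assms by linarith
  define \<kappa> where "\<kappa> = 2 * pi / l"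
  have \<kappa>: "\<kappa> > 0" "\<kappa> * l = 2 * pi"
    using l by (simp_all add: \<kappa>_def)
  define d where "d = \<bar>y - (a + b) / 2\<bar>"
  define r where "r = (b - a) / 2"
  have r: "0 < r" "r \<le> l / 2"
    using assms by (auto simp: r_def)
  define c where "c = (a + b) / 2"
  have ab: "a = c - r" "b = c + r"
    by (simp_all add: c_def r_def field_simps)
  have dc: "d = \<bar>y - c\<bar>"
    by (simp add: d_def c_def)
  have d: "0 \<le> d" "d \<le> l - r"
    unfolding dc using assms ab by linarith+
  have cd: "cos (\<kappa> * (y - (a + b) / 2)) = cos (\<kappa> * d)"
    using cos_abs_real[of "\<kappa> * (y - (a + b) / 2)"] \<kappa>(1) by (simp add: d_def abs_mult)
  have \<kappa>r: "0 < \<kappa> * r" "\<kappa> * r \<le> pi" and \<kappa>d: "0 \<le> \<kappa> * d" "\<kappa> * d \<le> 2 * pi - \<kappa> * r"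
  proof -
    show "\<kappa> * r \<le> pi"
      using mult_left_mono[OF r(2), of \<kappa>] \<kappa> by simp
    show "\<kappa> * d \<le> 2 * pi - \<kappa> * r"
      using mult_left_mono[OF d(2), of \<kappa>] \<kappa> by (simp add: right_diff_distrib)
  qed (use r d \<kappa> in auto)
  have "d < r \<longleftrightarrow> cos (\<kappa> * r) < cos (\<kappa> * d)"
  proof
    assume "d < r"
    then show "cos (\<kappa> * r) < cos (\<kappa> * d)"
      using \<kappa> \<kappa>d \<kappa>r by (intro cos_monotone_0_pi) auto
  next
    assume less: "cos (\<kappa> * r) < cos (\<kappa> * d)"
    show "d < r"
    proof (rule ccontr)
      assume "\<not> d < r"
      then have rd: "\<kappa> * r \<le> \<kappa> * d"
        using \<kappa> by simp
      show False
      proof (cases "\<kappa> * d \<le> pi")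
        case True
        then show False
          using cos_monotone_0_pi_le[OF _ rd] \<kappa>r less by auto
      next
        case False
        have "cos (2 * pi - \<kappa> * d) \<le> cos (\<kappa> * r)"
          using False \<kappa>d \<kappa>r by (intro cos_monotone_0_pi_le) auto
        then show False
          using less by (simp add: cos_diff)
      qed
    qed
  qed
  moreover have "a < y \<and> y < b \<longleftrightarrow> d < r"
    unfolding dc ab by linarith
  ultimately show ?thesis
    unfolding \<kappa>_def[symmetric] r_def[symmetric] cd by simp
qed


section \<open>Separation of integrable functions by Fourier modes\<close>

lemma torus_borel [measurable]: "torus l \<in> sets borel"
proof -
  have "{x \<in> space borel. \<forall>i. 0 \<le> x $ i \<and> x $ i < l} \<in> sets (borel :: (real^3) measure)"
    by measurable
  then show ?thesis
    by (simp add: torus_def)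
qed

text \<open>
  A function that annihilates all modes annihilates the trigonometric polynomials, by the
  Stone-Weierstrass theorem all continuous functions of finitely many of them, hence, by monotone
  approximation of indicator functions, all boxes.
\<close>

context
  fixes l :: real and H :: "real^3 \<Rightarrow> real"
  assumes l: "l > 0" and H: "integrable lborel H" and H0: "\<And>x. x \<notin> torus l \<Longrightarrow> H x = 0"
    and modes: "\<And>k \<theta>. \<theta> \<in> {0, - pi / 2} \<Longrightarrow> (LINT x|lborel. H x * fourier_mode l k \<theta> x) = 0"
begin

lemma H_measurable [measurable]: "H \<in> borel_measurable borel"
  using H by auto

lemma H_mult_integrable:
  assumes [measurable]: "g \<in> borel_measurable borel" and "\<And>x. \<bar>g x\<bar> \<le> B"
  shows "integrable lborel (\<lambda>x. H x * g x)"
proof (rule Bochner_Integration.integrable_bound)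
  show "integrable lborel (\<lambda>x. B * H x)"
    using H by simp
  have "\<bar>H x * g x\<bar> \<le> \<bar>B * H x\<bar>" for x
    using mult_left_mono[OF order_trans[OF assms(2)[of x] abs_ge_self], of "\<bar>H x\<bar>"]
    by (simp add: abs_mult mult.commute)
  then show "AE x in lborel. norm (H x * g x) \<le> norm (B * H x)"
    by auto
qed measurable

lemma integral_mode: "(LINT x|lborel. H x * fourier_mode l k \<theta> x) = 0"
proof -
  have i: "integrable lborel (\<lambda>x. H x * fourier_mode l k \<theta> x)" for \<theta>
    by (rule H_mult_integrable[where B = 1])
       (auto simp: fourier_mode_def intro!: borel_measurable_continuous_onI continuous_intros)
  have "fourier_mode l k \<theta> x = cos \<theta> * fourier_mode l k 0 x - sin \<theta> * fourier_mode l k (- pi / 2) x" for x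
    by (simp add: fourier_mode_def cos_add cos_diff)
  then have "H x * fourier_mode l k \<theta> x =
      cos \<theta> * (H x * fourier_mode l k 0 x) - sin \<theta> * (H x * fourier_mode l k (- pi / 2) x)" for x
    by (simp only: right_diff_distrib mult.left_commute)
  then have "(LINT x|lborel. H x * fourier_mode l k \<theta> x) =
      (LINT x|lborel. cos \<theta> * (H x * fourier_mode l k 0 x) - sin \<theta> * (H x * fourier_mode l k (- pi / 2) x))"
    by simp
  also have "\<dots> = 0"
    using i modes by simp
  finally show ?thesis .
qed

lemma integral_trig_poly:
  assumes "trig_poly l g"
  shows "integrable lborel (\<lambda>x. H x * g x) \<and> (LINT x|lborel. H x * g x) = 0"
  using assms
proof induction
  case (mode c k \<theta>)
  have "integrable lborel (\<lambda>x. H x * fourier_mode l k \<theta> x)"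
    by (rule H_mult_integrable[where B = 1])
       (auto simp: fourier_mode_def intro!: borel_measurable_continuous_onI continuous_intros)
  then have "integrable lborel (\<lambda>x. c * (H x * fourier_mode l k \<theta> x))"
      "(LINT x|lborel. c * (H x * fourier_mode l k \<theta> x)) = 0"
    using integral_mode by auto
  then show ?case
    by (simp add: mult.left_commute)
next
  case (add f g)
  then show ?case
    by (simp add: distrib_left)
qed

lemma integral_continuous_of_trig_polys:
  fixes F :: "real^3 \<Rightarrow> real"
  assumes F: "continuous_on UNIV F" and s: "\<And>i. trig_poly l (\<lambda>x. s x $ i)"
    and sb: "\<And>x. norm (s x) \<le> R"
  shows "(LINT x|lborel. H x * F (s x)) = 0"
proof -
  let ?I = "LINT x|lborel. \<bar>H x\<bar>"
  have [measurable]: "F \<in> borel_measurable borel"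
    using F by (rule borel_measurable_continuous_onI)
  have s_cont: "continuous_on UNIV s"
  proof -
    have "continuous_on UNIV (\<lambda>x. \<chi> i. s x $ i)"
      by (rule continuous_on_vec_lambda) (rule continuous_trig_poly[OF s])
    then show ?thesis by simp
  qed
  then have [measurable]: "s \<in> borel_measurable borel"
    by (rule borel_measurable_continuous_onI)
  have FR: "continuous_on (cball 0 R) F"
    using F by (rule continuous_on_subset) simp
  have "bounded (F ` cball 0 R)"
    by (intro compact_imp_bounded compact_continuous_image FR) auto
  then obtain B where B: "\<And>y. y \<in> cball 0 R \<Longrightarrow> \<bar>F y\<bar> \<le> B"
    unfolding bounded_iff by (metis imageI real_norm_def)
  have iF: "integrable lborel (\<lambda>x. H x * F (s x))"
    by (rule H_mult_integrable[where B = B]) (use B sb in auto)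
  have "\<bar>LINT x|lborel. H x * F (s x)\<bar> \<le> e * ?I" if e: "e > 0" for e
  proof -
    obtain P where P: "real_polynomial_function P" "\<And>y. y \<in> cball 0 R \<Longrightarrow> \<bar>F y - P y\<bar> < e"
      using Stone_Weierstrass_real_polynomial_function[OF compact_cball FR e] by blast
    from integral_trig_poly[OF trig_poly_polynomial[OF P(1) s]]
    have iP: "integrable lborel (\<lambda>x. H x * P (s x))" and P0: "(LINT x|lborel. H x * P (s x)) = 0"
      by auto
    have le: "\<bar>H x * F (s x) - H x * P (s x)\<bar> \<le> e * \<bar>H x\<bar>" for x
    proof -
      have "\<bar>H x * F (s x) - H x * P (s x)\<bar> = \<bar>H x\<bar> * \<bar>F (s x) - P (s x)\<bar>"
        by (simp add: right_diff_distrib flip: abs_mult)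
      also have "\<dots> \<le> \<bar>H x\<bar> * e"
        using P(2)[of "s x"] sb[of x] by (intro mult_left_mono) auto
      finally show ?thesis by (simp add: mult.commute)
    qed
    have "\<bar>LINT x|lborel. H x * F (s x)\<bar> = \<bar>LINT x|lborel. H x * F (s x) - H x * P (s x)\<bar>"
      using iF iP P0 by simp
    also have "\<dots> \<le> (LINT x|lborel. \<bar>H x * F (s x) - H x * P (s x)\<bar>)"
      by (rule integral_abs_bound)
    also have "\<dots> \<le> (LINT x|lborel. e * \<bar>H x\<bar>)"
      using iF iP H by (intro integral_mono le) auto
    finally show ?thesis by simp
  qed
  then have "\<bar>LINT x|lborel. H x * F (s x)\<bar> \<le> 0 + e'" if "e' > 0" for e'
  proof -
    have "e' / (c + 1) > 0 \<and> e' / (c + 1) * c \<le> e'" if "c \<ge> 0" for c :: real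
      using that \<open>e' > 0\<close> by (auto simp: field_simps)
    moreover have "?I \<ge> 0"
      by simp
    ultimately have "e' / (?I + 1) > 0" "e' / (?I + 1) * ?I \<le> e'"
      by blast+
    then show ?thesis
      using \<open>\<And>e. e > 0 \<Longrightarrow> \<bar>LINT x|lborel. H x * F (s x)\<bar> \<le> e * ?I\<close>[of "e' / (?I + 1)"] by linarith
  qed
  then have "\<bar>LINT x|lborel. H x * F (s x)\<bar> \<le> 0"
    by (rule field_le_epsilon)
  then show ?thesis by simp
qed

text \<open>
  Within the torus, the box is the set where all coordinates of \<open>s\<close> are positive; \<open>F\<^sub>n \<circ> s\<close> increases to its
  indicator.
\<close>

lemma integral_box_in_torus:
  assumes ab: "\<And>i. 0 \<le> a $ i" "\<And>i. a $ i < b $ i" "\<And>i. b $ i \<le> l"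
  shows "(LINT x|lborel. H x * indicator (box a b) x) = 0"
proof -
  define s :: "real^3 \<Rightarrow> real^3" where
    "s x = (\<chi> i. cos (2 * pi / l * (x $ i - (a $ i + b $ i) / 2)) - cos (2 * pi / l * ((b $ i - a $ i) / 2)))" for x
  define F :: "nat \<Rightarrow> real^3 \<Rightarrow> real" where
    "F n y = (\<Prod>i\<in>UNIV. min 1 (real n * max 0 (y $ i)))" for n y
  have trig: "trig_poly l (\<lambda>x. s x $ i)" for i
    unfolding s_def by (simp only: vec_lambda_beta trig_poly_cos_shift)
  have F: "continuous_on UNIV (F n)" for n
    unfolding F_def by (intro continuous_intros)
  have F01: "0 \<le> F n y \<and> F n y \<le> 1" for n y
    unfolding F_def by (auto intro!: prod_nonneg prod_le_1)
  have sb: "norm (s x) \<le> 6" for x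
  proof -
    have "\<bar>s x $ i\<bar> \<le> 2" for i
      using cos_le_one[of "2 * pi / l * (x $ i - (a $ i + b $ i) / 2)"]
        cos_ge_minus_one[of "2 * pi / l * (x $ i - (a $ i + b $ i) / 2)"]
        cos_le_one[of "2 * pi / l * ((b $ i - a $ i) / 2)"]
        cos_ge_minus_one[of "2 * pi / l * ((b $ i - a $ i) / 2)"]
      unfolding s_def vec_lambda_beta by linarith
    then have "(\<Sum>i\<in>UNIV. \<bar>s x $ i\<bar>) \<le> (\<Sum>i\<in>(UNIV :: 3 set). 2)"
      by (rule sum_mono)
    then show ?thesis
      using norm_le_l1_cart[of "s x"] by simp
  qed
  have box: "x \<in> box a b \<longleftrightarrow> (\<forall>i. 0 < s x $ i)" if "x \<in> torus l" for x
  proof -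
    have "a $ i < x $ i \<and> x $ i < b $ i \<longleftrightarrow> 0 < s x $ i" for i
      using interval_iff_cos_greater[OF ab(1)[of i] ab(2)[of i] ab(3)[of i], of "x $ i"] that unfolding s_def torus_def by auto
    then show ?thesis
      by (auto simp: mem_box_cart)
  qed
  have lim: "(\<lambda>n. F n y) \<longlonglongrightarrow> (if \<forall>i. 0 < y $ i then 1 else 0)" for y
  proof -
    have "(\<lambda>n. min 1 (real n * max 0 (y $ i))) \<longlonglongrightarrow> (if 0 < y $ i then 1 else 0)" for i
    proof (cases "0 < y $ i")
      case True
      obtain m where m: "1 / y $ i \<le> real m"
        using real_arch_simple by blast
      have "min 1 (real n * max 0 (y $ i)) = 1" if "n \<ge> m" for n
      proof -
        have "1 / y $ i \<le> real n"
          using m that by linarith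
        then show ?thesis
          using True by (simp add: field_simps)
      qed
      then have "\<forall>\<^sub>F n in sequentially. min 1 (real n * max 0 (y $ i)) = 1"
        by (rule eventually_sequentiallyI)
      then show ?thesis
        using True by (simp add: tendsto_eventually)
    qed auto
    then have "(\<lambda>n. F n y) \<longlonglongrightarrow> (\<Prod>i\<in>UNIV. if 0 < y $ i then 1 else 0)"
      unfolding F_def by (intro tendsto_prod)
    also have "(\<Prod>i\<in>UNIV. if 0 < y $ i then 1 else 0) = (if \<forall>i. 0 < y $ i then 1 else (0 :: real))"
      by auto
    finally show ?thesis .
  qed
  have "(\<lambda>n. LINT x|lborel. H x * F n (s x)) \<longlonglongrightarrow> (LINT x|lborel. H x * indicator (box a b) x)"
  proof (rule integral_dominated_convergence[where w = "\<lambda>x. \<bar>H x\<bar>"])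
    have "s \<in> borel_measurable borel"
    proof (rule borel_measurable_continuous_onI)
      have "continuous_on UNIV (\<lambda>x. \<chi> i. s x $ i)"
        by (rule continuous_on_vec_lambda) (rule continuous_trig_poly[OF trig])
      then show "continuous_on UNIV s" by simp
    qed
    moreover have "F n \<in> borel_measurable borel" for n
      using F by (rule borel_measurable_continuous_onI)
    ultimately have [measurable]: "(\<lambda>x. F n (s x)) \<in> borel_measurable borel" for n
      by simp
    show "(\<lambda>x. H x * F n (s x)) \<in> borel_measurable lborel" for n
      by simp
    show "AE x in lborel. (\<lambda>n. H x * F n (s x)) \<longlonglongrightarrow> H x * indicator (box a b) x"
    proof (rule AE_I2)
      fix x
      show "(\<lambda>n. H x * F n (s x)) \<longlonglongrightarrow> H x * indicator (box a b) x"
      proof (cases "x \<in> torus l")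
        case True
        then have "(indicator (box a b) x :: real) = (if \<forall>i. 0 < s x $ i then 1 else 0)"
          using box[OF True] unfolding indicator_def by (simp only: of_bool_def)
        then show ?thesis
          by (simp only: tendsto_mult_left[OF lim[of "s x"]])
      qed (simp add: H0)
    qed
    show "AE x in lborel. norm (H x * F n (s x)) \<le> \<bar>H x\<bar>" for n
      using F01[of n] by (auto simp: abs_mult intro!: mult_left_le)
  qed (use H in auto)
  moreover have "(LINT x|lborel. H x * F n (s x)) = 0" for n
    by (rule integral_continuous_of_trig_polys[OF F trig sb])
  ultimately show ?thesis
    by (simp add: LIMSEQ_const_iff)
qed

lemma integral_box: "(LINT x|lborel. H x * indicator (box a b) x) = 0"
proof -
  \<comment> \<open>The coordinate hyperplanes are null, so a box may be replaced by its part inside the open cube.\<close>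
  let ?a = "(\<chi> i. max (a $ i) 0) :: real^3" and ?b = "(\<chi> i. min (b $ i) l) :: real^3"
  have "AE x in lborel. (x :: real^3) $ i \<noteq> 0" for i
  proof -
    have "{x :: real^3. x $ i = 0} \<in> null_sets lborel"
    proof -
      have "{x \<in> space borel. (x :: real^3) $ i = 0} \<in> sets borel"
        by measurable
      then show ?thesis
        using negligible_standard_hyperplane_cart[of i]
        by (simp add: negligible_iff_null_sets null_sets_completion_iff)
    qed
    then have "AE x in lborel. x \<notin> {x :: real^3. x $ i = 0}"
      by (rule AE_not_in)
    then show ?thesis by simp
  qed
  then have "AE x in lborel. \<forall>i. (x :: real^3) $ i \<noteq> 0"
    by (simp add: AE_all_countable)
  then have "AE x in lborel. H x * indicator (box a b) x = H x * indicator (box ?a ?b) x"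
  proof eventually_elim
    case (elim x)
    show ?case
    proof (cases "x \<in> torus l")
      case True
      then have "x \<in> box a b \<longleftrightarrow> x \<in> box ?a ?b"
        using elim unfolding torus_def mem_box_cart by (force simp: order.order_iff_strict)
      then show ?thesis
        by (simp add: indicator_def)
    qed (simp add: H0)
  qed
  then have "(LINT x|lborel. H x * indicator (box a b) x) = (LINT x|lborel. H x * indicator (box ?a ?b) x)"
    by (intro integral_cong_AE) auto
  also have "\<dots> = 0"
  proof (cases "\<forall>i. ?a $ i < ?b $ i")
    case True
    then show ?thesis
      by (intro integral_box_in_torus) auto
  next
    case False
    then obtain i where i: "\<not> ?a $ i < ?b $ i"
      by blast
    have "x \<notin> box ?a ?b" for x
      unfolding mem_box_cart using i order.strict_trans by blast
    then have "box ?a ?b = {}"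
      by blast
    then show ?thesis by simp
  qed
  finally show ?thesis .
qed

text \<open>
  Positive and negative part of \<open>H\<close> are densities of two finite measures that agree on the boxes, hence on
  all Borel sets.
\<close>

lemma AE_zero_if_modes_vanish: "AE x in lborel. H x = 0"
proof -
  let ?p = "\<lambda>x. ennreal (H x)" and ?n = "\<lambda>x. ennreal (- H x)"
  have fin: "(\<integral>\<^sup>+x. ?p x \<partial>lborel) \<noteq> \<infinity>"
    using H by (auto simp: real_integrable_def)
  have eq: "emeasure (density lborel ?p) (box a b) = emeasure (density lborel ?n) (box a b)" for a b
  proof -
    let ?h = "\<lambda>x. H x * indicator (box a b) x"
    have i: "integrable lborel ?h"
      by (rule H_mult_integrable[where B = 1]) auto
    have pn: "(\<integral>\<^sup>+x. ?p x * indicator (box a b) x \<partial>lborel) = (\<integral>\<^sup>+x. ennreal (?h x) \<partial>lborel)"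
      "(\<integral>\<^sup>+x. ?n x * indicator (box a b) x \<partial>lborel) = (\<integral>\<^sup>+x. ennreal (- ?h x) \<partial>lborel)"
      by (auto intro!: nn_integral_cong split: split_indicator)
    have inj: "c = d" if "enn2real c = enn2real d" "c \<noteq> \<infinity>" "d \<noteq> \<infinity>" for c d :: ennreal
      using that by (cases c; cases d) auto
    have "enn2real (\<integral>\<^sup>+x. ennreal (?h x) \<partial>lborel) = enn2real (\<integral>\<^sup>+x. ennreal (- ?h x) \<partial>lborel)"
      using integral_box[of a b] i by (simp add: real_lebesgue_integral_def)
    moreover have "(\<integral>\<^sup>+x. ennreal (?h x) \<partial>lborel) \<noteq> \<infinity>" "(\<integral>\<^sup>+x. ennreal (- ?h x) \<partial>lborel) \<noteq> \<infinity>"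
      using i by (auto simp: real_integrable_def)
    ultimately have "(\<integral>\<^sup>+x. ennreal (?h x) \<partial>lborel) = (\<integral>\<^sup>+x. ennreal (- ?h x) \<partial>lborel)"
      by (rule inj)
    then show ?thesis
      by (simp add: emeasure_density pn)
  qed
  have "density lborel ?p = density lborel ?n"
  proof (rule measure_eqI_generator_eq)
    let ?E = "range (\<lambda>(a, b). box a b :: (real^3) set)"
    show "Int_stable ?E"
      by (auto simp: Int_stable_def box_Int_box)
    show "?E \<subseteq> Pow UNIV" "sets (density lborel ?p) = sigma_sets UNIV ?E"
      "sets (density lborel ?n) = sigma_sets UNIV ?E"
      by (simp_all add: borel_eq_box)
    let ?A = "\<lambda>n::nat. box (- (real n *\<^sub>R One)) (real n *\<^sub>R One) :: (real^3) set"
    show "range ?A \<subseteq> ?E" "(\<Union>i. ?A i) = UNIV"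
      unfolding UN_box_eq_UNIV by auto
    show "emeasure (density lborel ?p) (?A i) \<noteq> \<infinity>" for i
    proof -
      have "emeasure (density lborel ?p) (?A i) \<le> emeasure (density lborel ?p) UNIV"
        by (intro emeasure_mono) auto
      also have "\<dots> = (\<integral>\<^sup>+x. ?p x \<partial>lborel)"
        by (simp add: emeasure_density)
      finally show ?thesis
        using fin by (auto simp: top_unique)
    qed
    show "emeasure (density lborel ?p) X = emeasure (density lborel ?n) X" if "X \<in> ?E" for X
      using that eq by auto
  qed
  then have "AE x in lborel. ?p x = ?n x"
    using fin by (subst (asm) finite_density_unique) auto
  then show ?thesis
  proof eventually_elim
    case (elim x)
    then show ?case
      by (cases "H x \<ge> 0") (auto simp: ennreal_neg ennreal_eq_0_iff dest: sym)
  qed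
qed

end


section \<open>Lebesgue spaces and continuity in time\<close>

lemma integrable_lebesgue_on_iff:
  fixes f :: "'a::euclidean_space \<Rightarrow> real"
  assumes "A \<in> sets borel"
  shows "integrable (lebesgue_on A) f \<longleftrightarrow> integrable lebesgue (\<lambda>x. indicator A x * f x)"
    and "(LINT x|lebesgue_on A. f x) = (LINT x|lebesgue. indicator A x * f x)"
  using assms by (simp_all add: integrable_restrict_space integral_restrict_space)

text \<open>
  Fubini's theorem for Lebesgue rather than Borel integrands: pass to a Borel representative.
\<close>

lemma integral_lebesgue_on_Times:
  fixes f :: "real \<times> (real^3) \<Rightarrow> real"
  assumes [measurable]: "A \<in> sets borel" "B \<in> sets borel"
    and f: "integrable (lebesgue_on (A \<times> B)) f"
    and slice: "\<And>t. t \<in> A \<Longrightarrow> (\<lambda>x. f (t, x)) \<in> borel_measurable (lebesgue_on B)"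
    and outer: "(\<lambda>t. LINT x|lebesgue_on B. f (t, x)) \<in> borel_measurable (lebesgue_on A)"
  shows "(LINT z|lebesgue_on (A \<times> B). f z) = (LINT t|lebesgue_on A. LINT x|lebesgue_on B. f (t, x))"
proof -
  let ?F = "\<lambda>z. indicator (A \<times> B) z * f z"
  have AB: "A \<times> B \<in> sets borel"
    unfolding borel_prod[symmetric] by measurable
  have F: "integrable lebesgue ?F"
    using f integrable_lebesgue_on_iff[OF AB] by blast
  then have "?F \<in> borel_measurable (completion lborel)"
    by auto
  from completion_ex_borel_measurable_real[OF this]
  obtain g :: "real \<times> (real^3) \<Rightarrow> real" where g [measurable]: "g \<in> borel_measurable borel"
    and gF: "AE z in lborel. ?F z = g z"
    by auto
  have "integrable lebesgue g"
    by (rule integrable_cong_AE_imp[OF F])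
       (rule measurable_completion, simp, use AE_completion[OF gF] in eventually_elim, simp)
  then have g_int: "integrable lborel g"
    by (simp add: integrable_completion)
  have "(LINT z|lebesgue_on (A \<times> B). f z) = (LINT z|lebesgue. ?F z)"
    by (rule integrable_lebesgue_on_iff(2)[OF AB])
  also have "\<dots> = (LINT z|lebesgue. g z)"
    by (rule integral_cong_AE[OF borel_measurable_integrable[OF F] borel_measurable_integrable[OF \<open>integrable lebesgue g\<close>] AE_completion[OF gF]])
  also have "\<dots> = (LINT z|lborel. g z)"
    by (rule integral_completion) simp
  also have "\<dots> = (LINT t|lborel. LINT x|lborel. g (t, x))"
    using lborel_pair.integral_fst'[of g] g_int by (simp add: lborel_prod)
  also have "\<dots> = (LINT t|lebesgue. LINT x|lborel. g (t, x))"
    by (rule integral_completion[symmetric]) measurable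
  also have "\<dots> = (LINT t|lebesgue. indicator A t * (LINT x|lebesgue_on B. f (t, x)))"
  proof (rule integral_cong_AE)
    show "(\<lambda>t. LINT x|lborel. g (t, x)) \<in> borel_measurable lebesgue"
      by (rule measurable_completion) measurable
    show "(\<lambda>t. indicator A t * (LINT x|lebesgue_on B. f (t, x))) \<in> borel_measurable lebesgue"
      using outer by (subst (asm) borel_measurable_restrict_space_iff) auto
    have "AE z in lborel \<Otimes>\<^sub>M lborel. ?F z = g z"
      unfolding lborel_prod by (rule gF)
    then have "AE t in lborel. AE x in lborel. ?F (t, x) = g (t, x)"
      by (rule lborel_pair.AE_pair)
    then have "AE t in lebesgue. AE x in lebesgue. ?F (t, x) = g (t, x)"
      by (simp add: AE_completion_iff)
    then show "AE t in lebesgue. (LINT x|lborel. g (t, x)) = indicator A t * (LINT x|lebesgue_on B. f (t, x))"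
    proof eventually_elim
      case (elim t)
      have "(LINT x|lborel. g (t, x)) = (LINT x|lebesgue. g (t, x))"
        by (rule integral_completion[symmetric]) measurable
      also have "\<dots> = (LINT x|lebesgue. ?F (t, x))"
      proof (rule integral_cong_AE)
        show "(\<lambda>x. g (t, x)) \<in> borel_measurable lebesgue"
          by (rule measurable_completion) measurable
        show "(\<lambda>x. ?F (t, x)) \<in> borel_measurable lebesgue"
        proof (cases "t \<in> A")
          case True
          have "(\<lambda>x. indicator B x *\<^sub>R f (t, x)) \<in> borel_measurable lebesgue"
            using slice[OF True] by (subst (asm) borel_measurable_restrict_space_iff) auto
          then show ?thesis
            using True by (simp add: indicator_times)
        qed (simp add: indicator_times)
        show "AE x in lebesgue. g (t, x) = ?F (t, x)"
          using elim by eventually_elim simp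
      qed
      also have "\<dots> = (LINT x|lebesgue. indicator A t * (indicator B x * f (t, x)))"
        by (simp add: indicator_times mult.assoc)
      also have "\<dots> = indicator A t * (LINT x|lebesgue_on B. f (t, x))"
        by (simp add: integrable_lebesgue_on_iff(2))
      finally show ?case .
    qed
  qed
  also have "\<dots> = (LINT t|lebesgue_on A. LINT x|lebesgue_on B. f (t, x))"
    by (simp add: integrable_lebesgue_on_iff(2))
  finally show ?thesis .
qed

lemma nn_integral_lebesgue_on_Times:
  fixes f :: "real \<times> (real^3) \<Rightarrow> ennreal"
  assumes [measurable]: "A \<in> sets borel" "B \<in> sets borel" "f \<in> borel_measurable borel"
  shows "(\<integral>\<^sup>+z. f z \<partial>lebesgue_on (A \<times> B)) = (\<integral>\<^sup>+t. (\<integral>\<^sup>+x. f (t, x) \<partial>lebesgue_on B) \<partial>lebesgue_on A)"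
proof -
  have AB: "A \<times> B \<in> sets borel"
    unfolding borel_prod[symmetric] by measurable
  note [measurable] = AB
  have "(\<integral>\<^sup>+z. f z \<partial>lebesgue_on (A \<times> B)) = (\<integral>\<^sup>+z. f z * indicator (A \<times> B) z \<partial>lborel)"
    using AB by (simp add: nn_integral_restrict_space nn_integral_completion)
  also have "\<dots> = (\<integral>\<^sup>+t. \<integral>\<^sup>+x. f (t, x) * indicator (A \<times> B) (t, x) \<partial>lborel \<partial>lborel)"
    unfolding lborel_prod[symmetric]
    by (rule lborel.nn_integral_fst[symmetric], unfold lborel_prod, measurable)
  also have "\<dots> = (\<integral>\<^sup>+t. (\<integral>\<^sup>+x. f (t, x) * indicator B x \<partial>lborel) * indicator A t \<partial>lborel)"
    by (intro nn_integral_cong) (auto simp: indicator_times split: split_indicator)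
  also have "\<dots> = (\<integral>\<^sup>+t. (\<integral>\<^sup>+x. f (t, x) \<partial>lebesgue_on B) \<partial>lebesgue_on A)"
    by (simp add: nn_integral_restrict_space nn_integral_completion)
  finally show ?thesis .
qed

lemma
  fixes T l :: real
  shows finite_measure_lebesgue_on_torus: "finite_measure (lebesgue_on (torus l))"
    and finite_measure_lebesgue_on_cylinder: "finite_measure (lebesgue_on ({0<..<T} \<times> torus l))"
proof -
  have bdd: "bounded (torus l)"
  proof (rule bounded_subset)
    show "torus l \<subseteq> cbox 0 (\<chi> i. l)"
    proof
      fix x assume "x \<in> torus l"
      then have "0 \<le> x $ i" "x $ i \<le> l" for i
        by (auto simp: torus_def dest: spec[of _ i])
      then show "x \<in> cbox 0 (\<chi> i. l)"
        by (simp add: mem_box_cart)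
    qed
  qed (rule bounded_cbox)
  have fin: "finite_measure (lebesgue_on S)" if "bounded S" "S \<in> sets borel" for S :: "'x::euclidean_space set"
    using that emeasure_bounded_finite[OF that(1)]
    by (intro finite_measureI) (auto simp: emeasure_restrict_space)
  show "finite_measure (lebesgue_on (torus l))"
    by (rule fin[OF bdd]) measurable
  have "{0<..<T} \<times> torus l \<in> sets borel"
    unfolding borel_prod[symmetric] by (intro pair_measureI torus_borel) simp
  then show "finite_measure (lebesgue_on ({0<..<T} \<times> torus l))"
    by (intro fin bounded_Times bounded_box bdd) auto
qed

lemma Lp_iff:
  fixes f :: "real^3 \<Rightarrow> 'b::euclidean_space"
  shows "f \<in> Lp l p \<longleftrightarrow>
    f \<in> borel_measurable (lebesgue_on (torus l)) \<and> integrable (lebesgue_on (torus l)) (\<lambda>x. norm (f x) powr p)"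
proof -
  have "epowr a q < \<infinity> \<longleftrightarrow> a < \<infinity>" for a q
    by (auto simp: epowr_def less_top)
  then show ?thesis
    by (auto simp: Lp_def Lp_norm_def integrable_iff_bounded)
qed

lemma bounded_in_Lp:
  fixes f :: "real^3 \<Rightarrow> 'b::euclidean_space"
  assumes [measurable]: "f \<in> borel_measurable (lebesgue_on (torus l))" and B: "\<And>x. norm (f x) \<le> B" and p: "p \<ge> 0"
  shows "f \<in> Lp l p"
proof -
  interpret finite_measure "lebesgue_on (torus l)"
    by (rule finite_measure_lebesgue_on_torus)
  have "integrable (lebesgue_on (torus l)) (\<lambda>x. norm (f x) powr p)"
    by (rule integrable_const_bound[where B = "B powr p"]) (use B p in \<open>auto intro!: AE_I2 powr_mono2\<close>)
  then show ?thesis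
    by (simp add: Lp_iff)
qed

lemma continuous_Icc_bounded:
  fixes f :: "real \<Rightarrow> real"
  assumes "continuous_on {0..T} f"
  shows "\<exists>B. \<forall>t\<in>{0..T}. \<bar>f t\<bar> \<le> B"
  using compact_imp_bounded[OF compact_continuous_image[OF assms compact_Icc]]
  by (auto simp: bounded_iff)

text \<open>
  Against a fixed element of the dual space, uniform convergence of continuous functions on a
  compact interval bounds the pairings uniformly in the index and in time.  The uniform
  boundedness principle turns this into a bound for the norms.
\<close>

lemma Cw_tendsto_bounded:
  fixes v :: "nat \<Rightarrow> real \<Rightarrow> real^3 \<Rightarrow> 'b::euclidean_space"
  assumes p: "p > 1" and lim: "Cw_tendsto T l p v w"
  shows "\<exists>B\<ge>0. \<forall>n. \<forall>t\<in>{0..T}. (LINT x|lebesgue_on (torus l). norm (v n t x) powr p) \<le> B"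
proof -
  let ?M = "lebesgue_on (torus l)"
  have Cw: "\<And>n. v n \<in> Cw T l p" "w \<in> Cw T l p"
    and unif: "\<And>g. g \<in> Lp l (p / (p - 1)) \<Longrightarrow>
      uniform_limit {0..T} (\<lambda>n t. LINT x|?M. v n t x \<bullet> g x) (\<lambda>t. LINT x|?M. w t x \<bullet> g x) sequentially"
    using lim by (auto simp: Cw_tendsto_def)
  have v: "v n t \<in> Lp l p" if "t \<in> {0..T}" for n t
    using Cw(1)[of n] that by (auto simp: Cw_def)
  have "\<exists>B. \<forall>i\<in>UNIV \<times> {0..T}. (LINT x|?M. norm (v (fst i) (snd i) x) powr p) \<le> B"
  proof (rule Lp_uniform_boundedness[OF p])
    show "v (fst i) (snd i) \<in> borel_measurable ?M"
      and "integrable ?M (\<lambda>x. norm (v (fst i) (snd i) x) powr p)" if "i \<in> UNIV \<times> {0..T}" for i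
      using v[of "snd i" "fst i"] that by (auto simp: Lp_iff)
    fix g :: "real^3 \<Rightarrow> 'b"
    assume "g \<in> borel_measurable ?M" "integrable ?M (\<lambda>x. norm (g x) powr (p / (p - 1)))"
    then have g: "g \<in> Lp l (p / (p - 1))"
      by (simp add: Lp_iff)
    define I where "I n t = (LINT x|?M. v n t x \<bullet> g x)" for n t
    define J where "J t = (LINT x|?M. w t x \<bullet> g x)" for t
    have cont: "continuous_on {0..T} (I n)" "continuous_on {0..T} J" for n
      using Cw g by (auto simp: Cw_def I_def J_def)
    obtain b where b: "\<And>n t. t \<in> {0..T} \<Longrightarrow> \<bar>I n t\<bar> \<le> b n"
      using continuous_Icc_bounded[OF cont(1)] by metis
    obtain c where c: "\<And>t. t \<in> {0..T} \<Longrightarrow> \<bar>J t\<bar> \<le> c"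
      using continuous_Icc_bounded[OF cont(2)] by blast
    have "\<forall>\<^sub>F n in sequentially. \<forall>t\<in>{0..T}. dist (I n t) (J t) < 1"
      using unif[OF g] unfolding uniform_limit_iff I_def J_def by auto
    then obtain m where m: "\<And>n t. n \<ge> m \<Longrightarrow> t \<in> {0..T} \<Longrightarrow> \<bar>I n t - J t\<bar> < 1"
      unfolding eventually_sequentially dist_real_def by blast
    have "\<bar>I n t\<bar> \<le> (c + 1) + (\<Sum>n<m. \<bar>b n\<bar>)" if t: "t \<in> {0..T}" for n t
    proof (cases "n < m")
      case True
      have "\<bar>I n t\<bar> \<le> \<bar>b n\<bar>"
        using b[OF t, of n] by linarith
      also have "\<bar>b n\<bar> \<le> (\<Sum>n<m. \<bar>b n\<bar>)"
        using True by (intro member_le_sum) auto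
      finally show ?thesis
        using c[OF t] by linarith
    next
      case False
      have "(\<Sum>n<m. \<bar>b n\<bar>) \<ge> 0"
        by (intro sum_nonneg) auto
      moreover have "\<bar>I n t - J t\<bar> < 1"
        using m[of n t] False t by simp
      ultimately show ?thesis
        using c[OF t] by linarith
    qed
    then show "\<exists>B. \<forall>i\<in>UNIV \<times> {0..T}. \<bar>LINT x|?M. v (fst i) (snd i) x \<bullet> g x\<bar> \<le> B"
      unfolding I_def by (intro exI[of _ "(c + 1) + (\<Sum>n<m. \<bar>b n\<bar>)"]) auto
  qed
  then obtain B where B: "\<forall>i\<in>UNIV \<times> {0..T}. (LINT x|?M. norm (v (fst i) (snd i) x) powr p) \<le> B"
    by blast
  have "(LINT x|?M. norm (v n t x) powr p) \<le> \<bar>B\<bar>" if "t \<in> {0..T}" for n t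
    using bspec[OF B, of "(n, t)"] that by auto
  then show ?thesis
    by (intro exI[of _ "\<bar>B\<bar>"]) auto
qed

text \<open>
  A grid function depends on \<open>x\<close> only through the index of the cell of \<open>x\<close>, one of countably many, and for
  a fixed cell it is continuous in time.  Time is clamped to \<open>[0,T]\<close> since nothing is known outside.
\<close>

lemma grid_fun_time_continuous_measurable:
  fixes f :: "real \<Rightarrow> real^3 \<Rightarrow> 'b::{second_countable_topology, metric_space}"
  assumes T: "T \<ge> 0" and h: "h > 0"
    and grid: "\<And>t. t \<in> {0..T} \<Longrightarrow> grid_fun l h (f t)"
    and cont: "\<And>x. continuous_on {0..T} (\<lambda>t. f t x)"
  shows "(\<lambda>z. f (max 0 (min T (fst z))) (snd z)) \<in> borel_measurable borel"
proof -
  define k :: "real^3 \<Rightarrow> int^3" where "k x = (\<chi> i. \<lfloor>x $ i / h\<rfloor>)" for x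
  define x :: "int^3 \<Rightarrow> real^3" where "x k = (\<chi> i. h * of_int (k $ i))" for k
  have kx: "k (x j) = j" for j
    using h by (simp add: k_def x_def vec_eq_iff)
  have clamp: "max 0 (min T t) \<in> {0..T}" for t
    using T by auto
  have "f (max 0 (min T t)) y = f (max 0 (min T t)) (x (k y))" for t y
  proof -
    have "x (k y) \<in> cell h y"
      using h by (simp add: cell_def k_def x_def)
    then show ?thesis
      using grid[OF clamp] by (simp add: grid_fun_def)
  qed
  then have eq: "(\<lambda>z. f (max 0 (min T (fst z))) (snd z)) = (\<lambda>z. f (max 0 (min T (fst z))) (x (k (snd z))))"
    by auto
  have [measurable]: "k \<in> borel \<rightarrow>\<^sub>M count_space UNIV"
  proof (subst measurable_count_space_eq2_countable, safe)
    fix j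
    have "{x \<in> space borel. \<forall>i. \<lfloor>x $ i / h\<rfloor> = j $ i} \<in> sets (borel :: (real^3) measure)"
      by measurable
    also have "{x \<in> space borel. \<forall>i. \<lfloor>x $ i / h\<rfloor> = j $ i} = k -` {j} \<inter> space borel"
      by (auto simp: k_def vec_eq_iff)
    finally show "k -` {j} \<inter> space borel \<in> sets (borel :: (real^3) measure)" .
  qed auto
  have m: "(\<lambda>z. f (max 0 (min T (fst z))) (x j)) \<in> borel_measurable (borel :: (real \<times> (real^3)) measure)" for j
  proof -
    have "continuous_on UNIV (\<lambda>z :: real \<times> (real^3). max 0 (min T (fst z)))"
      by (intro continuous_intros)
    moreover have "range (\<lambda>z :: real \<times> (real^3). max 0 (min T (fst z))) \<subseteq> {0..T}"
      using clamp by blast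
    ultimately show ?thesis
      by (intro borel_measurable_continuous_onI continuous_on_compose2[OF cont[of "x j"]])
  qed
  have "(\<lambda>z :: real \<times> (real^3). k (snd z)) \<in> borel \<rightarrow>\<^sub>M count_space UNIV"
    by (rule measurable_compose[of snd borel borel]) (auto simp flip: borel_prod)
  from measurable_compose_countable[OF m this] show ?thesis
    unfolding eq .
qed


section \<open>Identification of the limit in time-continuous spaces\<close>

text \<open>
  The phases \<open>0\<close> and \<open>- \<pi> / 2\<close> give cosines and sines.  With the integer frequencies they form a
  countable family of test functions, so that conditions known almost surely for each test
  function hold almost surely for all of them.
\<close>

lemma AE_zero_if_fourier_modes_vanish:
  fixes f :: "real^3 \<Rightarrow> 'b::euclidean_space"
  assumes l: "l > 0" and f: "integrable (lebesgue_on (torus l)) f"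
    and modes: "\<And>k \<theta> b. \<theta> \<in> {0, - pi / 2} \<Longrightarrow> b \<in> Basis \<Longrightarrow>
      (LINT x|lebesgue_on (torus l). f x \<bullet> (fourier_mode l k \<theta> x *\<^sub>R b)) = 0"
  shows "AE x in lebesgue_on (torus l). f x = 0"
proof -
  have "AE x in lebesgue_on (torus l). f x \<bullet> b = 0" if b: "b \<in> Basis" for b
  proof -
    define F where "F x = indicator (torus l) x * (f x \<bullet> b)" for x
    have "integrable (lebesgue_on (torus l)) (\<lambda>x. f x \<bullet> b)"
      using f by simp
    then have F: "integrable lebesgue F"
      unfolding F_def[abs_def] by (rule integrable_lebesgue_on_iff(1)[OF torus_borel, THEN iffD1])
    then have "F \<in> borel_measurable (completion lborel)"
      by auto
    from completion_ex_borel_measurable_real[OF this]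
    obtain H0 where H0 [measurable]: "H0 \<in> borel_measurable borel" and FH0: "AE x in lborel. F x = H0 x"
      by auto
    define H where "H x = indicator (torus l) x * H0 x" for x
    have [measurable]: "H \<in> borel_measurable borel"
      unfolding H_def by measurable
    have FH: "AE x in lborel. F x = H x"
      using FH0 by eventually_elim (auto simp: F_def H_def split: split_indicator)
    have mode [measurable]: "fourier_mode l k \<theta> \<in> borel_measurable borel" for k \<theta>
      by (intro borel_measurable_continuous_onI continuous_fourier_mode)
    have "integrable lebesgue H"
      by (rule integrable_cong_AE_imp[OF F])
         (rule measurable_completion, simp, use AE_completion[OF FH] in eventually_elim, simp)
    then have "integrable lborel H"
      by (simp add: integrable_completion)
    moreover have "H x = 0" if "x \<notin> torus l" for x
      using that by (simp add: H_def)
    moreover have "(LINT x|lborel. H x * fourier_mode l k \<theta> x) = 0" if \<theta>: "\<theta> \<in> {0, - pi / 2}" for k \<theta>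
    proof -
      have "(LINT x|lborel. H x * fourier_mode l k \<theta> x) = (LINT x|lebesgue. H x * fourier_mode l k \<theta> x)"
        by (rule integral_completion[symmetric]) measurable
      also have "\<dots> = (LINT x|lebesgue. F x * fourier_mode l k \<theta> x)"
      proof (rule integral_cong_AE)
        show "(\<lambda>x. H x * fourier_mode l k \<theta> x) \<in> borel_measurable lebesgue"
          by (rule measurable_completion) measurable
        have "fourier_mode l k \<theta> \<in> borel_measurable lebesgue"
          by (rule measurable_completion) measurable
        then show "(\<lambda>x. F x * fourier_mode l k \<theta> x) \<in> borel_measurable lebesgue"
          using F by (intro borel_measurable_times) auto
        show "AE x in lebesgue. H x * fourier_mode l k \<theta> x = F x * fourier_mode l k \<theta> x"
          using AE_completion[OF FH] by eventually_elim simp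
      qed
      also have "\<dots> = (LINT x|lebesgue. indicator (torus l) x * (f x \<bullet> (fourier_mode l k \<theta> x *\<^sub>R b)))"
        by (intro Bochner_Integration.integral_cong refl) (simp add: F_def mult_ac)
      also have "\<dots> = 0"
        unfolding integrable_lebesgue_on_iff(2)[OF torus_borel, symmetric] by (rule modes[OF \<theta> b])
      finally show ?thesis .
    qed
    ultimately have "AE x in lborel. H x = 0"
      by (rule AE_zero_if_modes_vanish[OF l])
    with FH have "AE x in lborel. F x = 0"
      by eventually_elim simp
    then have "AE x in lebesgue. x \<in> torus l \<longrightarrow> f x \<bullet> b = 0"
      by (intro AE_completion, eventually_elim) (auto simp: F_def)
    then show ?thesis
      by (subst AE_restrict_space_iff) auto
  qed
  then have "AE x in lebesgue_on (torus l). \<forall>b\<in>Basis. f x \<bullet> b = 0"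
    by (intro AE_finite_allI) auto
  then show ?thesis
    by eventually_elim (simp add: euclidean_all_zero_iff)
qed

lemma continuous_Icc_integrable_Ioo:
  fixes f :: "real \<Rightarrow> real"
  assumes f: "continuous_on {0..T} f"
  shows "integrable (lebesgue_on {0<..<T}) f"
proof -
  have "finite_measure (lebesgue_on {0<..<T})"
    using emeasure_bounded_finite[of "{0<..<T}"]
    by (intro finite_measureI) (simp add: emeasure_restrict_space)
  then interpret finite_measure "lebesgue_on {0<..<T}" .
  obtain B where B: "\<And>t. t \<in> {0..T} \<Longrightarrow> \<bar>f t\<bar> \<le> B"
    using continuous_Icc_bounded[OF f] by blast
  have "AE t in lebesgue_on {0<..<T}. norm (f t) \<le> B"
    by (intro AE_I2) (auto intro: B)
  moreover have "f \<in> borel_measurable (lebesgue_on {0<..<T})"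
    by (intro continuous_imp_measurable_on_sets_lebesgue continuous_on_subset[OF f]) auto
  ultimately show ?thesis
    by (rule integrable_const_bound)
qed

lemma continuous_zero_if_square_integral_zero:
  fixes f :: "real \<Rightarrow> real"
  assumes T: "T > 0" and f: "continuous_on {0..T} f"
    and zero: "(LINT t|lebesgue_on {0<..<T}. f t * f t) = 0" and t: "t \<in> {0..T}"
  shows "f t = 0"
proof -
  have c: "continuous_on {0..T} (\<lambda>t. f t * f t)"
    by (intro continuous_intros f)
  have "(LINT t|lebesgue_on {0..T}. f t * f t) = integral {0..T} (\<lambda>t. f t * f t)"
    by (rule lebesgue_integral_eq_integral) (auto intro: continuous_imp_integrable_real c)
  also have "\<dots> = integral {0<..<T} (\<lambda>t. f t * f t)"
    by (rule integral_open_interval_real)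
  also have "\<dots> = (LINT t|lebesgue_on {0<..<T}. f t * f t)"
    by (rule lebesgue_integral_eq_integral[symmetric]) (auto intro: continuous_Icc_integrable_Ioo c)
  finally have "(LINT t|lebesgue_on {0..T}. f t * f t) = 0"
    using zero by simp
  then have "f t * f t = 0"
    using integralL_eq_0_iff[OF c T] t by auto
  then show ?thesis by simp
qed

lemma integral_uniform_limit_Ioo:
  fixes R :: "nat \<Rightarrow> real \<Rightarrow> real"
  assumes D: "continuous_on {0..T} D" and R: "\<And>n. continuous_on {0..T} (R n)" "continuous_on {0..T} S"
    and lim: "uniform_limit {0..T} R S sequentially"
  shows "(\<lambda>n. LINT t|lebesgue_on {0<..<T}. D t * R n t) \<longlonglongrightarrow> (LINT t|lebesgue_on {0<..<T}. D t * S t)"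
proof (rule LIMSEQ_I)
  fix r :: real assume r: "r > 0"
  let ?M = "lebesgue_on {0<..<T}"
  define K where "K = (LINT t|?M. \<bar>D t\<bar>)"
  have K: "K \<ge> 0"
    by (simp add: K_def)
  have int: "integrable ?M D" "integrable ?M (\<lambda>t. D t * R n t)" "integrable ?M (\<lambda>t. D t * S t)" for n
    by (intro continuous_Icc_integrable_Ioo continuous_intros D R)+
  define e where "e = r / (K + 1)"
  have e: "e > 0" and eK: "K * e < r"
    using r K by (auto simp: e_def field_simps)
  have "\<forall>\<^sub>F n in sequentially. \<forall>t\<in>{0..T}. \<bar>R n t - S t\<bar> < e"
    using lim e unfolding uniform_limit_iff dist_real_def by blast
  then obtain m where m: "\<forall>n\<ge>m. \<forall>t\<in>{0..T}. \<bar>R n t - S t\<bar> < e"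
    unfolding eventually_sequentially by blast
  have "norm ((LINT t|?M. D t * R n t) - (LINT t|?M. D t * S t)) < r" if n: "n \<ge> m" for n
  proof -
    have "norm ((LINT t|?M. D t * R n t) - (LINT t|?M. D t * S t)) = \<bar>LINT t|?M. D t * R n t - D t * S t\<bar>"
      using int by simp
    also have "\<dots> \<le> (LINT t|?M. \<bar>D t * R n t - D t * S t\<bar>)"
      by (rule integral_abs_bound)
    also have "\<dots> \<le> (LINT t|?M. \<bar>D t\<bar> * e)"
    proof (rule integral_mono)
      fix t assume "t \<in> space ?M"
      then have "\<bar>R n t - S t\<bar> \<le> e"
        using m n by (auto intro: less_imp_le)
      then show "\<bar>D t * R n t - D t * S t\<bar> \<le> \<bar>D t\<bar> * e"
        unfolding right_diff_distrib[symmetric] abs_mult by (intro mult_left_mono) auto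
    qed (use int in auto)
    also have "\<dots> = K * e"
      by (simp add: K_def)
    finally show ?thesis
      using eK by linarith
  qed
  then show "\<exists>no. \<forall>n\<ge>no. norm ((LINT t|?M. D t * R n t) - (LINT t|?M. D t * S t)) < r"
    by blast
qed

lemma Cw_continuous:
  "v \<in> Cw T l p \<Longrightarrow> g \<in> Lp l (p / (p - 1)) \<Longrightarrow>
    continuous_on {0..T} (\<lambda>t. LINT x|lebesgue_on (torus l). v t x \<bullet> g x)"
  by (simp add: Cw_def)

lemma fourier_mode_le_1: "\<bar>fourier_mode l k \<theta> x\<bar> \<le> 1"
  by (simp add: fourier_mode_def)

lemma fourier_mode_measurable: "fourier_mode l k \<theta> \<in> borel_measurable borel"
  by (intro borel_measurable_continuous_onI continuous_fourier_mode)

lemma borel_measurable_lebesgue_on: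
  "f \<in> borel_measurable borel \<Longrightarrow> f \<in> borel_measurable (lebesgue_on S)"
  by (intro measurable_restrict_space1 measurable_completion) simp

text \<open>
  A measure-valued limit and a limit in \<open>C\<^sub>w\<close> are compared mode by mode.  The difference \<open>D\<close> of
  the two pairings is a continuous function of time, and testing the weak convergence on the
  space-time cylinder with \<open>D\<close> itself shows that its square has integral zero.
\<close>

lemma pairing_with_mode_eq:
  fixes u :: "nat \<Rightarrow> real \<Rightarrow> real^3 \<Rightarrow> state" and V :: "real \<Rightarrow> real^3 \<Rightarrow> state measure"
    and L :: "state \<Rightarrow> 'b::euclidean_space"
  assumes T: "T > 0" and p1: "p > 1"
    and YL: "young_limit (lebesgue_on ({0<..<T} \<times> torus l)) (\<lambda>n z. u n (fst z) (snd z))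
      (\<lambda>z. V (fst z) (snd z)) q C"
    and L: "continuous_on UNIV L" "\<And>s. norm (L s) \<le> norm s"
    and lim: "Cw_tendsto T l p (\<lambda>n t x. L (u n t x)) r"
    and int: "\<And>t. t \<in> {0..T} \<Longrightarrow> integrable (lebesgue_on (torus l)) (\<lambda>x. LINT s|V t x. L s)"
    and b: "b \<in> Basis"
    and cont: "continuous_on {0..T} (\<lambda>t. LINT x|lebesgue_on (torus l).
        (LINT s|V t x. L s) \<bullet> (fourier_mode l k \<theta> x *\<^sub>R b))"
    and t: "t \<in> {0..T}"
  shows "(LINT x|lebesgue_on (torus l). (LINT s|V t x. L s) \<bullet> (fourier_mode l k \<theta> x *\<^sub>R b)) =
    (LINT x|lebesgue_on (torus l). r t x \<bullet> (fourier_mode l k \<theta> x *\<^sub>R b))"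
proof -
  let ?X = "lebesgue_on (torus l)" and ?I = "lebesgue_on {0<..<T}"
    and ?Q = "lebesgue_on ({0<..<T} \<times> torus l)"
  let ?\<phi> = "fourier_mode l k \<theta>"
  interpret young_limit ?Q "\<lambda>n z. u n (fst z) (snd z)" "\<lambda>z. V (fst z) (snd z)" q C
    by (rule YL)
  have Q: "space ?Q = {0<..<T} \<times> torus l"
    by simp
  have \<phi>: "?\<phi> \<in> borel_measurable ?X"
    by (intro borel_measurable_lebesgue_on fourier_mode_measurable)
  have \<phi>b: "(\<lambda>x. ?\<phi> x *\<^sub>R b) \<in> Lp l (p / (p - 1))"
  proof (rule bounded_in_Lp)
    show "(\<lambda>x. ?\<phi> x *\<^sub>R b) \<in> borel_measurable ?X"
      using \<phi> by measurable
    show "norm (?\<phi> x *\<^sub>R b) \<le> 1" for x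
      using b fourier_mode_le_1 by simp
  qed (use p1 in \<open>auto intro!: divide_nonneg_pos\<close>)
  define R where "R n t = (LINT x|?X. L (u n t x) \<bullet> (?\<phi> x *\<^sub>R b))" for n t
  define S where "S t = (LINT x|?X. r t x \<bullet> (?\<phi> x *\<^sub>R b))" for t
  define G where "G t = (LINT x|?X. (LINT s|V t x. L s) \<bullet> (?\<phi> x *\<^sub>R b))" for t
  have Cw: "\<And>n. (\<lambda>t x. L (u n t x)) \<in> Cw T l p" "r \<in> Cw T l p"
    and unif: "uniform_limit {0..T} R S sequentially"
    using lim \<phi>b unfolding Cw_tendsto_def R_def S_def by auto
  have RS: "continuous_on {0..T} (R n)" "continuous_on {0..T} S" for n
    unfolding R_def[abs_def] S_def[abs_def] using Cw_continuous[OF Cw(1) \<phi>b] Cw_continuous[OF Cw(2) \<phi>b] .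
  have G: "continuous_on {0..T} G"
    unfolding G_def[abs_def] by (rule cont)
  define D where "D t = G t - S t" for t
  have D: "continuous_on {0..T} D"
    unfolding D_def by (intro continuous_intros G RS)
  define f where "f s = L s \<bullet> b" for s
  have f: "continuous_on UNIV f"
    unfolding f_def by (intro continuous_intros L)
  have f_le: "\<bar>f s\<bar> \<le> norm s" for s
    using Basis_le_norm[OF b, of "L s"] L(2)[of s] by (simp add: f_def)
  \<comment> \<open>Clamping the time makes the test function Borel measurable on the whole space.\<close>
  define g where "g z = D (max 0 (min T (fst z))) * ?\<phi> (snd z)" for z
  have clamp: "max 0 (min T t) \<in> {0..T}" for t
    using T by auto
  have clamp_id: "max 0 (min T t) = t" if "t \<in> {0<..<T}" for t
    using that by auto
  have g_meas: "g \<in> borel_measurable ?Q"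
  proof (rule borel_measurable_lebesgue_on)
    have "continuous_on UNIV (\<lambda>z :: real \<times> (real^3). max 0 (min T (fst z)))"
      by (intro continuous_intros)
    moreover have "range (\<lambda>z :: real \<times> (real^3). max 0 (min T (fst z))) \<subseteq> {0..T}"
      using clamp by blast
    ultimately have "continuous_on UNIV (\<lambda>z :: real \<times> (real^3). D (max 0 (min T (fst z))))"
      by (rule continuous_on_compose2[OF D])
    moreover have "continuous_on UNIV (\<lambda>z :: real \<times> (real^3). ?\<phi> (snd z))"
      by (rule continuous_on_compose2[OF continuous_fourier_mode[of UNIV]]) (auto intro: continuous_intros)
    ultimately show "g \<in> borel_measurable borel"
      unfolding g_def by (intro borel_measurable_continuous_onI continuous_on_mult)
  qed
  obtain B where B: "\<And>t. t \<in> {0..T} \<Longrightarrow> \<bar>D t\<bar> \<le> B"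
    using continuous_Icc_bounded[OF D] by blast
  have g_le: "\<bar>g z\<bar> \<le> B * 1" for z
    unfolding g_def abs_mult using B[OF clamp] fourier_mode_le_1 order_trans[OF abs_ge_zero B[OF clamp]]
    by (intro mult_mono) auto
  note weak = weak_convergence[OF f f_le g_meas g_le]
  have measI: "(\<lambda>t. D t * h t) \<in> borel_measurable ?I" if "continuous_on {0..T} h" for h
    by (intro borel_measurable_integrable continuous_Icc_integrable_Ioo continuous_on_mult D that)
  have eqR: "(LINT z|?Q. g z * f (u n (fst z) (snd z))) = (LINT t|?I. D t * R n t)" for n
  proof -
    have slice: "(LINT x|?X. g (t, x) * f (u n t x)) = D t * R n t" if "t \<in> {0<..<T}" for t
      using clamp_id[OF that] by (simp add: g_def f_def R_def mult.assoc)
    have "(LINT z|?Q. g z * f (u n (fst z) (snd z))) = (LINT t|?I. LINT x|?X. g (t, x) * f (u n t x))"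
    proof (subst integral_lebesgue_on_Times)
      show "(\<lambda>x. g (t, x) * f (u n (fst (t, x)) (snd (t, x)))) \<in> borel_measurable ?X" if "t \<in> {0<..<T}" for t
      proof -
        have "(\<lambda>x. L (u n t x)) \<in> borel_measurable ?X"
          using Cw(1)[of n] that by (auto simp: Cw_def Lp_iff)
        then show ?thesis
          using \<phi> unfolding g_def f_def fst_conv snd_conv by measurable
      qed
      show "(\<lambda>t. LINT x|?X. g (t, x) * f (u n (fst (t, x)) (snd (t, x)))) \<in> borel_measurable ?I"
        by (rule measurable_cong[THEN iffD2, OF _ measI[OF RS(1)[of n]]]) (simp add: slice)
    qed (use weak(1) in auto)
    also have "\<dots> = (LINT t|?I. D t * R n t)"
      by (intro Bochner_Integration.integral_cong refl) (simp add: slice)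
    finally show ?thesis .
  qed
  have eqG: "(LINT z|?Q. g z * bary f z) = (LINT t|?I. D t * G t)"
  proof -
    let ?W = "\<lambda>z. LINT s|V (fst z) (snd z). L s"
    have [measurable]: "?W \<in> borel_measurable ?Q"
      by (rule barycentre_measurable[OF L(1)])
    have ae: "AE z in ?Q. g z * bary f z = g z * (?W z \<bullet> b)"
      using AE_integrable_V_id AE_space
    proof eventually_elim
      case (elim z)
      have "L \<in> borel_measurable (V (fst z) (snd z))"
        using borel_measurable_continuous_onI[OF L(1)] measurable_cong_sets[OF sets_V[OF elim(2)] refl] by blast
      then have "integrable (V (fst z) (snd z)) L"
        by (rule Bochner_Integration.integrable_bound[OF elim(1)]) (auto simp: L(2))
      then show ?case
        by (simp add: bary_def f_def)
    qed
    note [measurable] = g_meas bary_measurable[OF f]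
    have slice: "(LINT x|?X. g (t, x) * (?W (t, x) \<bullet> b)) = D t * G t" if "t \<in> {0<..<T}" for t
      using clamp_id[OF that] by (simp add: g_def G_def mult.assoc)
    have "(LINT z|?Q. g z * bary f z) = (LINT z|?Q. g z * (?W z \<bullet> b))"
      by (rule integral_cong_AE[OF _ _ ae]) measurable
    also have "\<dots> = (LINT t|?I. LINT x|?X. g (t, x) * (?W (t, x) \<bullet> b))"
    proof (rule integral_lebesgue_on_Times)
      show "integrable ?Q (\<lambda>z. g z * (?W z \<bullet> b))"
        by (rule integrable_cong_AE_imp[OF weak(2) _ ae]) measurable
      show "(\<lambda>x. g (t, x) * (?W (t, x) \<bullet> b)) \<in> borel_measurable ?X" if "t \<in> {0<..<T}" for t
      proof -
        have "(\<lambda>x. LINT s|V t x. L s) \<in> borel_measurable ?X"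
          using int[of t] that by auto
        then show ?thesis
          using \<phi> unfolding g_def fst_conv snd_conv by measurable
      qed
      show "(\<lambda>t. LINT x|?X. g (t, x) * (?W (t, x) \<bullet> b)) \<in> borel_measurable ?I"
        by (rule measurable_cong[THEN iffD2, OF _ measI[OF G]]) (rule slice, simp)
    qed auto
    also have "\<dots> = (LINT t|?I. D t * G t)"
      by (intro Bochner_Integration.integral_cong refl) (rule slice, simp)
    finally show ?thesis .
  qed
  have "(\<lambda>n. LINT t|?I. D t * R n t) \<longlonglongrightarrow> (LINT t|?I. D t * G t)"
    using weak(3) unfolding eqR eqG .
  moreover have "(\<lambda>n. LINT t|?I. D t * R n t) \<longlonglongrightarrow> (LINT t|?I. D t * S t)"
    by (rule integral_uniform_limit_Ioo[OF D RS unif])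
  ultimately have eq: "(LINT t|?I. D t * G t) = (LINT t|?I. D t * S t)"
    by (rule LIMSEQ_unique)
  have "(LINT t|?I. D t * D t) = (LINT t|?I. D t * G t - D t * S t)"
    by (simp add: D_def right_diff_distrib)
  also have "\<dots> = (LINT t|?I. D t * G t) - (LINT t|?I. D t * S t)"
    by (intro Bochner_Integration.integral_diff continuous_Icc_integrable_Ioo continuous_on_mult D G RS)
  finally have "(LINT t|?I. D t * D t) = 0"
    using eq by simp
  from continuous_zero_if_square_integral_zero[OF T D this t]
  show ?thesis
    by (simp add: D_def G_def S_def)
qed

text \<open>
  Equality of all pairings with modes at time \<open>t\<close> gives equality almost everywhere in space at that
  time, for every \<open>t\<close> in the closed interval.  Membership in \<open>C\<^sub>w\<close> and the convergence are then
  inherited from the given limit.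
\<close>

lemma Cw_limit_is_barycentre:
  fixes u :: "nat \<Rightarrow> real \<Rightarrow> real^3 \<Rightarrow> state" and V :: "real \<Rightarrow> real^3 \<Rightarrow> state measure"
    and L :: "state \<Rightarrow> 'b::euclidean_space"
  assumes T: "T > 0" and l: "l > 0" and p: "p > 1"
    and YL: "young_limit (lebesgue_on ({0<..<T} \<times> torus l)) (\<lambda>n z. u n (fst z) (snd z))
      (\<lambda>z. V (fst z) (snd z)) q C"
    and L: "continuous_on UNIV L" "\<And>s. norm (L s) \<le> norm s"
    and lim: "Cw_tendsto T l p (\<lambda>n t x. L (u n t x)) r"
    and int: "\<And>t. t \<in> {0..T} \<Longrightarrow> integrable (lebesgue_on (torus l)) (\<lambda>x. LINT s|V t x. L s)"
    and cont: "\<And>k \<theta> b. \<theta> \<in> {0, - pi / 2} \<Longrightarrow> b \<in> Basis \<Longrightarrow>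
      continuous_on {0..T} (\<lambda>t. LINT x|lebesgue_on (torus l).
        (LINT s|V t x. L s) \<bullet> (fourier_mode l k \<theta> x *\<^sub>R b))"
  shows "Cw_tendsto T l p (\<lambda>n t x. L (u n t x)) (\<lambda>t x. LINT s|V t x. L s)"
proof -
  let ?X = "lebesgue_on (torus l)"
  define W where "W t x = (LINT s|V t x. L s)" for t x
  interpret X: finite_measure ?X
    by (rule finite_measure_lebesgue_on_torus)
  have r: "r \<in> Cw T l p"
    using lim by (simp add: Cw_tendsto_def)
  have r_Lp: "r t \<in> Lp l p" if "t \<in> {0..T}" for t
    using r that by (auto simp: Cw_def)
  have W_int: "integrable ?X (W t)" if "t \<in> {0..T}" for t
    unfolding W_def[abs_def] by (rule int[OF that])
  have ae: "AE x in ?X. W t x = r t x" if t: "t \<in> {0..T}" for t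
  proof -
    have "integrable ?X (\<lambda>x. 1 + norm (r t x) powr p)"
      using r_Lp[OF t] by (auto simp: Lp_iff)
    then have r_int: "integrable ?X (r t)"
    proof (rule Bochner_Integration.integrable_bound)
      show "AE x in ?X. norm (r t x) \<le> norm (1 + norm (r t x) powr p)"
        by (intro AE_I2 order_trans[OF le_one_plus_powr[OF p norm_ge_zero]]) simp
    qed (use r_Lp[OF t] in \<open>auto simp: Lp_iff\<close>)
    have mult: "integrable ?X (\<lambda>x. h x \<bullet> (fourier_mode l k \<theta> x *\<^sub>R b))"
      if h: "integrable ?X h" and b: "b \<in> Basis" for h :: "real^3 \<Rightarrow> 'b" and k \<theta> b
    proof (rule Bochner_Integration.integrable_bound[OF h])
      note [measurable] = borel_measurable_lebesgue_on[OF fourier_mode_measurable, where S = "torus l"]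
        borel_measurable_integrable[OF h]
      show "(\<lambda>x. h x \<bullet> (fourier_mode l k \<theta> x *\<^sub>R b)) \<in> borel_measurable ?X"
        by measurable
      have "\<bar>h x \<bullet> (fourier_mode l k \<theta> x *\<^sub>R b)\<bar> \<le> norm (h x) * norm (fourier_mode l k \<theta> x *\<^sub>R b)" for x
        by (rule Cauchy_Schwarz_ineq2)
      also have "norm (h x) * norm (fourier_mode l k \<theta> x *\<^sub>R b) \<le> norm (h x) * 1" for x
        using fourier_mode_le_1 b by (intro mult_left_mono) auto
      finally show "AE x in ?X. norm (h x \<bullet> (fourier_mode l k \<theta> x *\<^sub>R b)) \<le> norm (h x)"
        by auto
    qed
    have "AE x in ?X. W t x - r t x = 0"
    proof (rule AE_zero_if_fourier_modes_vanish[OF l])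
      show "integrable ?X (\<lambda>x. W t x - r t x)"
        using W_int[OF t] r_int by simp
      fix k \<theta> and b :: 'b
      assume \<theta>: "\<theta> \<in> {0, - pi / 2}" and b: "b \<in> Basis"
      show "(LINT x|?X. (W t x - r t x) \<bullet> (fourier_mode l k \<theta> x *\<^sub>R b)) = 0"
        using pairing_with_mode_eq[OF T p YL L lim int b cont[OF \<theta> b] t]
          mult[OF W_int[OF t] b, of k \<theta>] mult[OF r_int b, of k \<theta>]
        by (simp only: inner_diff_left Bochner_Integration.integral_diff W_def)
    qed
    then show ?thesis
      by eventually_elim simp
  qed
  have W_Lp: "W t \<in> Lp l p" if t: "t \<in> {0..T}" for t
  proof -
    note [measurable] = borel_measurable_integrable[OF W_int[OF t]]
    have "integrable ?X (\<lambda>x. norm (r t x) powr p)"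
      using r_Lp[OF t] by (simp add: Lp_iff)
    then have "integrable ?X (\<lambda>x. norm (W t x) powr p)"
      by (rule integrable_cong_AE_imp) (measurable, use ae[OF t] in eventually_elim, simp)
    then show ?thesis
      by (simp add: Lp_iff)
  qed
  have pairing: "(LINT x|?X. W t x \<bullet> g x) = (LINT x|?X. r t x \<bullet> g x)"
    if t: "t \<in> {0..T}" and g: "g \<in> Lp l (p / (p - 1))" for t g
  proof (rule integral_cong_AE)
    show "AE x in ?X. W t x \<bullet> g x = r t x \<bullet> g x"
      using ae[OF t] by eventually_elim simp
  qed (use W_Lp[OF t] r_Lp[OF t] g in \<open>auto simp: Lp_iff\<close>)
  have "W \<in> Cw T l p"
    unfolding Cw_def
  proof (intro CollectI conjI ballI W_Lp)
    fix g :: "real^3 \<Rightarrow> 'b" assume g: "g \<in> Lp l (p / (p - 1))"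
    have "continuous_on {0..T} (\<lambda>t. LINT x|?X. r t x \<bullet> g x)"
      by (rule Cw_continuous[OF r g])
    then show "continuous_on {0..T} (\<lambda>t. LINT x|?X. W t x \<bullet> g x)"
      by (rule continuous_on_eq) (simp add: pairing[OF _ g])
  qed
  moreover have "uniform_limit {0..T} (\<lambda>n t. LINT x|?X. L (u n t x) \<bullet> g x) (\<lambda>t. LINT x|?X. W t x \<bullet> g x) sequentially"
    if g: "g \<in> Lp l (p / (p - 1))" for g
  proof -
    have "uniform_limit {0..T} (\<lambda>n t. LINT x|?X. L (u n t x) \<bullet> g x) (\<lambda>t. LINT x|?X. r t x \<bullet> g x) sequentially"
      using lim g by (auto simp: Cw_tendsto_def)
    then show ?thesis
      by (rule uniform_limit_cong'[THEN iffD1, rotated 2]) (auto simp: pairing[OF _ g])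
  qed
  ultimately show ?thesis
    using lim unfolding Cw_tendsto_def W_def by blast
qed


section \<open>Generated solutions\<close>

lemma SUP_abs_mult:
  fixes f :: "'a \<Rightarrow> real"
  assumes "\<And>x. \<bar>f x\<bar> \<le> B"
  shows "(SUP x. \<bar>c * f x\<bar>) = \<bar>c\<bar> * (SUP x. \<bar>f x\<bar>)"
proof -
  have bdd: "bdd_above (range (\<lambda>x. \<bar>f x\<bar>))"
    by (rule bdd_aboveI2[of _ _ B]) (rule assms)
  have bdd_c: "bdd_above (range (\<lambda>x. \<bar>c * f x\<bar>))"
    by (rule bdd_aboveI2[of _ _ "\<bar>c\<bar> * B"]) (simp add: abs_mult mult_left_mono assms)
  show ?thesis
  proof (rule antisym)
    show "(SUP x. \<bar>c * f x\<bar>) \<le> \<bar>c\<bar> * (SUP x. \<bar>f x\<bar>)"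
      by (intro cSUP_least) (auto simp: abs_mult intro!: mult_left_mono cSUP_upper bdd)
    show "\<bar>c\<bar> * (SUP x. \<bar>f x\<bar>) \<le> (SUP x. \<bar>c * f x\<bar>)"
    proof (cases "c = 0")
      case False
      have "(SUP x. \<bar>f x\<bar>) \<le> (SUP x. \<bar>c * f x\<bar>) / \<bar>c\<bar>"
      proof (rule cSUP_least)
        fix x
        have "\<bar>c\<bar> * \<bar>f x\<bar> \<le> (SUP x. \<bar>c * f x\<bar>)"
          unfolding abs_mult[symmetric] by (intro cSUP_upper bdd_c) simp
        then show "\<bar>f x\<bar> \<le> (SUP x. \<bar>c * f x\<bar>) / \<bar>c\<bar>"
          using False by (simp add: pos_le_divide_eq mult.commute)
      qed simp
      then show ?thesis
        using False by (simp add: pos_le_divide_eq mult.commute)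
    qed simp
  qed
qed

text \<open>
  Products of a bounded function of the base point and a function of the state vanishing at
  infinity are admissible in the convergence of Young measures.
\<close>

lemma young_tendsto_product:
  fixes u :: "nat \<Rightarrow> real \<Rightarrow> real^3 \<Rightarrow> state" and f :: "state \<Rightarrow> real" and g :: "real \<times> (real^3) \<Rightarrow> real"
  assumes fin: "finite_measure (lebesgue_on Q)"
    and lim: "young_tendsto Q (\<lambda>n t x. return borel (u n t x)) V"
    and f: "continuous_on UNIV f" "(f \<longlongrightarrow> 0) at_infinity"
    and g: "g \<in> borel_measurable (lebesgue_on Q)" "\<And>z. z \<in> space (lebesgue_on Q) \<Longrightarrow> \<bar>g z\<bar> \<le> B"
  shows "(\<lambda>n. LINT z|lebesgue_on Q. g z * f (u n (fst z) (snd z))) \<longlonglongrightarrow>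
    (LINT z|lebesgue_on Q. g z * (LINT s|V (fst z) (snd z). f s))"
proof -
  interpret finite_measure "lebesgue_on Q" by (rule fin)
  obtain A where A: "\<And>s. \<bar>f s\<bar> \<le> A"
    using vanishing_continuous_bounded[OF f] by blast
  have "integrable (lebesgue_on Q) g"
    by (rule integrable_const_bound[where B = B]) (use g in auto)
  then have "integrable (lebesgue_on Q) (\<lambda>z. \<bar>g z\<bar> * (SUP s. \<bar>f s\<bar>))"
    by simp
  then have "integrable (lebesgue_on Q) (\<lambda>z. SUP s. \<bar>g z * f s\<bar>)"
    by (simp only: SUP_abs_mult[OF A])
  then have "(\<lambda>z s. g z * f s) \<in> L1C0 Q"
    unfolding L1C0_def using g(1)
    by (auto intro!: continuous_on_mult continuous_on_const f tendsto_mult_right_zero)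
  then have "(\<lambda>n. LINT z|lebesgue_on Q. LINT s|return borel (u n (fst z) (snd z)). g z * f s) \<longlonglongrightarrow>
      (LINT z|lebesgue_on Q. LINT s|V (fst z) (snd z). g z * f s)"
    by (rule bspec[OF lim[unfolded young_tendsto_def]])
  moreover have "(LINT s|return borel v. f s) = f v" for v
    using borel_measurable_continuous_onI[OF f(1)] by (intro integral_return) auto
  ultimately show ?thesis
    by simp
qed

lemma mexp_bounds:
  assumes "\<gamma> > 1"
  shows "1 < mexp \<gamma>" "mexp \<gamma> \<le> 2" "mexp \<gamma> \<le> \<gamma>"
  using assms by (auto simp: mexp_def field_simps)

lemma state_norm_powr_le:
  fixes s :: state
  assumes "1 \<le> p" "p \<le> \<gamma>"
  shows "norm s powr p \<le> 2 powr p * (1 + norm (fst s) powr \<gamma> + norm (snd s) powr p)"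
proof -
  let ?a = "norm (fst s)" and ?b = "norm (snd s)"
  have "norm s \<le> ?a + ?b"
    using norm_Pair_le[of "fst s" "snd s"] by simp
  also have "\<dots> \<le> 2 * max ?a ?b"
    by simp
  finally have "norm s powr p \<le> (2 * max ?a ?b) powr p"
    using assms by (intro powr_mono2) auto
  also have "\<dots> = 2 powr p * max ?a ?b powr p"
    by (simp add: powr_mult)
  also have "max ?a ?b powr p \<le> ?a powr p + ?b powr p"
    by (auto simp: max_def)
  also have "?a powr p \<le> 1 + ?a powr \<gamma>"
  proof (cases "?a \<le> 1")
    case True
    then have "?a powr p \<le> 1 powr p"
      using assms by (intro powr_mono2) auto
    then show ?thesis
      by (simp add: add_increasing2)
  next
    case False
    then have "?a powr p \<le> ?a powr \<gamma>"
      using assms by (intro powr_mono) auto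
    then show ?thesis
      by linarith
  qed
  finally show ?thesis
    by simp
qed

text \<open>
  The momentum has the smaller exponent, so the density is estimated by its own power plus a constant;
  then the bounds at fixed time are integrated over \<open>(0,T)\<close>.
\<close>

lemma Cw_bounds_moment:
  fixes u :: "nat \<Rightarrow> real \<Rightarrow> real^3 \<Rightarrow> state"
  assumes T: "T > 0" and \<gamma>: "\<gamma> > 1"
    and r: "Cw_tendsto T l \<gamma> (\<lambda>n t x. fst (u n t x)) r"
    and m: "Cw_tendsto T l (mexp \<gamma>) (\<lambda>n t x. snd (u n t x)) m"
    and u: "\<And>n. (\<lambda>z. u n (max 0 (min T (fst z))) (snd z)) \<in> borel_measurable borel"
  shows "\<exists>C\<ge>0. \<forall>n. (\<integral>\<^sup>+z. ennreal (norm (u n (fst z) (snd z)) powr mexp \<gamma>)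
    \<partial>lebesgue_on ({0<..<T} \<times> torus l)) \<le> ennreal C"
proof -
  let ?p = "mexp \<gamma>" and ?X = "lebesgue_on (torus l)" and ?I = "lebesgue_on {0<..<T}"
  note p = mexp_bounds[OF \<gamma>]
  interpret X: finite_measure ?X
    by (rule finite_measure_lebesgue_on_torus)
  obtain A where A: "A \<ge> 0" "\<And>n t. t \<in> {0..T} \<Longrightarrow> (LINT x|?X. norm (fst (u n t x)) powr \<gamma>) \<le> A"
    using Cw_tendsto_bounded[OF \<gamma> r] by blast
  obtain B where B: "B \<ge> 0" "\<And>n t. t \<in> {0..T} \<Longrightarrow> (LINT x|?X. norm (snd (u n t x)) powr ?p) \<le> B"
    using Cw_tendsto_bounded[OF p(1) m] by blast
  define K where "K = 2 powr ?p * (measure ?X (space ?X) + A + B)"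
  have K: "K \<ge> 0"
    using A(1) B(1) by (simp add: K_def)
  have slice: "(\<integral>\<^sup>+x. ennreal (norm (u n t x) powr ?p) \<partial>?X) \<le> ennreal K" if t: "t \<in> {0..T}" for n t
  proof -
    have int: "integrable ?X (\<lambda>x. norm (fst (u n t x)) powr \<gamma>)" "integrable ?X (\<lambda>x. norm (snd (u n t x)) powr ?p)"
      using r m t unfolding Cw_tendsto_def Cw_def Lp_iff by auto
    let ?h = "\<lambda>x. 2 powr ?p * (1 + norm (fst (u n t x)) powr \<gamma> + norm (snd (u n t x)) powr ?p)"
    have h: "integrable ?X ?h"
      using int by (intro integrable_mult_right Bochner_Integration.integrable_add) auto
    have "(\<integral>\<^sup>+x. ennreal (norm (u n t x) powr ?p) \<partial>?X) \<le> (\<integral>\<^sup>+x. ennreal (?h x) \<partial>?X)"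
      using p by (intro nn_integral_mono ennreal_leI state_norm_powr_le) auto
    also have "\<dots> = ennreal (LINT x|?X. ?h x)"
      by (rule nn_integral_eq_integral[OF h]) simp
    also have "(LINT x|?X. ?h x) = 2 powr ?p * (measure ?X (space ?X) +
        (LINT x|?X. norm (fst (u n t x)) powr \<gamma>) + (LINT x|?X. norm (snd (u n t x)) powr ?p))"
      using int by simp
    also have "\<dots> \<le> K"
      unfolding K_def using A(2)[OF t, of n] B(2)[OF t, of n] by (intro mult_left_mono add_mono) auto
    finally show ?thesis
      by (simp add: ennreal_leI)
  qed
  have "(\<integral>\<^sup>+z. ennreal (norm (u n (fst z) (snd z)) powr ?p) \<partial>lebesgue_on ({0<..<T} \<times> torus l)) \<le> ennreal (K * T)" for n
  proof -
    note [measurable] = u[of n]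
    let ?u = "\<lambda>z. u n (max 0 (min T (fst z))) (snd z)"
    have "(\<integral>\<^sup>+z. ennreal (norm (u n (fst z) (snd z)) powr ?p) \<partial>lebesgue_on ({0<..<T} \<times> torus l)) =
        (\<integral>\<^sup>+z. ennreal (norm (?u z) powr ?p) \<partial>lebesgue_on ({0<..<T} \<times> torus l))"
      by (intro nn_integral_cong) (auto simp: max_def min_def)
    also have "\<dots> = (\<integral>\<^sup>+t. (\<integral>\<^sup>+x. ennreal (norm (?u (t, x)) powr ?p) \<partial>?X) \<partial>?I)"
      by (rule nn_integral_lebesgue_on_Times) (auto intro: torus_borel)
    also have "\<dots> \<le> (\<integral>\<^sup>+t. ennreal K \<partial>?I)"
      using slice T by (intro nn_integral_mono) auto
    also have "\<dots> = ennreal (K * T)"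
      using T K by (simp add: emeasure_restrict_space ennreal_mult)
    finally show ?thesis .
  qed
  then show ?thesis
    using K T by (intro exI[of _ "K * T"]) auto
qed

lemma young_limit_if_generated:
  fixes u :: "nat \<Rightarrow> real \<Rightarrow> real^3 \<Rightarrow> state" and V :: "real \<Rightarrow> real^3 \<Rightarrow> state measure"
  assumes T: "T > 0" and l: "l > 0" and \<gamma>: "\<gamma> > 1" and h: "\<And>n. h n > 0"
    and grid: "\<And>n t. t \<in> {0..T} \<Longrightarrow> grid_fun l (h n) (u n t)"
    and u_cont: "\<And>n x. continuous_on {0..T} (\<lambda>t. u n t x)"
    and V_prob: "\<And>t x. t \<in> {0..T} \<Longrightarrow> x \<in> torus l \<Longrightarrow> V t x \<in> space (prob_algebra borel)"
    and V_meas: "\<And>f :: state \<Rightarrow> real. continuous_on UNIV f \<Longrightarrow> (f \<longlongrightarrow> 0) at_infinity \<Longrightarrow>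
      (\<lambda>z. LINT s|V (fst z) (snd z). f s) \<in> borel_measurable (lebesgue_on ({0..T} \<times> torus l))"
    and young: "young_tendsto ({0<..<T} \<times> torus l) (\<lambda>n t x. return borel (u n t x)) V"
    and r: "Cw_tendsto T l \<gamma> (\<lambda>n t x. fst (u n t x)) r"
    and m: "Cw_tendsto T l (mexp \<gamma>) (\<lambda>n t x. snd (u n t x)) m"
  shows "\<exists>C. young_limit (lebesgue_on ({0<..<T} \<times> torus l)) (\<lambda>n z. u n (fst z) (snd z))
    (\<lambda>z. V (fst z) (snd z)) (mexp \<gamma>) C"
proof -
  let ?Q = "lebesgue_on ({0<..<T} \<times> torus l)"
  have u_meas: "(\<lambda>z. u n (max 0 (min T (fst z))) (snd z)) \<in> borel_measurable borel" for n
    by (rule grid_fun_time_continuous_measurable[OF _ h grid u_cont]) (use T in auto)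
  obtain C where C: "C \<ge> 0"
    "\<And>n. (\<integral>\<^sup>+z. ennreal (norm (u n (fst z) (snd z)) powr mexp \<gamma>) \<partial>?Q) \<le> ennreal C"
    using Cw_bounds_moment[OF T \<gamma> r m u_meas] by blast
  have "young_limit ?Q (\<lambda>n z. u n (fst z) (snd z)) (\<lambda>z. V (fst z) (snd z)) (mexp \<gamma>) C"
  proof (intro young_limit.intro young_limit_axioms.intro finite_measure_lebesgue_on_cylinder mexp_bounds \<gamma> C)
    show "(\<lambda>z. u n (fst z) (snd z)) \<in> borel_measurable ?Q" for n
      by (rule measurable_cong[THEN iffD1, OF _ borel_measurable_lebesgue_on[OF u_meas[of n]]])
         (auto simp: max_def min_def)
    show "V (fst z) (snd z) \<in> space (prob_algebra borel)" if "z \<in> space ?Q" for z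
      using that by (auto intro: V_prob)
    show "(\<lambda>z. LINT s|V (fst z) (snd z). f s) \<in> borel_measurable ?Q"
      if "continuous_on UNIV f" "(f \<longlongrightarrow> 0) at_infinity" for f :: "state \<Rightarrow> real"
    proof (rule measurable_restrict_mono[OF V_meas[OF that]])
      show "{0<..<T} \<times> torus l \<subseteq> {0..T} \<times> torus l"
        by auto
    qed
  qed (rule young_tendsto_product[OF finite_measure_lebesgue_on_cylinder young])
  then show ?thesis by blast
qed

theorem theorem2p15:
  fixes T l \<gamma> :: real
    and \<Psi> :: "nat \<Rightarrow> (real^3) \<times> state \<Rightarrow> real^3"
    and M :: "'a measure" and F :: "real \<Rightarrow> 'a measure"
    and W :: "'a \<Rightarrow> real \<Rightarrow> nat \<Rightarrow> real"
    and init :: "'a \<Rightarrow> (real^3 \<Rightarrow> real) \<times> (real^3 \<Rightarrow> real^3)"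
    and U :: "real \<Rightarrow> 'a \<Rightarrow> real \<Rightarrow> real^3 \<Rightarrow> state"
    and \<Lambda> :: "((real^3 \<Rightarrow> real) \<times> (real^3 \<Rightarrow> real^3)) measure"
    and M' :: "'b measure" and F' :: "real \<Rightarrow> 'b measure"
    and V :: "'b \<Rightarrow> real \<Rightarrow> real^3 \<Rightarrow> state measure"
    and W' :: "'b \<Rightarrow> real \<Rightarrow> nat \<Rightarrow> real"
    and hs :: "nat \<Rightarrow> real" and U' :: "nat \<Rightarrow> 'b \<Rightarrow> real \<Rightarrow> real^3 \<Rightarrow> state"
  assumes "T > 0" and "l > 0" and "\<gamma> > 1"
    and "noise_coeff l \<Psi>"
    and "stochastic_basis M F" and "cylindrical_wiener M F W"
    and "init \<in> F 0 \<rightarrow>\<^sub>M (Lp_borel l \<gamma> \<Otimes>\<^sub>M Lp_borel l (mexp \<gamma>))"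
    and "\<And>h. mesh l h \<Longrightarrow> scheme_solution T l \<gamma> \<Psi> M F W init h (U h)"
    and positive: "\<And>h. mesh l h \<Longrightarrow> AE \<omega> in M. \<forall>t\<in>{0..T}. \<forall>x. fst (U h \<omega> t x) > 0"
    and energy_bounds:
      "bounded_moments T l M 2 (\<lambda>h \<omega> t x. snd (U h \<omega> t x) /\<^sub>R sqrt (fst (U h \<omega> t x)))"
      "bounded_moments T l M \<gamma> (\<lambda>h \<omega> t x. fst (U h \<omega> t x))"
      "bounded_moments T l M (mexp \<gamma>) (\<lambda>h \<omega> t x. snd (U h \<omega> t x))"
    and solution: "dmv_martingale_solution T l \<gamma> \<Psi> \<Lambda> M' F' V W'"
    and gen: "generates T l \<gamma> M W U M' V W' hs U'"
  shows
    "(\<exists>r. strict_mono r \<and>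
       (AE \<omega> in M'.
          Cw_tendsto T l \<gamma> (\<lambda>k t x. fst (U' (r k) \<omega> t x)) (\<lambda>t x. LINT u|V \<omega> t x. fst u) \<and>
          Cw_tendsto T l (mexp \<gamma>) (\<lambda>k t x. snd (U' (r k) \<omega> t x)) (\<lambda>t x. LINT u|V \<omega> t x. snd u)))
     \<and> (AE \<omega> in M'. \<exists>r. strict_mono r \<and>
          (AE z in lebesgue_on ({0<..<T} \<times> torus l).
             (\<lambda>N. (\<Sum>k=1..N. fst (U' (r k) \<omega> (fst z) (snd z))) / real N)
               \<longlonglongrightarrow> (LINT u|V \<omega> (fst z) (snd z). fst u) \<and>
             (\<lambda>N. (\<Sum>k=1..N. snd (U' (r k) \<omega> (fst z) (snd z))) /\<^sub>R real N)
               \<longlonglongrightarrow> (LINT u|V \<omega> (fst z) (snd z). snd u)))"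
proof -
  let ?p = "mexp \<gamma>"
  have T: "T > 0" and l: "l > 0" and \<gamma>: "\<gamma> > 1"
    by fact+
  note p = mexp_bounds[OF \<gamma>]
  have V: "young_random_variable T l M' V"
    and reg: "barycentre_regular T l \<gamma> M' F' V fst" "barycentre_regular T l ?p M' F' V snd"
    using solution by (simp_all add: dmv_martingale_solution_def)
  have mesh: "\<And>n. mesh l (hs n)"
    and grid: "\<And>n \<omega> t. \<omega> \<in> space M' \<Longrightarrow> t \<in> {0..T} \<Longrightarrow> grid_fun l (hs n) (U' n \<omega> t)"
    and u_cont: "\<And>n \<omega> x. \<omega> \<in> space M' \<Longrightarrow> continuous_on {0..T} (\<lambda>t. U' n \<omega> t x)"
    and young: "AE \<omega> in M'. young_tendsto ({0<..<T} \<times> torus l) (\<lambda>n t x. return borel (U' n \<omega> t x)) (V \<omega>)"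
    and Cw: "AE \<omega> in M'. \<exists>r m. Cw_tendsto T l \<gamma> (\<lambda>n t x. fst (U' n \<omega> t x)) r \<and>
        Cw_tendsto T l ?p (\<lambda>n t x. snd (U' n \<omega> t x)) m"
    using gen unfolding generates_def by blast+
  have int: "AE \<omega> in M'. \<forall>t\<in>{0..T}. integrable (lebesgue_on (torus l)) (\<lambda>x. LINT s|V \<omega> t x. fst s)"
    "AE \<omega> in M'. \<forall>t\<in>{0..T}. integrable (lebesgue_on (torus l)) (\<lambda>x. LINT s|V \<omega> t x. snd s)"
    using reg unfolding barycentre_regular_def by (auto elim: eventually_mono)
  have cont: "AE \<omega> in M'. \<forall>k. \<forall>\<theta>\<in>{0, - pi / 2}. \<forall>b\<in>Basis. continuous_on {0..T}
      (\<lambda>t. LINT x|lebesgue_on (torus l). (LINT s|V \<omega> t x. L s) \<bullet> (fourier_mode l k \<theta> x *\<^sub>R b))"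
    if "barycentre_regular T l q M' F' V L" for q and L :: "state \<Rightarrow> 'c::euclidean_space"
    unfolding AE_all_countable
  proof (intro allI AE_finite_allI finite_Basis)
    fix k \<theta> and b :: 'c
    show "AE \<omega> in M'. continuous_on {0..T}
      (\<lambda>t. LINT x|lebesgue_on (torus l). (LINT s|V \<omega> t x. L s) \<bullet> (fourier_mode l k \<theta> x *\<^sub>R b))"
      using that test_fun_fourier_mode[OF l, of k \<theta> b] unfolding barycentre_regular_def by blast
  qed simp
  have path: "Cw_tendsto T l \<gamma> (\<lambda>n t x. fst (U' n \<omega> t x)) (\<lambda>t x. LINT s|V \<omega> t x. fst s) \<and>
      Cw_tendsto T l ?p (\<lambda>n t x. snd (U' n \<omega> t x)) (\<lambda>t x. LINT s|V \<omega> t x. snd s) \<and>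
      (\<exists>r. strict_mono r \<and>
          (AE z in lebesgue_on ({0<..<T} \<times> torus l).
             (\<lambda>N. (\<Sum>k=1..N. fst (U' (r k) \<omega> (fst z) (snd z))) / real N)
               \<longlonglongrightarrow> (LINT u|V \<omega> (fst z) (snd z). fst u) \<and>
             (\<lambda>N. (\<Sum>k=1..N. snd (U' (r k) \<omega> (fst z) (snd z))) /\<^sub>R real N)
               \<longlonglongrightarrow> (LINT u|V \<omega> (fst z) (snd z). snd u)))"
    if \<omega>: "\<omega> \<in> space M'"
      and young: "young_tendsto ({0<..<T} \<times> torus l) (\<lambda>n t x. return borel (U' n \<omega> t x)) (V \<omega>)"
      and Cw: "\<exists>r m. Cw_tendsto T l \<gamma> (\<lambda>n t x. fst (U' n \<omega> t x)) r \<and>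
        Cw_tendsto T l ?p (\<lambda>n t x. snd (U' n \<omega> t x)) m"
      and int: "\<forall>t\<in>{0..T}. integrable (lebesgue_on (torus l)) (\<lambda>x. LINT s|V \<omega> t x. fst s)"
        "\<forall>t\<in>{0..T}. integrable (lebesgue_on (torus l)) (\<lambda>x. LINT s|V \<omega> t x. snd s)"
      and cont: "\<forall>k. \<forall>\<theta>\<in>{0, - pi / 2}. \<forall>b\<in>Basis. continuous_on {0..T}
        (\<lambda>t. LINT x|lebesgue_on (torus l). (LINT s|V \<omega> t x. fst s) \<bullet> (fourier_mode l k \<theta> x *\<^sub>R b))"
        "\<forall>k. \<forall>\<theta>\<in>{0, - pi / 2}. \<forall>b\<in>Basis. continuous_on {0..T}
        (\<lambda>t. LINT x|lebesgue_on (torus l). (LINT s|V \<omega> t x. snd s) \<bullet> (fourier_mode l k \<theta> x *\<^sub>R b))"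
    for \<omega>
  proof -
    let ?Q = "lebesgue_on ({0<..<T} \<times> torus l)"
    obtain r m where r: "Cw_tendsto T l \<gamma> (\<lambda>n t x. fst (U' n \<omega> t x)) r"
      and m: "Cw_tendsto T l ?p (\<lambda>n t x. snd (U' n \<omega> t x)) m"
      using Cw by blast
    have "\<exists>C. young_limit ?Q (\<lambda>n z. U' n \<omega> (fst z) (snd z)) (\<lambda>z. V \<omega> (fst z) (snd z)) ?p C"
    proof (rule young_limit_if_generated[OF T l \<gamma> _ grid[OF \<omega>] u_cont[OF \<omega>] _ _ young r m])
      show "hs n > 0" for n
        using mesh[of n] by (simp add: mesh_def)
    qed (use V \<omega> in \<open>auto simp: young_random_variable_def\<close>)
    then obtain C where YL: "young_limit ?Q (\<lambda>n z. U' n \<omega> (fst z) (snd z)) (\<lambda>z. V \<omega> (fst z) (snd z)) ?p C"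
      by blast
    interpret young_limit ?Q "\<lambda>n z. U' n \<omega> (fst z) (snd z)" "\<lambda>z. V \<omega> (fst z) (snd z)" ?p C
      by (rule YL)
    have fst_le: "norm (fst s) \<le> norm s" and snd_le: "norm (snd s) \<le> norm s" for s :: state
      using norm_fst_le[of "fst s" "snd s"] norm_snd_le[of "snd s" "fst s"] by simp_all
    have 1: "Cw_tendsto T l \<gamma> (\<lambda>n t x. fst (U' n \<omega> t x)) (\<lambda>t x. LINT s|V \<omega> t x. fst s)"
      using int(1) cont(1)
      by (intro Cw_limit_is_barycentre[OF T l \<gamma> YL linear_continuous_on[OF bounded_linear_fst] fst_le r]) blast+
    have 2: "Cw_tendsto T l ?p (\<lambda>n t x. snd (U' n \<omega> t x)) (\<lambda>t x. LINT s|V \<omega> t x. snd s)"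
      using int(2) cont(2)
      by (intro Cw_limit_is_barycentre[OF T l mexp_bounds(1)[OF \<gamma>] YL linear_continuous_on[OF bounded_linear_snd] snd_le m]) blast+
    obtain s :: "nat \<Rightarrow> nat" where s: "strict_mono s"
      and ae: "AE z in ?Q. (\<lambda>N. (\<Sum>k=1..N. U' (s k) \<omega> (fst z) (snd z)) /\<^sub>R real N)
        \<longlonglongrightarrow> (LINT x|V \<omega> (fst z) (snd z). x)"
      using cesaro_subsequence by blast
    have "AE z in ?Q.
        (\<lambda>N. (\<Sum>k=1..N. fst (U' (s k) \<omega> (fst z) (snd z))) / real N)
          \<longlonglongrightarrow> (LINT u|V \<omega> (fst z) (snd z). fst u) \<and>
        (\<lambda>N. (\<Sum>k=1..N. snd (U' (s k) \<omega> (fst z) (snd z))) /\<^sub>R real N)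
          \<longlonglongrightarrow> (LINT u|V \<omega> (fst z) (snd z). snd u)"
      using ae AE_integrable_V_id
    proof eventually_elim
      case (elim z)
      have "(LINT u|V \<omega> (fst z) (snd z). fst u) = fst (LINT u|V \<omega> (fst z) (snd z). u)"
        by (rule integral_bounded_linear[OF bounded_linear_fst elim(2)])
      moreover have "(LINT u|V \<omega> (fst z) (snd z). snd u) = snd (LINT u|V \<omega> (fst z) (snd z). u)"
        by (rule integral_bounded_linear[OF bounded_linear_snd elim(2)])
      ultimately show ?case
        using tendsto_fst[OF elim(1)] tendsto_snd[OF elim(1)]
        by (simp add: fst_sum snd_sum divide_inverse mult.commute)
    qed
    with 1 2 s show ?thesis
      by blast
  qed
  have all: "AE \<omega> in M'. Cw_tendsto T l \<gamma> (\<lambda>n t x. fst (U' n \<omega> t x)) (\<lambda>t x. LINT s|V \<omega> t x. fst s) \<and>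
      Cw_tendsto T l ?p (\<lambda>n t x. snd (U' n \<omega> t x)) (\<lambda>t x. LINT s|V \<omega> t x. snd s) \<and>
      (\<exists>r. strict_mono r \<and>
          (AE z in lebesgue_on ({0<..<T} \<times> torus l).
             (\<lambda>N. (\<Sum>k=1..N. fst (U' (r k) \<omega> (fst z) (snd z))) / real N)
               \<longlonglongrightarrow> (LINT u|V \<omega> (fst z) (snd z). fst u) \<and>
             (\<lambda>N. (\<Sum>k=1..N. snd (U' (r k) \<omega> (fst z) (snd z))) /\<^sub>R real N)
               \<longlonglongrightarrow> (LINT u|V \<omega> (fst z) (snd z). snd u)))"
    using AE_space young Cw int cont[OF reg(1)] cont[OF reg(2)]
    by eventually_elim (rule path)
  then show ?thesis
    by (intro conjI exI[of _ "\<lambda>k. k"]) (auto simp: strict_mono_def elim: eventually_mono)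
qed

end
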